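(* Let $S=\langle a,b\rangle$ be an arbitrary bisimple monogenic orthodox semigroup such that $a$ (and hence $b$) has infinite order; that is, $S$ is a bisimple orthodox semigroup generated by two elements $a,b$ of infinite order satisfying $aba=a$ and $bab=b$. Then $S$ is strongly lattice determined: for every semigroup $T$ and every lattice isomorphism $\Phi$ of the lattice of subsemigroups of $S$ onto the lattice of subsemigroups of $T$, there is an isomorphism or an antiisomorphism $\varphi$ of $S$ onto $T$ such that $U\Phi=U\varphi$ for every subsemigroup $U$ of $S$.
   Context: An orthodox semigroup is a regular semigroup whose idempotents form a subsemigroup. A monogenic orthodox semigroup $S=\langle a,b\rangle$ is an orthodox semigroup generated (as a semigroup) by a pair of mutually inverse elements $a,b$, i.e. $aba=a$, $bab=b$. A semigroup is bisimple if it has a single $\mathcal D$-class. The order of an element $x$ is the cardinality of the cyclic subsemigroup $\langle x\rangle$. The set of all subsemigroups of a semigroup, with the empty set included by convention as a subsemigroup, is a lattice under inclusion. Mappings are written on the right; $U\varphi$ is the image of the set $U$ under $\varphi$. An antiisomorphism of $S$ onto $T$ is a bijection $\varphi$ with $(xy)\varphi=(y\varphi)(x\varphi)$ for all $x,y\in S$. *)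

theory Defs
  imports Main "HOL.Hull"
begin

(* Semigroups are types of class semigroup_mult, and carriers are whole types.
   The empty set is a subsemigroup by convention, so the generated subsemigroup is
   an intersection of subsemigroups without exception. *)

definition subsemigroup :: "'a::semigroup_mult set \<Rightarrow> bool" where
  "subsemigroup U \<longleftrightarrow> (\<forall>x\<in>U. \<forall>y\<in>U. x * y \<in> U)"

definition generated :: "'a::semigroup_mult set \<Rightarrow> 'a set" where
  "generated X = subsemigroup hull X"

definition infinite_order :: "'a::semigroup_mult \<Rightarrow> bool" where
  "infinite_order x \<longleftrightarrow> infinite (generated {x})"

definition mutually_inverse :: "'a::semigroup_mult \<Rightarrow> 'a \<Rightarrow> bool" where
  "mutually_inverse a b \<longleftrightarrow> a * b * a = a \<and> b * a * b = b"

definition idempotents :: "'a::semigroup_mult set" where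
  "idempotents = {e. e * e = e}"

definition regular_semigroup :: "'a::semigroup_mult itself \<Rightarrow> bool" where
  "regular_semigroup _ \<longleftrightarrow> (\<forall>x::'a. \<exists>y. x * y * x = x)"

definition orthodox_semigroup :: "'a::semigroup_mult itself \<Rightarrow> bool" where
  "orthodox_semigroup S \<longleftrightarrow> regular_semigroup S \<and> subsemigroup (idempotents :: 'a set)"

(* The principal one-sided ideals S\<^sup>1 x and x S\<^sup>1; S\<^sup>1 itself is avoided by
   inserting x. *)

definition principal_left_ideal :: "'a::semigroup_mult \<Rightarrow> 'a set" where
  "principal_left_ideal x = insert x {s * x | s. True}"

definition principal_right_ideal :: "'a::semigroup_mult \<Rightarrow> 'a set" where
  "principal_right_ideal x = insert x {x * s | s. True}"

definition green_L :: "('a::semigroup_mult \<times> 'a) set" where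
  "green_L = {(x, y). principal_left_ideal x = principal_left_ideal y}"

definition green_R :: "('a::semigroup_mult \<times> 'a) set" where
  "green_R = {(x, y). principal_right_ideal x = principal_right_ideal y}"

(* L and R commute, so this composition is the least equivalence containing both. *)
definition green_D :: "('a::semigroup_mult \<times> 'a) set" where
  "green_D = green_L O green_R"

definition bisimple :: "'a::semigroup_mult itself \<Rightarrow> bool" where
  "bisimple _ \<longleftrightarrow> (\<forall>x y::'a. (x, y) \<in> green_D)"

(* In the lattice of subsemigroups, the meet is intersection and the join of U and V is
   the subsemigroup generated by their union.  Only the values of F on subsemigroups
   matter. *)
definition lattice_isomorphism ::
  "('a::semigroup_mult set \<Rightarrow> 'b::semigroup_mult set) \<Rightarrow> bool" where
  "lattice_isomorphism F \<longleftrightarrow>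
     bij_betw F {U. subsemigroup U} {V. subsemigroup V} \<and>
     (\<forall>U V. subsemigroup U \<longrightarrow> subsemigroup V \<longrightarrow>
        F (U \<inter> V) = F U \<inter> F V \<and>
        F (generated (U \<union> V)) = generated (F U \<union> F V))"

definition isomorphism :: "('a::semigroup_mult \<Rightarrow> 'b::semigroup_mult) \<Rightarrow> bool" where
  "isomorphism f \<longleftrightarrow> bij f \<and> (\<forall>x y. f (x * y) = f x * f y)"

definition antiisomorphism :: "('a::semigroup_mult \<Rightarrow> 'b::semigroup_mult) \<Rightarrow> bool" where
  "antiisomorphism f \<longleftrightarrow> bij f \<and> (\<forall>x y. f (x * y) = f y * f x)"

lemma subsemigroup_Int: "subsemigroup U \<Longrightarrow> subsemigroup V \<Longrightarrow> subsemigroup (U \<inter> V)"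
  by (auto simp: subsemigroup_def)

lemma subsemigroup_generated: "subsemigroup (generated X)"
  by (auto simp: generated_def hull_def subsemigroup_def)

lemma generated_subset_iff: "subsemigroup W \<Longrightarrow> generated X \<subseteq> W \<longleftrightarrow> X \<subseteq> W"
  by (auto simp: generated_def hull_def)

lemma subset_generated: "X \<subseteq> generated X"
  by (auto simp: generated_def hull_def)

lemma lattice_isomorphism_iff_order:
  "lattice_isomorphism F \<longleftrightarrow>
     bij_betw F {U. subsemigroup U} {V. subsemigroup V} \<and>
     (\<forall>U V. subsemigroup U \<longrightarrow> subsemigroup V \<longrightarrow> (U \<subseteq> V \<longleftrightarrow> F U \<subseteq> F V))"
    (is "?L \<longleftrightarrow> ?B \<and> ?O")
proof
  assume L: ?L
  then have B: ?B by (simp add: lattice_isomorphism_def)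
  have "U \<subseteq> V \<longleftrightarrow> F U \<subseteq> F V" if U: "subsemigroup U" and V: "subsemigroup V" for U V
  proof -
    have "F (U \<inter> V) = F U \<inter> F V" using L U V by (simp add: lattice_isomorphism_def)
    moreover have "F (U \<inter> V) = F U \<longleftrightarrow> U \<inter> V = U"
      using B U V subsemigroup_Int[OF U V] by (auto simp: bij_betw_def inj_on_def)
    ultimately show ?thesis by (metis inf.orderE inf.orderI)
  qed
  with B show "?B \<and> ?O" by blast
next
  assume BO: "?B \<and> ?O"
  then have im: "subsemigroup U \<Longrightarrow> subsemigroup (F U)" for U
    by (auto simp: bij_betw_def)
  have sur: "subsemigroup W \<Longrightarrow> \<exists>U. subsemigroup U \<and> F U = W" for W
    using BO by (auto simp: bij_betw_def) (metis imageE mem_Collect_eq)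
  have ord: "subsemigroup U \<Longrightarrow> subsemigroup V \<Longrightarrow> F U \<subseteq> F V \<longleftrightarrow> U \<subseteq> V" for U V
    using BO by blast
  have "F (U \<inter> V) = F U \<inter> F V \<and> F (generated (U \<union> V)) = generated (F U \<union> F V)"
    if U: "subsemigroup U" and V: "subsemigroup V" for U V
  proof
    obtain W where W: "subsemigroup W" "F W = F U \<inter> F V"
      using sur subsemigroup_Int[OF im[OF U] im[OF V]] by blast
    have "W \<subseteq> U \<inter> V" using W ord U V by (metis inf_le1 inf_le2 le_inf_iff)
    then have "F W \<subseteq> F (U \<inter> V)" using W ord subsemigroup_Int[OF U V] by blast
    moreover have "F (U \<inter> V) \<subseteq> F U" "F (U \<inter> V) \<subseteq> F V"
      using ord subsemigroup_Int[OF U V] U V by blast+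
    ultimately show "F (U \<inter> V) = F U \<inter> F V" using W by blast
    obtain Z where Z: "subsemigroup Z" "F Z = generated (F U \<union> F V)"
      using sur subsemigroup_generated by blast
    have "F U \<subseteq> F Z" "F V \<subseteq> F Z" using Z subset_generated[of "F U \<union> F V"] by auto
    then have "U \<union> V \<subseteq> Z" using ord[OF U Z(1)] ord[OF V Z(1)] by blast
    then have "generated (U \<union> V) \<subseteq> Z" using Z(1) by (simp add: generated_subset_iff)
    then have "F (generated (U \<union> V)) \<subseteq> F Z" using Z ord subsemigroup_generated by blast
    moreover have "F U \<subseteq> F (generated (U \<union> V))" "F V \<subseteq> F (generated (U \<union> V))"
      using ord U V subsemigroup_generated[of "U \<union> V"] subset_generated[of "U \<union> V"] by auto
    then have "generated (F U \<union> F V) \<subseteq> F (generated (U \<union> V))"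
      using im[OF subsemigroup_generated] by (simp add: generated_subset_iff)
    ultimately show "F (generated (U \<union> V)) = generated (F U \<union> F V)" using Z by blast
  qed
  with BO show ?L by (simp add: lattice_isomorphism_def)
qed

end

theory Submission
  imports Defs
begin

text \<open>Put e = ab.  Bisimplicity forces, up to exchanging a and b, the relation aabb = ab.  Then
  B = eSe is generated by ae and eb with (ae)(eb) = e, so it is bicyclic or infinite cyclic; xey = xy
  holds throughout, and every element is upv with u in {e, b}, p in B, v in {e, a}.  All elements are
  idempotent or of infinite order, so a lattice isomorphism comes from a bijection \<phi>, and \<phi>
  preserves powers because the identity is the only permutation of the positive integers that
  preserves sum-closed sets in both directions.  One shows that \<phi> e is an identity of \<phi>(B)
  (the alternative is a zero, which is excluded by comparing subsemigroups generated by two powers),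
  that, possibly after reversing the multiplication of T, \<phi>(ae) \<phi>(eb) = \<phi> e, and that \<phi> is
  multiplicative on B.  Finally \<phi> a and \<phi> b satisfy in T the relations of a and b, with the
  same retraction x \<mapsto> exe onto B, and this determines \<phi> on the remaining elements.\<close>

section \<open>Subsemigroups and powers\<close>

text \<open>The lattice never shows a product in \<open>T\<close>. It shows only that the preimage
  of the product of \<phi> x and \<phi> y lies in the subsemigroup generated by x and y. So each
  identity in \<open>T\<close> is found by listing the candidates that such a membership allows and
  refuting the wrong ones: a wrong one would make a set closed in \<open>T\<close> whose preimage is
  not closed in \<open>S\<close>, or would give an element of infinite order an idempotent power.

  The side of the multiplication of \<open>T\<close> is the main obstacle. If B is bicyclic, it is
  settled by which of the two products of \<phi>(ae) and \<phi>(eb) is \<phi> e. If B is a group,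
  both products are \<phi> e, and only the action of \<phi> e on \<phi> a and \<phi> b can settle
  it; the case in which \<phi> a and \<phi> b call for different sides must then be excluded.
  Multiplications are explicit arguments, not class operations, so that a reversed one can live on
  the same type; \<open>opp\<close> then turns each statement into its dual.\<close>

definition opp :: "('a \<Rightarrow> 'a \<Rightarrow> 'a) \<Rightarrow> 'a \<Rightarrow> 'a \<Rightarrow> 'a" where
  "opp f x y = f y x"

definition closed :: "('a \<Rightarrow> 'a \<Rightarrow> 'a) \<Rightarrow> 'a set \<Rightarrow> bool" where
  "closed f U \<longleftrightarrow> (\<forall>x\<in>U. \<forall>y\<in>U. f x y \<in> U)"

definition gen :: "('a \<Rightarrow> 'a \<Rightarrow> 'a) \<Rightarrow> 'a set \<Rightarrow> 'a set" where
  "gen f X = closed f hull X"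

text \<open>The start value \<open>e\<close> serves as zeroth power, so exponent 0 makes sense in a
  local monoid with identity \<open>e\<close>.\<close>

definition mpow :: "('a \<Rightarrow> 'a \<Rightarrow> 'a) \<Rightarrow> 'a \<Rightarrow> 'a \<Rightarrow> nat \<Rightarrow> 'a" where
  "mpow f e x n = (f x ^^ n) e"

(* The exponent 0 is junk: pw f x 0 = x. *)
definition pw :: "('a \<Rightarrow> 'a \<Rightarrow> 'a) \<Rightarrow> 'a \<Rightarrow> nat \<Rightarrow> 'a" where
  "pw f x n = mpow f x x (n - 1)"

text \<open>Infinite order, phrased through exponents because these are what a bijection of cyclic
  subsemigroups permutes. The name does not refer to trivial subgroups.\<close>

definition aperiodic :: "('a \<Rightarrow> 'a \<Rightarrow> 'a) \<Rightarrow> 'a \<Rightarrow> bool" where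
  "aperiodic f x \<longleftrightarrow> inj_on (pw f x) {1..}"

lemma opp_apply [simp]: "opp f x y = f y x"
  by (simp add: opp_def)

lemma closed_opp [simp]: "closed (opp f) = closed f"
  by (auto simp: closed_def fun_eq_iff)

lemma gen_opp [simp]: "gen (opp f) = gen f"
  by (simp add: gen_def fun_eq_iff)

lemma closedD: "closed f U \<Longrightarrow> x \<in> U \<Longrightarrow> y \<in> U \<Longrightarrow> f x y \<in> U"
  by (simp add: closed_def)

lemma closedI: "(\<And>x y. x \<in> U \<Longrightarrow> y \<in> U \<Longrightarrow> f x y \<in> U) \<Longrightarrow> closed f U"
  by (simp add: closed_def)

lemma closed_gen: "closed f (gen f X)"
  by (auto simp: gen_def hull_def closed_def)

lemma gen_superset: "X \<subseteq> gen f X"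
  by (auto simp: gen_def hull_def)

lemma gen_minimal: "closed f U \<Longrightarrow> X \<subseteq> U \<Longrightarrow> gen f X \<subseteq> U"
  by (auto simp: gen_def hull_def)

lemma gen_base: "x \<in> X \<Longrightarrow> x \<in> gen f X"
  by (rule subsetD[OF gen_superset])

lemma gen_single_subset_iff: "closed f U \<Longrightarrow> gen f {x} \<subseteq> U \<longleftrightarrow> x \<in> U"
  using gen_minimal[of f U "{x}"] gen_base[of x "{x}" f] by blast

lemma gen_mult: "x \<in> gen f X \<Longrightarrow> y \<in> gen f X \<Longrightarrow> f x y \<in> gen f X"
  by (rule closedD[OF closed_gen])

lemma gen_induct [consumes 1, case_names base mult]:
  assumes "x \<in> gen f X" "\<And>x. x \<in> X \<Longrightarrow> P x" "\<And>x y. P x \<Longrightarrow> P y \<Longrightarrow> P (f x y)"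
  shows "P x"
proof -
  have "gen f X \<subseteq> {x. P x}"
  proof (rule gen_minimal)
    show "closed f {x. P x}" by (rule closedI) (simp add: assms(3))
    show "X \<subseteq> {x. P x}" using assms(2) by blast
  qed
  then show ?thesis using assms(1) by (rule subsetD[THEN CollectD])
qed

lemma mpow_0 [simp]: "mpow f e x 0 = e"
  by (simp add: mpow_def)

lemma mpow_Suc: "mpow f e x (Suc n) = f x (mpow f e x n)"
  by (simp add: mpow_def)

lemma pw_1 [simp]: "pw f x 1 = x" "pw f x (Suc 0) = x"
  by (simp_all add: pw_def)

lemma pw_Suc: "n \<ge> 1 \<Longrightarrow> pw f x (Suc n) = f x (pw f x n)"
  by (cases n) (simp_all add: pw_def mpow_Suc)

lemma aperiodicD: "aperiodic f x \<Longrightarrow> pw f x m = pw f x n \<Longrightarrow> m \<ge> 1 \<Longrightarrow> n \<ge> 1 \<Longrightarrow> m = n"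
  by (auto simp: aperiodic_def dest: inj_onD)

section \<open>Powers, cyclic subsemigroups and their generators\<close>

context semigroup
begin

lemma opp_semigroup: "semigroup (opp f)"
  by standard (simp add: assoc)

lemma pw_add: "m \<ge> 1 \<Longrightarrow> n \<ge> 1 \<Longrightarrow> pw f x (m + n) = pw f x m \<^bold>* pw f x n"
proof (induction m rule: nat_induct_at_least)
  case base
  then show ?case using pw_Suc[of n f x] by simp
next
  case (Suc m)
  then show ?case using pw_Suc[of "m + n" f x] pw_Suc[of m f x] by (simp add: assoc)
qed

lemma pw_mult: "n \<ge> 1 \<Longrightarrow> m \<ge> 1 \<Longrightarrow> pw f (pw f x m) n = pw f x (m * n)"
proof (induction n rule: nat_induct_at_least)
  case (Suc n)
  then show ?case using pw_add[of m "m * n" x] pw_Suc[of n f "pw f x m"] by simp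
qed simp

lemma pw_Suc2: "n \<ge> 1 \<Longrightarrow> pw f x (Suc n) = pw f x n \<^bold>* x"
  using pw_add[of n 1 x] by simp

lemma pw_opp: "n \<ge> 1 \<Longrightarrow> pw (opp f) x n = pw f x n"
proof (induction n rule: nat_induct_at_least)
  case (Suc n)
  have "pw (opp f) x (Suc n) = opp f x (pw (opp f) x n)" using Suc by (simp only: pw_Suc)
  also have "\<dots> = pw f x (Suc n)" unfolding Suc opp_apply using pw_Suc2[of n x] Suc by simp
  finally show ?case .
qed simp

lemma aperiodic_opp [simp]: "aperiodic (opp f) x \<longleftrightarrow> aperiodic f x"
  unfolding aperiodic_def by (rule inj_on_cong) (simp add: pw_opp)

lemma pw_in: "n \<ge> 1 \<Longrightarrow> closed f U \<Longrightarrow> x \<in> U \<Longrightarrow> pw f x n \<in> U"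
  by (induction n rule: nat_induct_at_least) (simp_all add: pw_Suc closedD)

lemma gen_single: "gen f {x} = {pw f x n | n. n \<ge> 1}"
proof (rule antisym)
  show "gen f {x} \<subseteq> {pw f x n | n. n \<ge> 1}"
  proof (rule gen_minimal)
    show "closed f {pw f x n | n. n \<ge> 1}"
    proof (rule closedI)
      fix y z assume "y \<in> {pw f x n | n. n \<ge> 1}" "z \<in> {pw f x n | n. n \<ge> 1}"
      then obtain m n where "y = pw f x m" "z = pw f x n" "m \<ge> 1" "n \<ge> 1" by blast
      then have "y \<^bold>* z = pw f x (m + n) \<and> m + n \<ge> 1" by (simp add: pw_add)
      then show "y \<^bold>* z \<in> {pw f x n | n. n \<ge> 1}" by blast
    qed
    show "{x} \<subseteq> {pw f x n | n. n \<ge> 1}"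
      using pw_1(1)[of f x] by (metis (mono_tags, lifting) empty_subsetI insert_subset le_refl mem_Collect_eq)
  qed
  show "{pw f x n | n. n \<ge> 1} \<subseteq> gen f {x}"
    using pw_in[OF _ closed_gen gen_base, of _ x "{x}"] by blast
qed

lemma pw_gen: "n \<ge> 1 \<Longrightarrow> x \<in> gen f X \<Longrightarrow> pw f x n \<in> gen f X"
  by (rule pw_in[OF _ closed_gen])

lemma pw_idem: "n \<ge> 1 \<Longrightarrow> x \<^bold>* x = x \<Longrightarrow> pw f x n = x"
  by (induction n rule: nat_induct_at_least) (simp_all add: pw_Suc)

lemma gen_idem: "x \<^bold>* x = x \<Longrightarrow> gen f {x} = {x}"
  using gen_minimal[of f "{x}" "{x}"] gen_superset[of "{x}" f] by (simp add: closed_def)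

lemma aperiodic_not_idem: "aperiodic f x \<Longrightarrow> n \<ge> 1 \<Longrightarrow> pw f x n \<^bold>* pw f x n \<noteq> pw f x n"
  using aperiodicD[of f x "n + n" n] by (auto simp: pw_add)

lemma aperiodic_not_idem1: "aperiodic f x \<Longrightarrow> x \<^bold>* x \<noteq> x"
  using aperiodic_not_idem[of x 1] by simp

text \<open>If x^i = x^(i+d), then adding multiples of d to an exponent that is at least i changes
  nothing. The exponent i * d is at least i and is itself a multiple of d, so doubling it changes
  nothing.\<close>

lemma not_aperiodic_idem:
  assumes "\<not> aperiodic f x"
  obtains n where "n \<ge> 1" "pw f x n \<^bold>* pw f x n = pw f x n"
proof -
  obtain i j where ij: "i \<ge> 1" "j \<ge> 1" "pw f x i = pw f x j" "i < j"
    using assms unfolding aperiodic_def inj_on_def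
    by (metis atLeast_iff linorder_neqE_nat)
  define d where "d = j - i"
  have d: "d \<ge> 1" "pw f x (i + d) = pw f x i"
    using ij by (auto simp: d_def)
  have step: "pw f x (m + d) = pw f x m" if "m \<ge> i" for m
  proof (cases "m = i")
    case False
    with that have "m = i + (m - i)" "m - i \<ge> 1" by auto
    then have "pw f x (m + d) = pw f x ((i + d) + (m - i))" by (simp add: add_ac)
    also have "\<dots> = pw f x i \<^bold>* pw f x (m - i)"
      using pw_add[of "i + d" "m - i" x] \<open>m - i \<ge> 1\<close> d by simp
    also have "\<dots> = pw f x (i + (m - i))" using pw_add[of i "m - i" x] \<open>m - i \<ge> 1\<close> ij by simp
    finally show ?thesis using that by simp
  qed (use d in simp)
  have "pw f x (m + k * d) = pw f x m" if "m \<ge> i" for m k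
  proof (induction k)
    case (Suc k)
    have "m + Suc k * d = (m + k * d) + d" by simp
    then show ?case using Suc step[of "m + k * d"] that by (simp only: le_add1 trans_le_add1)
  qed simp
  from this[of "i * d" i] have "pw f x (i * d + i * d) = pw f x (i * d)"
    using d by simp
  then show ?thesis
    using pw_add[of "i * d" "i * d" x] that[of "i * d"] d ij by simp
qed

text \<open>From x = y^i and y = x^j follows x = x^(j*i). Infinite order forces i = j = 1; an
  idempotent x equals x^j = y at once.\<close>

lemma gen_single_inj:
  assumes "x \<^bold>* x = x \<or> aperiodic f x" "gen f {x} = gen f {y}"
  shows "x = y"
proof -
  have "x \<in> gen f {y}" "y \<in> gen f {x}"
    using gen_base[of x "{x}" f] gen_base[of y "{y}" f] assms(2) by auto
  then obtain i j where ij: "x = pw f y i" "y = pw f x j" "i \<ge> 1" "j \<ge> 1"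
    by (auto simp: gen_single)
  then have "pw f x (j * i) = pw f x 1" using pw_mult[of i j x] by simp
  with assms(1) ij show ?thesis
    using aperiodicD[of f x "j * i" 1] pw_idem[of j x] by force
qed

end

section \<open>Permutations preserving sum-closed sets\<close>

text \<open>These are the subsemigroups of the positive integers under addition. The value at 0 is
  ignored, in keeping with the junk exponent 0 of \<open>pw\<close>.\<close>

definition sum_closed :: "(nat \<Rightarrow> bool) \<Rightarrow> bool" where
  "sum_closed P \<longleftrightarrow> (\<forall>i\<ge>1. \<forall>j\<ge>1. P i \<longrightarrow> P j \<longrightarrow> P (i + j))"

definition sum_closed_preserving :: "(nat \<Rightarrow> nat) \<Rightarrow> (nat \<Rightarrow> nat) \<Rightarrow> bool" where
  "sum_closed_preserving s t \<longleftrightarrow>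
     (\<forall>k\<ge>1. s k \<ge> 1 \<and> t k \<ge> 1 \<and> s (t k) = k \<and> t (s k) = k) \<and>
     (\<forall>P. sum_closed P \<longleftrightarrow> sum_closed (\<lambda>k. P (s k)))"

lemma sum_closedD: "sum_closed P \<Longrightarrow> P i \<Longrightarrow> P j \<Longrightarrow> i \<ge> 1 \<Longrightarrow> j \<ge> 1 \<Longrightarrow> P (i + j)"
  by (simp add: sum_closed_def)

lemma sum_closed_cong: "(\<And>k. k \<ge> 1 \<Longrightarrow> P k = Q k) \<Longrightarrow> sum_closed P = sum_closed Q"
  by (simp add: sum_closed_def)

lemma sum_closed_preserving_iff:
  "sum_closed_preserving s t \<Longrightarrow> sum_closed (\<lambda>k. P (s k)) \<longleftrightarrow> sum_closed P"
  unfolding sum_closed_preserving_def by blast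

lemma sum_closed_preserving_inv:
  assumes "sum_closed_preserving s t"
  shows "sum_closed_preserving t s"
proof -
  have "sum_closed P \<longleftrightarrow> sum_closed (\<lambda>k. P (t k))" for P
  proof -
    have "sum_closed P \<longleftrightarrow> sum_closed (\<lambda>k. P (t (s k)))"
      by (rule sum_closed_cong) (use assms in \<open>simp add: sum_closed_preserving_def\<close>)
    also have "\<dots> \<longleftrightarrow> sum_closed (\<lambda>k. P (t k))"
      by (rule sum_closed_preserving_iff[OF assms])
    finally show ?thesis .
  qed
  moreover have "\<forall>k\<ge>1. t k \<ge> 1 \<and> s k \<ge> 1 \<and> t (s k) = k \<and> s (t k) = k"
    using assms by (simp add: sum_closed_preserving_def)
  ultimately show ?thesis unfolding sum_closed_preserving_def by blast
qed

text \<open>Doubling is an isomorphism of the positive integers onto the even ones; this is what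
  makes the halving in \<open>sum_closed_preserving_half\<close> work.\<close>

lemma sum_closed_even: "sum_closed (\<lambda>k. even k \<and> R k) \<longleftrightarrow> sum_closed (\<lambda>k. R (2 * k))"
proof
  assume *: "sum_closed (\<lambda>k. even k \<and> R k)"
  show "sum_closed (\<lambda>k. R (2 * k))"
    unfolding sum_closed_def
    using sum_closedD[OF *, of "2 * _" "2 * _"] by (simp add: distrib_left)
next
  assume *: "sum_closed (\<lambda>k. R (2 * k))"
  show "sum_closed (\<lambda>k. even k \<and> R k)"
    unfolding sum_closed_def
  proof (intro allI impI)
    fix i j :: nat assume "1 \<le> i" "1 \<le> j" "even i \<and> R i" "even j \<and> R j"
    moreover from this obtain i' j' where "i = 2 * i'" "j = 2 * j'" by (auto elim!: evenE)
    ultimately show "even (i + j) \<and> R (i + j)"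
      using sum_closedD[OF *, of i' j'] by (simp add: distrib_left)
  qed
qed

text \<open>Each claim moves a sum-closed set along \<open>s\<close> or \<open>t\<close> and finds
  an excluded number that is a sum of members. Parity follows because the fixed number 2 generates
  the even numbers.\<close>

lemma sum_closed_preserving_2:
  assumes "sum_closed_preserving s t"
  shows "s 1 = 1" "s 2 = 2" "k \<ge> 1 \<Longrightarrow> even (s k) = even k"
proof -
  have inv: "k \<ge> 1 \<Longrightarrow> s k \<ge> 1 \<and> t k \<ge> 1 \<and> s (t k) = k \<and> t (s k) = k" for k
    using assms by (simp add: sum_closed_preserving_def)
  have pull: "sum_closed P \<Longrightarrow> sum_closed (\<lambda>k. P (s k))" for P
    by (simp only: sum_closed_preserving_iff[OF assms])
  have push: "sum_closed P \<Longrightarrow> sum_closed (\<lambda>k. P (t k))" for P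
    by (simp only: sum_closed_preserving_iff[OF sum_closed_preserving_inv[OF assms]])
  show s1: "s 1 = 1"
  proof (rule ccontr)
    assume "s 1 \<noteq> 1"
    with inv[of 1] have s1: "s 1 \<ge> 2" by simp
    have *: "sum_closed (\<lambda>k. s k \<ge> 2)" by (rule pull) (simp add: sum_closed_def)
    have "s k \<ge> 2" if "k \<ge> 1" for k
      using that by (induction k rule: nat_induct_at_least)
        (use s1 sum_closedD[OF *, of _ 1] in auto)
    from this[of "t 1"] inv[of 1] show False by simp
  qed
  then have t1: "t 1 = 1" using inv[of 1] by (metis order_refl)
  have s21: "s 2 \<noteq> 1" using inv[of 2] t1 by fastforce
  have s2: "s 2 = 2 \<or> s 2 = 3"
  proof (rule ccontr)
    assume "\<not> ?thesis"
    with s21 inv[of 2] have ge: "s 2 \<ge> 4" by linarith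
    \<comment> \<open>The only positive integers outside this set are 1 and \<open>s 2\<close>.
      Hence 2 and \<open>s 2 - 2\<close> belong to it, and so would their sum
      \<open>s 2\<close>.\<close>
    have *: "sum_closed (\<lambda>k. t k \<ge> 3)" by (rule push) (simp add: sum_closed_def)
    have big: "t m \<ge> 3" if "m \<ge> 2" "m \<noteq> s 2" for m
    proof -
      have "t m \<noteq> 1" "t m \<noteq> 2" "t m \<ge> 1" using inv[of m] s1 that by auto
      then show ?thesis by linarith
    qed
    have "t (2 + (s 2 - 2)) \<ge> 3"
      by (rule sum_closedD[OF *]) (use big[of 2] big[of "s 2 - 2"] ge in auto)
    moreover have "2 + (s 2 - 2) = s 2" using ge by simp
    ultimately show False using inv[of 2] ge by simp
  qed
  have "s 2 \<noteq> 3"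
  proof
    assume s3: "s 2 = 3"
    \<comment> \<open>The multiples of 3 pull back to a set that contains 2, hence also 4. This
      makes \<open>s 4\<close> a multiple of 3 other than 3.\<close>
    have "sum_closed (\<lambda>k. 3 dvd s k)" by (rule pull) (simp add: sum_closed_def)
    from sum_closedD[OF this, of 2 2] have d: "3 dvd s 4" using s3 by simp
    moreover have "s 4 \<noteq> 3" using inv[of 2] inv[of 4] s3 by auto
    ultimately have ge: "s 4 \<ge> 6" using inv[of 4] by (auto elim!: dvdE)
    \<comment> \<open>The same argument with the gaps 1, 2, 4, which \<open>s\<close> sends to 1, 3
      and \<open>s 4\<close>: the forbidden sum is now 2 + (\<open>s 4\<close> - 2).\<close>
    have *: "sum_closed (\<lambda>k. t k \<ge> 3 \<and> t k \<noteq> 4)" by (rule push) (auto simp: sum_closed_def)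
    have big: "t m \<ge> 3 \<and> t m \<noteq> 4" if "m \<ge> 2" "m \<noteq> 3" "m \<noteq> s 4" for m
    proof -
      have "t m \<noteq> 1" "t m \<noteq> 2" "t m \<noteq> 4" "t m \<ge> 1" using inv[of m] s1 s3 that by auto
      then show ?thesis by linarith
    qed
    have "t (2 + (s 4 - 2)) \<ge> 3 \<and> t (2 + (s 4 - 2)) \<noteq> 4"
      by (rule sum_closedD[OF *]) (use big[of 2] big[of "s 4 - 2"] ge in auto)
    moreover have "2 + (s 4 - 2) = s 4" using ge by simp
    ultimately show False using inv[of 4] ge by simp
  qed
  with s2 show s22: "s 2 = 2" by simp
  then have t22: "t 2 = 2" using inv[of 2] by (metis one_le_numeral)
  have even_dbl: "even (h (2 * m))" if "sum_closed (\<lambda>k. even (h k))" "h 2 = 2" "m \<ge> 1" for h :: "nat \<Rightarrow> nat" and m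
    using that(3)
  proof (induction m rule: nat_induct_at_least)
    case (Suc m)
    then show ?case using sum_closedD[OF that(1), of "2 * m" 2] that(2) by simp
  qed (use that in simp)
  have e: "sum_closed even" by (simp add: sum_closed_def)
  show "even (s k) = even k" if k: "k \<ge> 1"
  proof
    assume "even (s k)"
    then obtain m where m: "s k = 2 * m" by (auto elim: evenE)
    with inv[OF k] have "m \<ge> 1" by (cases m) auto
    with even_dbl[OF push[OF e] t22 this] inv[OF k] m show "even k" by simp
  next
    assume "even k"
    then obtain m where m: "k = 2 * m" by (auto elim: evenE)
    with k have "m \<ge> 1" by (cases m) auto
    with even_dbl[OF pull[OF e] s22 this] m show "even (s k)" by simp
  qed
qed

lemma sum_closed_preserving_half:
  assumes "sum_closed_preserving s t"
  shows "sum_closed_preserving (\<lambda>k. s (2 * k) div 2) (\<lambda>k. t (2 * k) div 2)"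
proof -
  have inv: "k \<ge> 1 \<Longrightarrow> s k \<ge> 1 \<and> t k \<ge> 1 \<and> s (t k) = k \<and> t (s k) = k" for k
    using assms by (simp add: sum_closed_preserving_def)
  have ev: "k \<ge> 1 \<Longrightarrow> even (s k) = even k" for k
    using sum_closed_preserving_2(3)[OF assms] by simp
  have evt: "k \<ge> 1 \<Longrightarrow> even (t k) = even k" for k
    using ev[of "t k"] inv[of k] by simp
  have half: "j \<ge> 1 \<Longrightarrow> even j \<Longrightarrow> j div 2 \<ge> (1::nat)" for j
    by (auto elim!: evenE)
  have "sum_closed P \<longleftrightarrow> sum_closed (\<lambda>k. P (s (2 * k) div 2))" for P
  proof -
    have "sum_closed P \<longleftrightarrow> sum_closed (\<lambda>k. even k \<and> P (k div 2))"
      by (simp add: sum_closed_even)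
    also have "\<dots> \<longleftrightarrow> sum_closed (\<lambda>k. even (s k) \<and> P (s k div 2))"
      by (rule sum_closed_preserving_iff[OF assms, symmetric])
    also have "\<dots> \<longleftrightarrow> sum_closed (\<lambda>k. even k \<and> P (s k div 2))"
      by (rule sum_closed_cong) (simp add: ev)
    finally show ?thesis by (simp add: sum_closed_even)
  qed
  moreover have "s (2 * k) div 2 \<ge> 1 \<and> t (2 * k) div 2 \<ge> 1 \<and>
      s (2 * (t (2 * k) div 2)) div 2 = k \<and> t (2 * (s (2 * k) div 2)) div 2 = k" if "k \<ge> 1" for k
  proof -
    have "2 * k \<ge> 1" using that by simp
    note * = inv[OF this] ev[OF this] evt[OF this]
    then show ?thesis using half[of "s (2 * k)"] half[of "t (2 * k)"] by simp
  qed
  ultimately show ?thesis by (simp add: sum_closed_preserving_def)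
qed

text \<open>For even n the halved permutation reduces the claim to n div 2, which is why the
  induction generalizes over \<open>s\<close> and \<open>t\<close>. For odd n all smaller numbers
  are fixed already, so only a jump of \<open>s n\<close> above n has to be refuted.\<close>

lemma sum_closed_preserving_id:
  assumes "sum_closed_preserving s t" "n \<ge> 1"
  shows "s n = n"
  using assms
proof (induction n arbitrary: s t rule: less_induct)
  case (less n)
  note st = less.prems(1)
  have inv: "k \<ge> 1 \<Longrightarrow> s k \<ge> 1 \<and> t k \<ge> 1 \<and> s (t k) = k \<and> t (s k) = k" for k
    using st by (simp add: sum_closed_preserving_def)
  note two = sum_closed_preserving_2[OF st]
  show ?case
  proof (cases "even n")
    case True
    then obtain m where m: "n = 2 * m" by (auto elim: evenE)
    with less.prems have "m \<ge> 1" "m < n" by auto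
    then have "s (2 * m) div 2 = m"
      using less.IH[OF _ sum_closed_preserving_half[OF st]] by simp
    moreover have "even (s (2 * m))" using two(3)[of n] m less.prems by simp
    ultimately show ?thesis using m by auto
  next
    case odd: False
    have IH: "s k = k" if "k \<ge> 1" "k < n" for k using less.IH[OF that(2) st that(1)] .
    have "s n \<ge> n"
    proof (rule ccontr)
      assume "\<not> s n \<ge> n"
      then have "s n < n" by simp
      then show False using IH[of "s n"] inv[of n] inv[of "s n"] less.prems(2) by auto
    qed
    moreover have "\<not> s n > n"
    proof
      assume gt: "s n > n"
      have "odd (s n)" using two(3)[OF less.prems(2)] odd by simp
      with gt odd have gt2: "s n \<ge> n + 2" 
        by (cases "s n = n + 1") auto
      \<comment> \<open>This set omits only the odd numbers up to n. Its image under
        \<open>s\<close> contains 2 and \<open>s n - 2\<close>, so it would contain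
        \<open>s n\<close>, although n itself is omitted.\<close>
      have "sum_closed (\<lambda>k. even k \<or> k > n)" by (auto simp: sum_closed_def)
      then have *: "sum_closed (\<lambda>k. even (t k) \<or> t k > n)"
        using sum_closed_preserving_iff[OF sum_closed_preserving_inv[OF st],
            of "\<lambda>k. even k \<or> k > n"] by blast
      define m where "m = s n - 2"
      have m: "m \<ge> n" "m \<ge> 1" "m + 2 = s n" using gt2 less.prems by (auto simp: m_def)
      have "t m > n"
      proof (rule ccontr)
        assume "\<not> t m > n"
        then consider "t m = n" | "t m < n" by linarith
        then show False
        proof cases
          case 1
          then show False using inv[OF m(2)] m by auto
        next
          case 2
          then show False using IH[of "t m"] inv[OF m(2)] m by simp
        qed
      qed
      moreover have "t 2 = 2" using two(2) inv[of 2] by (metis one_le_numeral)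
      ultimately have "even (t (m + 2)) \<or> t (m + 2) > n"
        using m by (intro sum_closedD[OF *]) auto
      then show False using m inv[OF less.prems(2)] odd by simp
    qed
    ultimately show ?thesis by linarith
  qed
qed

section \<open>Lattice isomorphisms induced by bijections\<close>

locale lattice_iso = S: semigroup f + T: semigroup g
  for f :: "'a \<Rightarrow> 'a \<Rightarrow> 'a" and g :: "'b \<Rightarrow> 'b \<Rightarrow> 'b" +
  fixes \<Phi> :: "'a set \<Rightarrow> 'b set"
  assumes bij: "bij_betw \<Phi> {U. closed f U} {V. closed g V}"
    and ord: "closed f U \<Longrightarrow> closed f V \<Longrightarrow> \<Phi> U \<subseteq> \<Phi> V \<longleftrightarrow> U \<subseteq> V"
begin

definition \<Psi> :: "'b set \<Rightarrow> 'a set" where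
  "\<Psi> = inv_into {U. closed f U} \<Phi>"

lemma closed_img: "closed f U \<Longrightarrow> closed g (\<Phi> U)"
  using bij by (auto simp: bij_betw_def)

lemma inv_closed: "closed g V \<Longrightarrow> closed f (\<Psi> V)"
  using bij_betw_inv_into[OF bij] by (auto simp: bij_betw_def \<Psi>_def)

lemma img_inv: "closed g V \<Longrightarrow> \<Phi> (\<Psi> V) = V"
  using bij by (simp add: bij_betw_inv_into_right \<Psi>_def)

lemma inv_img: "closed f U \<Longrightarrow> \<Psi> (\<Phi> U) = U"
  using bij by (simp add: bij_betw_inv_into_left \<Psi>_def)

lemma lattice_iso_inv: "lattice_iso g f \<Psi>"
proof
  show "bij_betw \<Psi> {U. closed g U} {V. closed f V}"
    unfolding \<Psi>_def by (rule bij_betw_inv_into[OF bij])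
  show "\<Psi> U \<subseteq> \<Psi> V \<longleftrightarrow> U \<subseteq> V" if "closed g U" "closed g V" for U V
    using ord[OF inv_closed inv_closed, OF that] that by (simp add: img_inv)
qed

lemma inj: "closed f U \<Longrightarrow> closed f V \<Longrightarrow> \<Phi> U = \<Phi> V \<Longrightarrow> U = V"
  by (metis inv_img)

text \<open>An element x that is idempotent or aperiodic generates a subsemigroup with a largest
  proper subsemigroup, and anything outside the image of the latter generates the image.\<close>

lemma image_cyclic:
  assumes x: "f x x = x \<or> aperiodic f x"
  obtains y where "\<Phi> (gen f {x}) = gen g {y}"
proof -
  define M where "M = gen f {x} - {x}"
  have M: "closed f M"
  proof (rule closedI)
    fix y z assume "y \<in> M" "z \<in> M"
    then obtain m n where mn: "y = pw f x m" "z = pw f x n" "m \<ge> 1" "n \<ge> 1" "y \<noteq> x" "z \<noteq> x"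
      by (auto simp: M_def S.gen_single)
    then have "f y z = pw f x (m + n)" by (simp add: S.pw_add)
    moreover have "aperiodic f x" using x mn S.pw_idem by metis
    then have "pw f x (m + n) \<noteq> x" using aperiodicD[of f x "m + n" 1] mn by auto
    moreover have "pw f x (m + n) \<in> gen f {x}"
      by (rule S.pw_gen) (use mn in \<open>simp_all add: gen_base\<close>)
    ultimately show "f y z \<in> M" by (simp add: M_def)
  qed
  have "x \<in> gen f {x}" by (simp add: gen_base)
  then have "\<not> gen f {x} \<subseteq> M" by (auto simp: M_def)
  then have "\<not> \<Phi> (gen f {x}) \<subseteq> \<Phi> M" using ord[OF closed_gen M] by simp
  then obtain y where y: "y \<in> \<Phi> (gen f {x})" "y \<notin> \<Phi> M" by blast
  define V where "V = \<Psi> (gen g {y})"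
  have V: "closed f V" "\<Phi> V = gen g {y}" by (simp_all add: V_def inv_closed img_inv closed_gen)
  have "gen g {y} \<subseteq> \<Phi> (gen f {x})"
    using y closed_img[OF closed_gen] by (simp add: gen_single_subset_iff)
  then have sub: "V \<subseteq> gen f {x}" using ord[OF V(1) closed_gen] V by simp
  have "x \<in> V"
  proof (rule ccontr)
    assume "x \<notin> V"
    with sub have "V \<subseteq> M" by (auto simp: M_def)
    then have "gen g {y} \<subseteq> \<Phi> M" using ord[OF V(1) M] V by simp
    then show False using y(2) gen_base[of y "{y}" g] by auto
  qed
  then have "gen f {x} \<subseteq> V" using V by (simp add: gen_single_subset_iff)
  with sub have "V = gen f {x}" by simp
  with V that show thesis by simp
qed

text \<open>The set \<open>{u}\<close> is an atom of the lattice, so its preimage is a minimal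
  nonempty subsemigroup. An aperiodic h cannot lie in one, because h^2 generates a smaller
  subsemigroup; what remains is a single idempotent.\<close>

lemma idem_inv:
  assumes u: "g u u = u" and S: "\<And>x. f x x = x \<or> aperiodic f x"
  obtains h where "f h h = h" "\<Phi> {h} = {u}"
proof -
  define V where "V = \<Psi> {u}"
  have cu: "closed g {u}" using u by (simp add: closed_def)
  have V: "closed f V" "\<Phi> V = {u}" by (simp_all add: V_def inv_closed img_inv cu)
  have e: "closed f {}" by (simp add: closed_def)
  have e2: "closed g {}" by (simp add: closed_def)
  have "\<Phi> {} = {}" using ord[OF e inv_closed[OF e2]] img_inv[OF e2] by simp
  then have "V \<noteq> {}" using V by auto
  then obtain h where h: "h \<in> V" by blast
  have min: "W = V" if "closed f W" "W \<noteq> {}" "W \<subseteq> V" for W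
  proof -
    have "\<Phi> W \<subseteq> {u}" using ord[OF that(1) V(1)] that V by simp
    moreover have "\<Phi> W \<noteq> {}" using inj[OF that(1) e] \<open>\<Phi> {} = {}\<close> that by auto
    ultimately have "\<Phi> W = \<Phi> V" using V by auto
    then show ?thesis by (rule inj[OF that(1) V(1)])
  qed
  have gV: "gen f {z} = V" if "z \<in> V" for z
  proof (rule min)
    show "gen f {z} \<noteq> {}" using gen_base[of z "{z}" f] by auto
    show "gen f {z} \<subseteq> V" using that V by (simp add: gen_single_subset_iff)
  qed (rule closed_gen)
  have "f h h = h"
  proof (rule ccontr)
    assume "f h h \<noteq> h"
    with S have ap: "aperiodic f h" by blast
    have "f h h \<in> V" using closedD[OF V(1) h h] .
    then have "gen f {f h h} = V" by (rule gV)
    with h obtain n where n: "h = pw f (f h h) n" "n \<ge> 1" by (auto simp: S.gen_single)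
    have "f h h = pw f h 2" using pw_Suc[of 1 f h] by (simp add: numeral_2_eq_2)
    then have "pw f h 1 = pw f h (2 * n)" using n S.pw_mult[of n 2 h] by simp
    then show False using aperiodicD[OF ap, of 1 "2 * n"] n(2) by simp
  qed
  moreover from this have "V = {h}" using gV[OF h] by (simp add: S.gen_idem)
  ultimately show thesis using that V by simp
qed

text \<open>Suppose that a power t^n = u is idempotent, with \<open>{u}\<close> the image of
  \<open>{h}\<close>. Every x in the preimage of the subsemigroup of t generates a subsemigroup that
  contains h, because any y = t^j satisfies y^n = u. As x is idempotent or aperiodic, x = h. So the
  preimage is \<open>{h}\<close>, and t = u.\<close>

lemma idem_or_aperiodic_image:
  assumes S: "\<And>x. f x x = x \<or> aperiodic f x"
  shows "g t t = t \<or> aperiodic g t"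
proof (rule ccontr)
  assume t: "\<not> ?thesis"
  then obtain n where n: "n \<ge> 1" "g (pw g t n) (pw g t n) = pw g t n"
    using T.not_aperiodic_idem by metis
  define u where "u = pw g t n"
  obtain h where h: "f h h = h" "\<Phi> {h} = {u}"
    using idem_inv[OF _ S, of u] n by (auto simp: u_def)
  define V where "V = \<Psi> (gen g {t})"
  have V: "closed f V" "\<Phi> V = gen g {t}" by (simp_all add: V_def inv_closed img_inv closed_gen)
  have ch: "closed f {z}" if "f z z = z" for z using that by (simp add: closed_def)
  have "x = h" if x: "x \<in> V" for x
  proof -
    obtain y where y: "\<Phi> (gen f {x}) = gen g {y}" using image_cyclic S by blast
    have "gen f {x} \<subseteq> V" using x V by (simp add: gen_single_subset_iff)
    then have "gen g {y} \<subseteq> gen g {t}" using ord[OF closed_gen V(1), of "{x}"] V y by simp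
    then have yt: "y \<in> gen g {t}" using gen_base[of y "{y}" g] by auto
    then obtain j where j: "y = pw g t j" "j \<ge> 1" by (auto simp: T.gen_single)
    have "pw g y n = pw g u j" using j n T.pw_mult[of n j t] T.pw_mult[of j n t]
      by (simp add: u_def mult.commute)
    also have "\<dots> = u" using T.pw_idem[of j u] j n by (simp add: u_def)
    finally have "pw g y n = u" .
    moreover have "pw g y n \<in> gen g {y}" using n by (intro T.pw_gen gen_base) auto
    ultimately have "{u} \<subseteq> \<Phi> (gen f {x})" using y by simp
    then have hx: "h \<in> gen f {x}" using ord[OF ch[OF h(1)] closed_gen, of "{x}"] h by simp
    show ?thesis
    proof (cases "f x x = x")
      case True
      then show ?thesis using hx by (simp add: S.gen_idem)
    next
      case False
      then have "aperiodic f x" using S by blast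
      then show ?thesis using hx h(1) S.aperiodic_not_idem by (auto simp: S.gen_single)
    qed
  qed
  then have "V \<subseteq> {h}" by blast
  then have "gen g {t} \<subseteq> {u}" using ord[OF V(1) ch[OF h(1)]] V h by simp
  then have "t = u" using gen_base[of t "{t}" g] by auto
  then show False using t n by (simp add: u_def)
qed

text \<open>Cyclic subsemigroups go to cyclic ones, and in both semigroups a generator is unique;
  \<phi> matches the generators. It induces \<Phi> because x lies in U exactly if the subsemigroup
  of x lies below U.\<close>

lemma induced_by_bijection:
  assumes S: "\<And>x. f x x = x \<or> aperiodic f x"
  obtains \<phi> where "bij \<phi>" "\<And>U. closed f U \<Longrightarrow> \<Phi> U = \<phi> ` U"
proof -
  have T: "g t t = t \<or> aperiodic g t" for t using idem_or_aperiodic_image[OF S] .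
  have "\<exists>y. \<Phi> (gen f {x}) = gen g {y}" for x using image_cyclic[OF S] by metis
  then obtain \<phi> where \<phi>: "\<And>x. \<Phi> (gen f {x}) = gen g {\<phi> x}" by metis
  have "inj \<phi>"
  proof (rule injI)
    fix x y assume "\<phi> x = \<phi> y"
    then have "\<Phi> (gen f {x}) = \<Phi> (gen f {y})" by (simp add: \<phi>)
    then have "gen f {x} = gen f {y}" by (rule inj[OF closed_gen closed_gen])
    then show "x = y" using S.gen_single_inj S by blast
  qed
  moreover have surj: "\<exists>x. t = \<phi> x" for t
  proof -
    obtain x where x: "\<Psi> (gen g {t}) = gen f {x}"
      using lattice_iso.image_cyclic[OF lattice_iso_inv, of t] T by metis
    then have "gen g {t} = gen g {\<phi> x}" using img_inv[OF closed_gen] \<phi> by metis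
    then show ?thesis using T.gen_single_inj T by blast
  qed
  ultimately have "bij \<phi>" by (auto intro!: bijI simp: surj_def)
  moreover have "\<Phi> U = \<phi> ` U" if U: "closed f U" for U
  proof -
    have "\<phi> x \<in> \<Phi> U \<longleftrightarrow> x \<in> U" for x
    proof -
      have "\<phi> x \<in> \<Phi> U \<longleftrightarrow> gen g {\<phi> x} \<subseteq> \<Phi> U"
        using closed_img[OF U] by (simp add: gen_single_subset_iff)
      also have "\<dots> \<longleftrightarrow> gen f {x} \<subseteq> U" using ord[OF closed_gen U, of "{x}"] \<phi> by simp
      also have "\<dots> \<longleftrightarrow> x \<in> U"
        using U by (simp add: gen_single_subset_iff)
      finally show ?thesis .
    qed
    then show ?thesis using surj by (auto simp: set_eq_iff image_iff) metis+
  qed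
  ultimately show thesis using that by blast
qed

end

section \<open>The bicyclic monoid and the infinite cyclic group\<close>

definition el :: "('a \<Rightarrow> 'a \<Rightarrow> 'a) \<Rightarrow> 'a \<Rightarrow> 'a \<Rightarrow> 'a \<Rightarrow> nat \<Rightarrow> nat \<Rightarrow> 'a" where
  "el f e p q m n = f (mpow f e q m) (mpow f e p n)"

definition els :: "('a \<Rightarrow> 'a \<Rightarrow> 'a) \<Rightarrow> 'a \<Rightarrow> 'a \<Rightarrow> 'a \<Rightarrow> 'a set" where
  "els f e p q = {el f e p q m n | m n. True}"

text \<open>In the group case the normal form q^m p^n is not unique, only the difference of its
  exponents is (\<open>el_deg\<close>); hence the definite description.\<close>

definition deg :: "('a \<Rightarrow> 'a \<Rightarrow> 'a) \<Rightarrow> 'a \<Rightarrow> 'a \<Rightarrow> 'a \<Rightarrow> 'a \<Rightarrow> int" where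
  "deg f e p q x = (THE d. \<exists>m n. x = el f e p q m n \<and> d = int n - int m)"

text \<open>Covers both the bicyclic monoid and, when q * p = e as well, the infinite cyclic group.\<close>

locale bicyclic_pair = semigroup f for f :: "'a \<Rightarrow> 'a \<Rightarrow> 'a" (infixl \<open>\<cdot>\<close> 70) +
  fixes e p q :: 'a
  assumes ep: "e \<cdot> p = p" and pe: "p \<cdot> e = p" and eq: "e \<cdot> q = q" and qe: "q \<cdot> e = q"
    and pq: "p \<cdot> q = e" and aperiodic_p: "aperiodic f p"
begin

abbreviation "P \<equiv> mpow f e p"
abbreviation "Q \<equiv> mpow f e q"
abbreviation "E \<equiv> el f e p q"
abbreviation "B \<equiv> els f e p q"
abbreviation "dg \<equiv> deg f e p q"

lemma ee [simp]: "e \<cdot> e = e"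
  using pq qe assoc by metis

lemma eP [simp]: "e \<cdot> P n = P n"
  by (cases n) (simp_all add: mpow_Suc ep flip: assoc)

lemma eQ [simp]: "e \<cdot> Q n = Q n"
  by (cases n) (simp_all add: mpow_Suc eq flip: assoc)

lemma Pe [simp]: "P n \<cdot> e = P n"
  by (induction n) (simp_all add: mpow_Suc assoc)

lemma Qe [simp]: "Q n \<cdot> e = Q n"
  by (induction n) (simp_all add: mpow_Suc assoc)

lemma P_add: "P (m + n) = P m \<cdot> P n"
  by (induction m) (simp_all add: mpow_Suc assoc)

lemma Q_add: "Q (m + n) = Q m \<cdot> Q n"
  by (induction m) (simp_all add: mpow_Suc assoc)

lemma P_1: "P (Suc 0) = p"
  by (simp add: mpow_Suc pe)

lemma Q_1: "Q (Suc 0) = q"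
  by (simp add: mpow_Suc qe)

lemma P_Suc2: "P (Suc n) = P n \<cdot> p"
  using P_add[of n 1] by (simp add: P_1)

lemma Q_Suc2: "Q (Suc n) = Q n \<cdot> q"
  using Q_add[of n 1] by (simp add: Q_1)

lemma P_pw: "n \<ge> 1 \<Longrightarrow> P n = pw f p n"
  by (induction n rule: nat_induct_at_least) (simp_all add: pe mpow_Suc pw_Suc)

lemma Q_pw: "n \<ge> 1 \<Longrightarrow> Q n = pw f q n"
  by (induction n rule: nat_induct_at_least) (simp_all add: qe mpow_Suc pw_Suc)

lemma PQ: "P n \<cdot> Q n = e"
proof (induction n)
  case (Suc n)
  have "P (Suc n) \<cdot> Q (Suc n) = P n \<cdot> (p \<cdot> q) \<cdot> Q n"
    by (simp only: P_Suc2 mpow_Suc[of _ _ q] assoc)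
  then show ?case by (simp add: pq Suc)
qed simp

lemma PQ_ge: "n \<ge> m \<Longrightarrow> P n \<cdot> Q m = P (n - m)"
  using P_add[of "n - m" m] PQ[of m] by (simp add: assoc)

lemma PQ_le: "n \<le> m \<Longrightarrow> P n \<cdot> Q m = Q (m - n)"
  using Q_add[of n "m - n"] PQ[of n] by (simp flip: assoc)

lemma P_inj: "P m = P n \<longleftrightarrow> m = n"
proof -
  have "P 0 \<noteq> P k" if "k \<ge> 1" for k
    using aperiodic_not_idem[OF aperiodic_p that] by (metis P_pw ee mpow_0 that)
  moreover have "P m = P n \<Longrightarrow> m \<ge> 1 \<Longrightarrow> n \<ge> 1 \<Longrightarrow> m = n"
    using aperiodicD[OF aperiodic_p, of m n] by (simp add: P_pw)
  ultimately show ?thesis by (metis less_one linorder_not_le)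
qed

lemma Q_inj: "Q m = Q n \<longleftrightarrow> m = n"
proof -
  have "P (m + n) \<cdot> Q m = P n" "P (m + n) \<cdot> Q n = P m" by (simp_all add: PQ_ge)
  then show ?thesis using P_inj[of m n] by metis
qed

lemma aperiodic_q: "aperiodic f q"
  unfolding aperiodic_def
proof (rule inj_onI)
  fix m n :: nat assume "m \<in> {1..}" "n \<in> {1..}" "pw f q m = pw f q n"
  then show "m = n" using Q_inj[of m n] by (simp add: Q_pw)
qed

lemma el_eq: "E m n = Q m \<cdot> P n"
  by (simp add: el_def)

lemma el_0: "E 0 n = P n" "E m 0 = Q m" "E 0 0 = e"
  by (simp_all add: el_eq)

lemma el_in: "E m n \<in> B"
  by (auto simp: els_def)

lemma elsE: assumes "x \<in> B" obtains m n where "x = E m n"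
  using assms by (auto simp: els_def)

lemma P_in: "P n \<in> B" and Q_in: "Q n \<in> B" and e_in: "e \<in> B" and p_in: "p \<in> B" and q_in: "q \<in> B"
  using el_in[of 0 n] el_in[of n 0] el_in[of 0 0] el_in[of 0 1] el_in[of 1 0]
  by (simp_all add: el_0 P_1 Q_1)

lemma e_el: "e \<cdot> E m n = E m n" "E m n \<cdot> e = E m n"
  by (simp_all add: el_eq assoc) (simp flip: assoc)

lemma unit: "x \<in> B \<Longrightarrow> e \<cdot> x = x" "x \<in> B \<Longrightarrow> x \<cdot> e = x"
  using e_el by (auto elim: elsE)

lemma el_mult: "E m n \<cdot> E i j = (if i \<le> n then E m (n - i + j) else E (m + (i - n)) j)"
proof -
  have "E m n \<cdot> E i j = Q m \<cdot> (P n \<cdot> Q i) \<cdot> P j"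
    by (simp add: el_eq assoc)
  also have "\<dots> = (if i \<le> n then E m (n - i + j) else E (m + (i - n)) j)"
  proof (cases "i \<le> n")
    case True
    then show ?thesis by (simp only: PQ_ge el_eq P_add assoc if_True)
  next
    case False
    then show ?thesis by (simp only: PQ_le[of n i] nat_le_linear el_eq Q_add if_False)
  qed
  finally show ?thesis .
qed

lemma els_closed: "closed f B"
  by (rule closedI) (auto elim!: elsE simp: el_mult el_in)

lemma els_mult: "x \<in> B \<Longrightarrow> y \<in> B \<Longrightarrow> x \<cdot> y \<in> B"
  using els_closed by (rule closedD)

text \<open>Multiplying by p^(m+i) on the left clears the powers of q on both sides and leaves two
  powers of p.\<close>

lemma el_deg:
  assumes "E m n = E i j"
  shows "int n - int m = int j - int i"
proof -
  have "P (m + i) \<cdot> E m n = P (i + n)" "P (m + i) \<cdot> E i j = P (m + j)"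
    using el_mult[of 0 "m + i" m n] el_mult[of 0 "m + i" i j] by (simp_all add: el_0)
  with assms have "i + n = m + j" using P_inj by metis
  then show ?thesis by linarith
qed

lemma deg_el [simp]: "dg (E m n) = int n - int m"
  unfolding deg_def
proof (rule the_equality)
  show "\<exists>i j. E m n = E i j \<and> int n - int m = int j - int i" by blast
  fix d assume "\<exists>i j. E m n = E i j \<and> d = int j - int i"
  then show "d = int n - int m" using el_deg by metis
qed

lemma deg_0 [simp]: "dg e = 0" "dg p = 1" "dg q = -1" "dg (P n) = int n" "dg (Q n) = - int n"
  using deg_el[of 0 0] deg_el[of 0 1] deg_el[of 1 0] deg_el[of 0 n] deg_el[of n 0]
  by (simp_all add: el_0 P_1 Q_1 del: deg_el)

lemma deg_mult: "x \<in> B \<Longrightarrow> y \<in> B \<Longrightarrow> dg (x \<cdot> y) = dg x + dg y"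
  by (elim elsE) (auto simp: el_mult)

lemma deg_pw: "n \<ge> 1 \<Longrightarrow> x \<in> B \<Longrightarrow> dg (pw f x n) = int n * dg x"
  by (induction n rule: nat_induct_at_least)
    (simp_all add: pw_Suc deg_mult pw_in els_closed algebra_simps)

lemma aperiodic_deg: "x \<in> B \<Longrightarrow> dg x \<noteq> 0 \<Longrightarrow> aperiodic f x"
  unfolding aperiodic_def using deg_pw[of _ x] by (auto intro!: inj_onI) (metis One_nat_def mult_right_cancel of_nat_eq_iff)

lemma el_idem: "E m m \<cdot> E m m = E m m"
  by (simp add: el_mult)

lemma deg_0_el: "x \<in> B \<Longrightarrow> dg x = 0 \<Longrightarrow> \<exists>m. x = E m m"
  by (elim elsE) auto

lemma idem_el: "x \<in> B \<Longrightarrow> x \<cdot> x = x \<Longrightarrow> \<exists>m. x = E m m"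
  using deg_0_el deg_mult[of x x] by simp

lemma idem_or_aperiodic: "x \<in> B \<Longrightarrow> x \<cdot> x = x \<or> aperiodic f x"
  using deg_0_el aperiodic_deg el_idem by metis

lemma not_aperiodic_e: "\<not> aperiodic f e"
  using aperiodic_not_idem1 ee by blast

lemma gen_pq: "gen f {p, q} = B"
proof
  show "gen f {p, q} \<subseteq> B" by (rule gen_minimal[OF els_closed]) (simp add: p_in q_in)
  have e: "e \<in> gen f {p, q}" using gen_mult[of p f "{p, q}" q] pq by (simp add: gen_base)
  have "P n \<in> gen f {p, q}" "Q n \<in> gen f {p, q}" for n
    using e by (induction n) (auto simp: mpow_Suc intro!: gen_mult intro: gen_base)
  then show "B \<subseteq> gen f {p, q}" by (auto simp: els_def el_eq gen_mult)
qed

text \<open>Between p^m and q^m the equation becomes e = q^d p^d with d = n - m > 0. So e has the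
  form q x p, and q p q = q shows that q p fixes e from the left.\<close>

lemma el_collapse:
  assumes "E m m = E n n" "m < n"
  shows "q \<cdot> p = e"
proof -
  define k where "k = n - m - 1"
  have k: "n - m = Suc k" using assms(2) by (simp add: k_def)
  have "e = P m \<cdot> E m m \<cdot> Q m" by (simp add: el_eq PQ assoc)
  also have "\<dots> = (P m \<cdot> Q n) \<cdot> (P n \<cdot> Q m)" unfolding assms(1) by (simp add: el_eq assoc)
  also have "\<dots> = Q (Suc k) \<cdot> P (Suc k)" using assms(2) k by (simp add: PQ_le PQ_ge)
  also have "\<dots> = q \<cdot> (Q k \<cdot> P k) \<cdot> p" by (simp only: mpow_Suc[of _ _ q] P_Suc2 assoc)
  finally have e: "e = q \<cdot> (Q k \<cdot> P k) \<cdot> p" .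
  have "q \<cdot> p \<cdot> e = q \<cdot> (p \<cdot> q) \<cdot> (Q k \<cdot> P k) \<cdot> p" by (subst e) (simp only: assoc)
  also have "\<dots> = e" by (simp add: pq qe e[symmetric])
  finally show ?thesis by (simp add: assoc pe)
qed

lemma el_group: "q \<cdot> p = e \<Longrightarrow> E m m = e"
proof (induction m)
  case (Suc m)
  have "E (Suc m) (Suc m) = q \<cdot> E m m \<cdot> p" by (simp only: el_eq mpow_Suc[of _ _ q] P_Suc2 assoc)
  then show ?case using Suc by (simp add: qe)
qed (simp add: el_0)

lemma pw_el: "k \<ge> 1 \<Longrightarrow> pw f (E m (Suc m)) k = E m (m + k)"
  by (induction k rule: nat_induct_at_least) (simp_all add: pw_Suc el_mult)

lemma mpow_opp_P: "mpow (opp f) e p n = P n"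
proof (induction n)
  case (Suc n)
  have "mpow (opp f) e p (Suc n) = opp f p (P n)" using mpow_Suc[of "opp f"] Suc by metis
  then show ?case using P_Suc2[of n] by (metis opp_apply)
qed (rule trans[OF mpow_0 mpow_0[symmetric]])

lemma mpow_opp_Q: "mpow (opp f) e q n = Q n"
proof (induction n)
  case (Suc n)
  have "mpow (opp f) e q (Suc n) = opp f q (Q n)" using mpow_Suc[of "opp f"] Suc by metis
  then show ?case using Q_Suc2[of n] by (metis opp_apply)
qed (rule trans[OF mpow_0 mpow_0[symmetric]])

lemma opp_bicyclic_pair: "bicyclic_pair (opp f) e q p"
  by (intro bicyclic_pair.intro opp_semigroup bicyclic_pair_axioms.intro)
    (simp_all add: ep pe eq qe pq aperiodic_q)

text \<open>Reversing the multiplication swaps p and q and transposes the exponents, so a claim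
  about m \<le> n yields the one about n \<le> m.\<close>

lemma el_opp: "el (opp f) e q p m n = E n m"
  by (simp add: el_def mpow_opp_P mpow_opp_Q)

lemma els_opp: "els (opp f) e q p = B"
  by (auto simp: els_def el_opp)

text \<open>If neither factor is a power of q, then x \<cdot> y ends in p, which forces q \<cdot> p = e; both
  factors are then positive powers of p.\<close>

lemma mult_eq_Q:
  assumes "x \<in> B" "y \<in> B" "x \<cdot> y = Q j"
  shows "x \<in> range Q \<or> y \<in> range Q"
proof -
  obtain m n where y: "y = E m n" using assms(2) by (rule elsE)
  show ?thesis
  proof (cases n)
    case 0
    then show ?thesis using y by (simp add: el_0)
  next
    case (Suc k)
    have "Q j \<cdot> (q \<cdot> p) = x \<cdot> Q m \<cdot> P k \<cdot> p \<cdot> (q \<cdot> p)"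
      using assms(3) by (simp only: y Suc el_eq P_Suc2 assoc)
    also have "\<dots> = x \<cdot> Q m \<cdot> P k \<cdot> (p \<cdot> q) \<cdot> p" by (simp only: assoc)
    also have "\<dots> = x \<cdot> y" by (simp add: y Suc el_eq P_Suc2 pq assoc ep)
    finally have "Q j \<cdot> (q \<cdot> p) = Q j" using assms(3) by simp
    then have "P j \<cdot> (Q j \<cdot> (q \<cdot> p)) = P j \<cdot> Q j" by simp
    then have "q \<cdot> p = e" using PQ[of j] eq by (simp flip: assoc)
    then have idem: "E i i = e" for i by (rule el_group)
    have pos: "z \<in> range Q \<or> (\<exists>n\<ge>1. z = P n)" if zB: "z \<in> B" for z
    proof -
      obtain i l where z: "z = E i l" using zB by (rule elsE)
      show ?thesis
      proof (cases "l \<le> i")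
        case True
        then have "z = Q (i - l) \<cdot> E l l"
          using Q_add[of "i - l" l] by (simp add: z el_eq flip: assoc)
        then show ?thesis by (simp add: idem)
      next
        case False
        then have "z = E i i \<cdot> P (l - i)"
          using P_add[of i "l - i"] by (simp add: z el_eq assoc)
        then have "z = P (l - i)" by (simp add: idem)
        then show ?thesis using False by (auto intro!: exI[of _ "l - i"])
      qed
    qed
    show ?thesis
    proof (rule ccontr)
      assume "\<not> ?thesis"
      then obtain r s where "r \<ge> 1" "s \<ge> 1" "x = P r" "y = P s" using pos assms by metis
      then have "dg (x \<cdot> y) > 0" by (simp add: deg_mult P_in)
      then show False using assms(3) by simp
    qed
  qed
qed

section \<open>Pairs in \<open>B\<close> that generate the identity\<close>

lemma gen_e_imp_Q:
  assumes "x \<in> B" "y \<in> B" "e \<in> gen f {x, y}"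
  shows "x \<in> range Q \<or> y \<in> range Q"
proof (rule ccontr)
  assume neg: "\<not> ?thesis"
  have "gen f {x, y} \<subseteq> B - range Q"
  proof (rule gen_minimal)
    show "closed f (B - range Q)"
      by (rule closedI) (use mult_eq_Q els_mult in blast)
    show "{x, y} \<subseteq> B - range Q" using neg assms by auto
  qed
  moreover have "e \<in> range Q" using mpow_0[of f e q] by (metis rangeI)
  ultimately show False using assms(3) by blast
qed

lemma gen_e_imp_P:
  assumes "x \<in> B" "y \<in> B" "e \<in> gen f {x, y}"
  shows "x \<in> range P \<or> y \<in> range P"
  using bicyclic_pair.gen_e_imp_Q[OF opp_bicyclic_pair, of x y] assms
  by (simp add: els_opp mpow_opp_P[abs_def])

lemma P_neq_Q: "P m = Q n \<Longrightarrow> m = 0 \<and> n = 0"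
  using deg_0(4)[of m] deg_0(5)[of n] by auto

text \<open>One of the elements is a power of p and one is a power of q. They cannot be the same
  element: its degree would be both nonnegative and nonpositive, which leaves only e.\<close>

lemma gen_e_imp_powers:
  assumes "x \<in> B" "y \<in> B" "e \<in> gen f {x, y}" "x \<noteq> e" "y \<noteq> e"
  obtains i j where "i \<ge> 1" "j \<ge> 1" "x = P i \<and> y = Q j \<or> x = Q j \<and> y = P i"
proof -
  have nz: "z = P m \<Longrightarrow> m \<ge> 1" "z = Q m \<Longrightarrow> m \<ge> 1" if "z \<noteq> e" for z m
    using that by (cases m; simp)+
  obtain r s where "x = P r \<or> y = P r" "x = Q s \<or> y = Q s"
    using gen_e_imp_Q gen_e_imp_P assms(1-3) by blast
  then show thesis using nz[of x] nz[of y] assms(4,5) P_neq_Q[of r s] that[of r s] by fastforce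
qed

end

section \<open>Orthodox semigroups with aabb = ab\<close>

text \<open>The assumption \<open>al_be\<close> is the relation aabb = ab written for ae and eb. The
  elements \<open>e\<close>, \<open>al\<close>, \<open>be\<close> are parameters tied down by
  equations, so that the dual and later the image in \<open>T\<close> can instantiate the locale
  with their own elements.\<close>

locale orthodox_pair = semigroup f for f :: "'a \<Rightarrow> 'a \<Rightarrow> 'a" (infixl \<open>\<cdot>\<close> 70) +
  fixes a b e al be :: 'a
  assumes ab: "a \<cdot> b = e" and al: "a \<cdot> e = al" and be: "e \<cdot> b = be"
    and ea: "e \<cdot> a = a" and be_e: "b \<cdot> e = b" and al_be: "al \<cdot> be = e"
    and gen_ab: "gen f {a, b} = UNIV" and aperiodic_a: "aperiodic f a"
begin

lemma induct [case_names a b mult]: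
  assumes "Q a" "Q b" "\<And>x y. Q x \<Longrightarrow> Q y \<Longrightarrow> Q (x \<cdot> y)"
  shows "Q x"
proof -
  have "x \<in> gen f {a, b}" by (simp add: gen_ab)
  then show ?thesis by (induction rule: gen_induct) (use assms in auto)
qed

lemma idem_e: "e \<cdot> e = e"
  by (metis ab assoc ea)

text \<open>Only the letters next to the inserted e matter. It is absorbed by a following a or a
  preceding b; in the remaining case a e b = (ae)(eb) = e = ab.\<close>

lemma sandwich: "x \<cdot> e \<cdot> y = x \<cdot> y"
proof (induction x arbitrary: y rule: induct)
  case a
  show ?case
  proof (induction y rule: induct)
    case a
    then show ?case by (simp add: assoc ea)
  next
    case b
    have "a \<cdot> e \<cdot> b = a \<cdot> e \<cdot> (e \<cdot> b)" by (metis assoc idem_e)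
    then show ?case by (simp add: al be al_be ab)
  next
    case (mult x y)
    then show ?case by (simp flip: assoc)
  qed
next
  case b
  then show ?case by (simp add: be_e)
next
  case (mult x y)
  then show ?case by (simp add: assoc)
qed

text \<open>Each inner factor e of (ae)^k a disappears by \<open>sandwich\<close>. This carries the
  infinite order of a over to ae.\<close>

lemma pw_al_a: "k \<ge> 1 \<Longrightarrow> pw f al k \<cdot> a = pw f a (Suc k)"
proof (induction k rule: nat_induct_at_least)
  case base
  show ?case using pw_Suc[of 1 f a] by (simp add: sandwich flip: al)
next
  case (Suc k)
  have "pw f al (Suc k) \<cdot> a = al \<cdot> (pw f al k \<cdot> a)" using Suc by (simp add: pw_Suc assoc)
  also have "\<dots> = a \<cdot> pw f a (Suc k)" using Suc sandwich by (simp flip: al)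
  finally show ?case using pw_Suc[of "Suc k" f a] by simp
qed

lemma aperiodic_al: "aperiodic f al"
  unfolding aperiodic_def
proof (rule inj_onI)
  fix m n :: nat assume *: "m \<in> {1..}" "n \<in> {1..}" "pw f al m = pw f al n"
  then have "pw f a (Suc m) = pw f a (Suc n)" using pw_al_a by (metis atLeast_iff)
  then show "m = n" using aperiodicD[OF aperiodic_a, of "Suc m" "Suc n"] by simp
qed

sublocale bicyclic_pair f e al be
proof
  show "e \<cdot> al = al" "al \<cdot> e = al" "e \<cdot> be = be" "be \<cdot> e = be"
    using al be ea be_e idem_e assoc by metis+
qed (fact al_be aperiodic_al)+

lemma decomp:
  obtains u v p where "u \<in> {e, b}" "v \<in> {e, a}" "p \<in> B" "x = u \<cdot> p \<cdot> v"
proof -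
  have "\<exists>u v p. u \<in> {e, b} \<and> v \<in> {e, a} \<and> p \<in> B \<and> x = u \<cdot> p \<cdot> v"
  proof (induction x rule: induct)
    case a
    show ?case by (rule exI[of _ e], rule exI[of _ a], rule exI[of _ e]) (simp add: e_in ea idem_e)
  next
    case b
    show ?case by (rule exI[of _ b], rule exI[of _ e], rule exI[of _ e]) (simp add: e_in be_e)
  next
    case (mult x y)
    then obtain u v p u' v' p' where *: "u \<in> {e, b}" "v' \<in> {e, a}" "v \<in> {e, a}" "u' \<in> {e, b}"
        "p \<in> B" "p' \<in> B" "x = u \<cdot> p \<cdot> v" "y = u' \<cdot> p' \<cdot> v'" by blast
    \<comment> \<open>Where two normal forms meet, the possible products are ee = e, ab = e, ae =
      \<open>al\<close> and eb = \<open>be\<close>, so the middle part stays in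
      \<open>B\<close>.\<close>
    then have "v \<cdot> u' \<in> B" by (auto simp: idem_e ab al be e_in p_in q_in)
    then have "p \<cdot> (v \<cdot> u') \<cdot> p' \<in> B" using * els_mult by blast
    moreover have "x \<cdot> y = u \<cdot> (p \<cdot> (v \<cdot> u') \<cdot> p') \<cdot> v'" by (simp add: * assoc)
    ultimately show ?case using * by blast
  qed
  then show thesis using that by blast
qed

lemma P_a: "P n \<cdot> a = pw f a (Suc n)"
  by (cases "n = 0") (simp_all add: ea P_pw pw_al_a)

lemma left_fixed: "e \<cdot> x = x \<Longrightarrow> \<exists>q\<in>B. x = q \<or> x = q \<cdot> a"
proof -
  assume x: "e \<cdot> x = x"
  obtain u v p where *: "u \<in> {e, b}" "v \<in> {e, a}" "p \<in> B" "x = u \<cdot> p \<cdot> v" by (rule decomp)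
  then have "e \<cdot> u \<cdot> p \<in> B" using els_mult by (auto simp: be idem_e e_in q_in)
  moreover have "x = e \<cdot> u \<cdot> p \<cdot> v" using x * by (simp add: assoc)
  ultimately show ?thesis using *(2) unit(2) by auto
qed

lemma gen_insert_a_B: "x \<in> gen f (insert a B) \<Longrightarrow> \<exists>q\<in>B. x = q \<or> x = q \<cdot> a"
proof (rule left_fixed)
  show "e \<cdot> x = x" if "x \<in> gen f (insert a B)"
    using that by (induction rule: gen_induct) (auto simp: ea unit(1) simp flip: assoc)
qed

lemma core_in: "e \<cdot> x \<cdot> e \<in> B"
proof -
  obtain u v p where *: "u \<in> {e, b}" "v \<in> {e, a}" "p \<in> B" "x = u \<cdot> p \<cdot> v" by (rule decomp)
  then have "e \<cdot> u \<in> B" "v \<cdot> e \<in> B" by (auto simp: al be idem_e e_in p_in q_in)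
  moreover have "e \<cdot> x \<cdot> e = e \<cdot> u \<cdot> p \<cdot> (v \<cdot> e)" by (simp add: * assoc)
  ultimately show ?thesis using * els_mult by metis
qed

lemma in_B_iff: "x \<in> B \<longleftrightarrow> e \<cdot> x = x \<and> x \<cdot> e = x"
  using unit[of x] core_in[of x] by metis

text \<open>By \<open>sandwich\<close> the inner factors e may be dropped. So x \<mapsto> exe is a
  retraction homomorphism onto \<open>B\<close>, and through it every element of the semigroup has a
  degree.\<close>

lemma core_mult: "e \<cdot> (x \<cdot> y) \<cdot> e = (e \<cdot> x \<cdot> e) \<cdot> (e \<cdot> y \<cdot> e)"
proof -
  have "(e \<cdot> x \<cdot> e) \<cdot> (e \<cdot> y \<cdot> e) = e \<cdot> (x \<cdot> e \<cdot> e \<cdot> y) \<cdot> e" by (simp only: assoc)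
  then show ?thesis by (simp add: sandwich)
qed

lemma core_pw: "n \<ge> 1 \<Longrightarrow> e \<cdot> pw f x n \<cdot> e = pw f (e \<cdot> x \<cdot> e) n"
  by (induction n rule: nat_induct_at_least) (simp_all only: pw_1 One_nat_def pw_Suc core_mult)

text \<open>With x = u p v, squaring inserts vu between two copies of p. Degree 0 says that vu, one
  of e, \<open>al\<close>, \<open>be\<close>, has the degree opposite to that of p; in each such
  case p(vu)p = p.\<close>

lemma idem_iff: "x \<cdot> x = x \<longleftrightarrow> dg (e \<cdot> x \<cdot> e) = 0"
proof
  assume "x \<cdot> x = x"
  then have "(e \<cdot> x \<cdot> e) \<cdot> (e \<cdot> x \<cdot> e) = e \<cdot> x \<cdot> e" by (metis core_mult)
  then show "dg (e \<cdot> x \<cdot> e) = 0" using deg_mult[OF core_in[of x] core_in[of x]] by simp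
next
  assume d: "dg (e \<cdot> x \<cdot> e) = 0"
  obtain u v p where *: "u \<in> {e, b}" "v \<in> {e, a}" "p \<in> B" "x = u \<cdot> p \<cdot> v" by (rule decomp)
  then have eu: "e \<cdot> u \<in> B" "v \<cdot> e \<in> B" by (auto simp: al be idem_e e_in p_in q_in)
  have "e \<cdot> x \<cdot> e = e \<cdot> u \<cdot> p \<cdot> (v \<cdot> e)" by (simp add: * assoc)
  then have dp: "dg (e \<cdot> u) + dg p + dg (v \<cdot> e) = 0"
    using d eu * by (simp add: deg_mult els_mult)
  obtain m n where p: "p = E m n" using *(3) by (rule elsE)
  have "p \<cdot> (v \<cdot> u) \<cdot> p = p"
  proof -
    consider "v \<cdot> u = e" "n = m" | "v \<cdot> u = E 0 1" "m = Suc n" | "v \<cdot> u = E 1 0" "n = Suc m"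
      using * dp by (auto simp: p ab al be idem_e el_0 P_1 Q_1)
    then show ?thesis
      by cases (simp_all add: p e_el el_mult)
  qed
  moreover have "x \<cdot> x = u \<cdot> (p \<cdot> (v \<cdot> u) \<cdot> p) \<cdot> v" by (simp add: * assoc)
  ultimately show "x \<cdot> x = x" using * by simp
qed

text \<open>Two equal powers of x give equal multiples of the degree of exe, so this degree is
  0.\<close>

lemma idem_or_aperiodic_all: "x \<cdot> x = x \<or> aperiodic f x"
proof (rule disjCI)
  assume "\<not> aperiodic f x"
  then obtain m n where mn: "m \<ge> 1" "n \<ge> 1" "m \<noteq> n" "pw f x m = pw f x n"
    by (auto simp: aperiodic_def inj_on_def)
  then have "dg (pw f (e \<cdot> x \<cdot> e) m) = dg (pw f (e \<cdot> x \<cdot> e) n)" by (metis core_pw)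
  then show "x \<cdot> x = x" using mn by (simp add: deg_pw core_in idem_iff)
qed

lemma aperiodic_b: "aperiodic f b"
proof -
  have "dg (e \<cdot> b \<cdot> e) \<noteq> 0" using be qe by simp
  then have "b \<cdot> b \<noteq> b" by (simp add: idem_iff)
  then show ?thesis using idem_or_aperiodic_all by blast
qed

lemma opp_orthodox_pair: "orthodox_pair (opp f) b a e be al"
  by (intro orthodox_pair.intro opp_semigroup orthodox_pair_axioms.intro)
    (simp_all add: ab al be ea be_e al_be aperiodic_b gen_ab[unfolded insert_commute[of a b]])

lemma idem_a_B: "a \<in> B \<longleftrightarrow> a = al"
  by (metis al ea in_B_iff)

end

section \<open>Bijections preserving subsemigroups\<close>

locale closure_bij = S: semigroup f + T: semigroup g
  for f :: "'a \<Rightarrow> 'a \<Rightarrow> 'a" and g :: "'b \<Rightarrow> 'b \<Rightarrow> 'b" +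
  fixes \<phi> :: "'a \<Rightarrow> 'b"
  assumes bij: "bij \<phi>" and closed_iff: "closed f U \<longleftrightarrow> closed g (\<phi> ` U)"
    and S_idem_or_aperiodic: "f x x = x \<or> aperiodic f x"
    and T_idem_or_aperiodic: "g y y = y \<or> aperiodic g y"
begin

lemma opp_left: "closure_bij (opp f) g \<phi>"
  by (intro closure_bij.intro closure_bij_axioms.intro S.opp_semigroup T.semigroup_axioms bij)
    (use closed_iff S_idem_or_aperiodic T_idem_or_aperiodic in \<open>simp_all\<close>)

lemma opp_right: "closure_bij f (opp g) \<phi>"
  by (intro closure_bij.intro closure_bij_axioms.intro T.opp_semigroup S.semigroup_axioms bij)
    (use closed_iff S_idem_or_aperiodic T_idem_or_aperiodic in \<open>simp_all\<close>)

lemma phi_eq_iff [simp]: "\<phi> x = \<phi> y \<longleftrightarrow> x = y"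
  using bij by (auto simp: bij_def inj_def)

lemma phi_in_iff [simp]: "\<phi> x \<in> \<phi> ` U \<longleftrightarrow> x \<in> U"
  by auto

lemma phi_surj: obtains x where "y = \<phi> x"
  using bij by (auto simp: bij_def surj_def)

lemma image_gen: "\<phi> ` gen f X = gen g (\<phi> ` X)"
proof
  show "gen g (\<phi> ` X) \<subseteq> \<phi> ` gen f X"
    using closed_gen[of f X] gen_superset[of X f] by (intro gen_minimal image_mono) (simp_all add: closed_iff)
  define U where "U = {x. \<phi> x \<in> gen g (\<phi> ` X)}"
  have U: "\<phi> ` U = gen g (\<phi> ` X)"
    using bij unfolding U_def bij_def by (metis surj_image_vimage_eq vimage_def inf_top_right)
  have "gen f X \<subseteq> U"
  proof (rule gen_minimal)
    show "closed f U" unfolding closed_iff U by (rule closed_gen)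
    show "X \<subseteq> U" by (auto simp: U_def intro: gen_base)
  qed
  then show "\<phi> ` gen f X \<subseteq> gen g (\<phi> ` X)" using U by blast
qed

text \<open>The standard way to locate a product in \<open>T\<close>: it belongs to the subsemigroup
  generated by its factors, hence its preimage to the one generated by theirs.\<close>

lemma in_gen_iff: "\<phi> x \<in> gen g (\<phi> ` X) \<longleftrightarrow> x \<in> gen f X"
  by (simp flip: image_gen)

lemma phi_idem_iff: "g (\<phi> x) (\<phi> x) = \<phi> x \<longleftrightarrow> f x x = x"
  using closed_iff[of "{x}"] by (auto simp: closed_def)

lemma phi_aperiodic_iff: "aperiodic g (\<phi> x) \<longleftrightarrow> aperiodic f x"
  using S_idem_or_aperiodic[of x] T_idem_or_aperiodic[of "\<phi> x"] phi_idem_iff[of x]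
    S.aperiodic_not_idem1[of x] T.aperiodic_not_idem1[of "\<phi> x"] by blast

text \<open>On the cyclic subsemigroup of x, \<phi> acts as a permutation of exponents. The
  subsemigroups there are exactly the sum-closed sets of exponents, so the permutation is the
  identity by \<open>sum_closed_preserving_id\<close>.\<close>

lemma phi_pw_aperiodic:
  assumes x: "aperiodic f x" and n: "n \<ge> 1"
  shows "\<phi> (pw f x n) = pw g (\<phi> x) n"
proof -
  define y where "y = \<phi> x"
  have y: "aperiodic g y" using x phi_aperiodic_iff by (simp add: y_def)
  have im: "\<phi> ` gen f {x} = gen g {y}" by (simp add: image_gen y_def)
  have "\<exists>m\<ge>1. \<phi> (pw f x n) = pw g y m" if "n \<ge> 1" for n
  proof -
    have "\<phi> (pw f x n) \<in> gen g {y}" using that unfolding im[symmetric] by (auto simp: S.gen_single)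
    then show ?thesis by (auto simp: T.gen_single)
  qed
  then obtain s where s: "\<And>n. n \<ge> 1 \<Longrightarrow> s n \<ge> 1 \<and> \<phi> (pw f x n) = pw g y (s n)" by metis
  have "\<exists>n\<ge>1. \<phi> (pw f x n) = pw g y m" if "m \<ge> 1" for m
  proof -
    have "pw g y m \<in> \<phi> ` gen f {x}" using that unfolding im by (auto simp: T.gen_single)
    then show ?thesis by (auto simp: S.gen_single)
  qed
  then obtain t where t: "\<And>m. m \<ge> 1 \<Longrightarrow> t m \<ge> 1 \<and> \<phi> (pw f x (t m)) = pw g y m" by metis
  have st: "s (t m) = m" "t (s m) = m" if "m \<ge> 1" for m
  proof -
    have "pw g y (s (t m)) = pw g y m" using s[of "t m"] t[of m] that by simp
    then show "s (t m) = m" using aperiodicD[OF y, of "s (t m)" m] s t that by simp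
    have "\<phi> (pw f x (t (s m))) = \<phi> (pw f x m)" using t[of "s m"] s[of m] that by metis
    then have "pw f x (t (s m)) = pw f x m" unfolding phi_eq_iff .
    then show "t (s m) = m" using aperiodicD[OF x, of "t (s m)" m] s[of m] t[of "s m"] that by blast
  qed
  have cl: "closed h {pw h z k | k. k \<ge> 1 \<and> Q k} \<longleftrightarrow> sum_closed Q"
    if h: "semigroup h" and z: "aperiodic h z" for h :: "'c \<Rightarrow> 'c \<Rightarrow> 'c" and z Q
  proof
    assume c: "closed h {pw h z k | k. k \<ge> 1 \<and> Q k}"
    show "sum_closed Q"
      unfolding sum_closed_def
    proof (intro allI impI)
      fix i j :: nat assume ij: "1 \<le> i" "1 \<le> j" "Q i" "Q j"
      then have "h (pw h z i) (pw h z j) \<in> {pw h z k | k. k \<ge> 1 \<and> Q k}"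
        by (intro closedD[OF c]) auto
      then obtain k where "pw h z (i + j) = pw h z k" "k \<ge> 1" "Q k"
        using semigroup.pw_add[OF h] ij by auto
      then show "Q (i + j)" using aperiodicD[OF z, of "i + j" k] ij by simp
    qed
  next
    assume Q: "sum_closed Q"
    show "closed h {pw h z k | k. k \<ge> 1 \<and> Q k}"
    proof (rule closedI)
      fix u v assume "u \<in> {pw h z k | k. k \<ge> 1 \<and> Q k}" "v \<in> {pw h z k | k. k \<ge> 1 \<and> Q k}"
      then obtain i j where "u = pw h z i" "v = pw h z j" "1 \<le> i" "1 \<le> j" "Q i" "Q j" by blast
      then have "h u v = pw h z (i + j) \<and> i + j \<ge> 1 \<and> Q (i + j)"
        using semigroup.pw_add[OF h] sum_closedD[OF Q] by simp
      then show "h u v \<in> {pw h z k | k. k \<ge> 1 \<and> Q k}" by blast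
    qed
  qed
  have "sum_closed Q \<longleftrightarrow> sum_closed (\<lambda>k. Q (t k))" for Q
  proof -
    have "\<phi> ` {pw f x k | k. k \<ge> 1 \<and> Q k} = {pw g y k | k. k \<ge> 1 \<and> Q (t k)}"
    proof (intro equalityI subsetI)
      fix z assume "z \<in> \<phi> ` {pw f x k | k. k \<ge> 1 \<and> Q k}"
      then obtain k where "k \<ge> 1" "Q k" "z = \<phi> (pw f x k)" by blast
      then have "z = pw g y (s k) \<and> s k \<ge> 1 \<and> Q (t (s k))" using s st by simp
      then show "z \<in> {pw g y k | k. k \<ge> 1 \<and> Q (t k)}" by blast
    next
      fix z assume "z \<in> {pw g y k | k. k \<ge> 1 \<and> Q (t k)}"
      then obtain k where "k \<ge> 1" "Q (t k)" "z = pw g y k" by blast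
      then have "z = \<phi> (pw f x (t k)) \<and> t k \<ge> 1 \<and> Q (t k)" using t by simp
      then show "z \<in> \<phi> ` {pw f x k | k. k \<ge> 1 \<and> Q k}" by blast
    qed
    then show ?thesis
      using closed_iff[of "{pw f x k | k. k \<ge> 1 \<and> Q k}"]
        cl[OF S.semigroup_axioms x, of Q] cl[OF T.semigroup_axioms y, of "\<lambda>k. Q (t k)"] by simp
  qed
  then have "sum_closed_preserving t s"
    using s t st unfolding sum_closed_preserving_def by blast
  then have "t n = n" using n by (rule sum_closed_preserving_id)
  then show ?thesis using t[OF n] by (simp add: y_def)
qed

lemma phi_pw: "n \<ge> 1 \<Longrightarrow> \<phi> (pw f x n) = pw g (\<phi> x) n"
  using S_idem_or_aperiodic[of x] phi_pw_aperiodic S.pw_idem T.pw_idem phi_idem_iff by metis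

end

section \<open>The image of the local monoid eSe\<close>

context semigroup
begin

text \<open>If uy = y^k with k > 1, then u fixes y^k, but u y^k = (uy) y^(k-1) = y^(2k-1), against
  infinite order.\<close>

lemma idem_aperiodic_mult:
  assumes "u \<^bold>* u = u" "aperiodic f y" "u \<^bold>* y \<in> insert u (gen f {y})"
  shows "u \<^bold>* y = u \<or> u \<^bold>* y = y"
proof (rule ccontr)
  assume neg: "\<not> ?thesis"
  then obtain k where k: "u \<^bold>* y = pw f y k" "k \<ge> 1" using assms(3) by (auto simp: gen_single)
  with neg have k2: "k - 1 \<ge> 1" by (cases "k = 1") auto
  have "u \<^bold>* pw f y k = pw f y k" using assms(1) by (simp flip: k(1) assoc)
  also have "u \<^bold>* pw f y k = u \<^bold>* (y \<^bold>* pw f y (k - 1))" using pw_Suc[of "k - 1" f y] k2 by simp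
  also have "\<dots> = pw f y (k + (k - 1))" using pw_add[of k "k - 1" y] k k2 by (simp flip: assoc)
  finally have "k + (k - 1) = k" using aperiodicD[OF assms(2), of "k + (k - 1)" k] k by simp
  then show False using k2 by simp
qed

lemma unit_mult_pw:
  assumes "n \<ge> 1" "y \<^bold>* u = y"
  shows "u \<^bold>* pw f y n = pw f (u \<^bold>* y) n"
  using assms(1)
proof (induction n rule: nat_induct_at_least)
  case (Suc n)
  have "u \<^bold>* pw f y (Suc n) = u \<^bold>* y \<^bold>* pw f y n" using Suc by (simp add: pw_Suc assoc)
  also have "\<dots> = u \<^bold>* (y \<^bold>* u) \<^bold>* pw f y n" by (simp only: assms(2))
  also have "\<dots> = u \<^bold>* y \<^bold>* (u \<^bold>* pw f y n)" by (simp only: assoc)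
  finally have "u \<^bold>* pw f y (Suc n) = u \<^bold>* y \<^bold>* (u \<^bold>* pw f y n)" .
  then show ?case using Suc by (simp add: pw_Suc)
qed simp

text \<open>Each of uy and yu is u or y. If they differ, evaluating y u y in two ways makes y
  idempotent.\<close>

lemma unit_or_zero:
  assumes u: "u \<^bold>* u = u" and y: "aperiodic f y" and c: "closed f (insert u (gen f {y}))"
  shows "u \<^bold>* y = y \<and> y \<^bold>* u = y \<or> u \<^bold>* y = u \<and> y \<^bold>* u = u"
proof -
  have "u \<^bold>* y = u \<or> u \<^bold>* y = y"
    by (rule idem_aperiodic_mult) (use u y closedD[OF c, of u y] gen_base[of y "{y}" f] in auto)
  moreover have "y \<^bold>* u = u \<or> y \<^bold>* u = y"
    using semigroup.idem_aperiodic_mult[OF opp_semigroup, of u y] u y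
      closedD[OF c, of y u] gen_base[of y "{y}" f] by simp
  moreover have "\<not> (u \<^bold>* y = u \<and> y \<^bold>* u = y)" "\<not> (u \<^bold>* y = y \<and> y \<^bold>* u = u)"
    using aperiodic_not_idem1[OF y] assoc u by metis+
  ultimately show ?thesis by blast
qed

text \<open>Two cyclic subsemigroups whose mixed products all collapse to a common zero. This is the
  shape in \<open>T\<close> that \<open>no_zero\<close> refutes in \<open>S\<close>.\<close>

lemma closed_zero_union:
  assumes "u \<^bold>* u = u" "x \<^bold>* y = u" "y \<^bold>* x = u"
    and "u \<^bold>* x = u" "x \<^bold>* u = u" "u \<^bold>* y = u" "y \<^bold>* u = u"
  shows "closed f (insert u (gen f {x} \<union> gen f {y}))"
proof -
  have zx: "u \<^bold>* p = u \<and> p \<^bold>* u = u \<and> p \<^bold>* y = u \<and> y \<^bold>* p = u" if "p \<in> gen f {x}" for p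
    using that
  proof (induction rule: gen_induct)
    case (mult p q)
    then show ?case by (metis assoc)
  qed (use assms in auto)
  have zy: "u \<^bold>* q = u \<and> q \<^bold>* u = u" if "q \<in> gen f {y}" for q
    using that
  proof (induction rule: gen_induct)
    case (mult p q)
    then show ?case by (metis assoc)
  qed (use assms in auto)
  have xy: "p \<^bold>* q = u \<and> q \<^bold>* p = u \<and> u \<^bold>* q = u \<and> q \<^bold>* u = u"
    if p: "p \<in> gen f {x}" and "q \<in> gen f {y}" for p q
    using that(2)
  proof (induction rule: gen_induct)
    case (mult q r)
    then show ?case by (metis assoc)
  qed (use zx[OF p] assms in auto)
  show ?thesis
    by (rule closedI) (use assms(1) zx zy xy in \<open>auto intro: gen_mult\<close>)
qed

end

section \<open>The element \<open>e'\<close> is an identity of the image of \<open>B\<close>\<close>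

locale pair_bij = orthodox_pair f a b e al be + closure_bij f g \<phi>
  for f :: "'a \<Rightarrow> 'a \<Rightarrow> 'a" (infixl \<open>\<cdot>\<close> 70) and a b e al be
    and g :: "'b \<Rightarrow> 'b \<Rightarrow> 'b" (infixl \<open>\<odot>\<close> 70) and \<phi> :: "'a \<Rightarrow> 'b"
begin

abbreviation "a' \<equiv> \<phi> a"
abbreviation "b' \<equiv> \<phi> b"
abbreviation "e' \<equiv> \<phi> e"
abbreviation "al' \<equiv> \<phi> al"
abbreviation "be' \<equiv> \<phi> be"

lemma pair_bij_opp: "pair_bij (opp f) b a e be al (opp g) \<phi>"
  by (intro pair_bij.intro opp_orthodox_pair closure_bij.opp_left opp_right)

lemma pair_bij_opp_right: "pair_bij f a b e al be (opp g) \<phi>"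
  by (intro pair_bij.intro opp_right orthodox_pair_axioms)

lemma e'_idem: "e' \<odot> e' = e'"
  by (simp add: phi_idem_iff idem_e)

lemma aperiodic_al': "aperiodic g al'" and aperiodic_be': "aperiodic g be'"
  by (simp_all add: phi_aperiodic_iff aperiodic_p aperiodic_q)

lemma phi_P: "n \<ge> 1 \<Longrightarrow> \<phi> (P n) = pw g al' n" and phi_Q: "n \<ge> 1 \<Longrightarrow> \<phi> (Q n) = pw g be' n"
  by (simp_all add: P_pw Q_pw phi_pw)

lemma image_B: "\<phi> ` B = gen g {al', be'}"
  using image_gen[of "{al, be}"] by (simp add: gen_pq)

lemma closed_image_B: "closed g (\<phi> ` B)"
  using els_closed by (simp flip: closed_iff)

text \<open>In \<open>S\<close> the element e is an identity for the powers of x, so adding it to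
  them gives a subsemigroup. Closedness is all that passes to \<open>T\<close>, and there a zero is
  conceivable too.\<close>

lemma unit_or_zero_image:
  assumes "x \<in> B" "aperiodic f x"
  shows "e' \<odot> \<phi> x = \<phi> x \<and> \<phi> x \<odot> e' = \<phi> x \<or> e' \<odot> \<phi> x = e' \<and> \<phi> x \<odot> e' = e'"
proof (rule T.unit_or_zero)
  have *: "e \<cdot> y = y \<and> y \<cdot> e = y" if "y \<in> gen f {x}" for y
  proof -
    have "gen f {x} \<subseteq> B" using assms els_closed by (simp add: gen_single_subset_iff)
    then show ?thesis using unit that by blast
  qed
  have "closed f (insert e (gen f {x}))"
    by (rule closedI) (use * in \<open>auto simp: idem_e intro: gen_mult\<close>)
  then show "closed g (insert e' (gen g {\<phi> x}))"
    using closed_iff[of "insert e (gen f {x})"] image_gen[of "{x}"] by simp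
qed (use assms e'_idem phi_aperiodic_iff in auto)

lemma mult_e_image:
  assumes "x \<in> B"
  shows "e' \<odot> \<phi> x = e' \<or> e' \<odot> \<phi> x = \<phi> x" "\<phi> x \<odot> e' = e' \<or> \<phi> x \<odot> e' = \<phi> x"
proof -
  have "(e' \<odot> \<phi> x = e' \<or> e' \<odot> \<phi> x = \<phi> x) \<and> (\<phi> x \<odot> e' = e' \<or> \<phi> x \<odot> e' = \<phi> x)"
  proof (cases "aperiodic f x")
    case True
    then show ?thesis using unit_or_zero_image[OF assms] by blast
  next
    case False
    then have "x \<cdot> x = x" using idem_or_aperiodic[OF assms] by blast
    then have "closed f {e, x}" using unit[OF assms] by (auto simp: closed_def idem_e)
    then have "closed g {e', \<phi> x}" using closed_iff[of "{e, x}"] by simp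
    then show ?thesis by (auto simp: closed_def)
  qed
  then show "e' \<odot> \<phi> x = e' \<or> e' \<odot> \<phi> x = \<phi> x" "\<phi> x \<odot> e' = e' \<or> \<phi> x \<odot> e' = \<phi> x" by blast+
qed

text \<open>Multiplying \<phi> u \<odot> \<phi> v by \<open>e'\<close> on the right gives \<phi> u,
  and an element of the image of \<open>B\<close> becomes itself or \<open>e'\<close>; so \<phi> v
  acts trivially on \<phi> u from both sides. Then the union of the two cyclic subsemigroups is
  closed and must contain \<open>e'\<close>, yet neither has an idempotent.\<close>

lemma no_mixed:
  assumes u: "aperiodic f u" and v: "aperiodic f v" and uv: "gen f {u, v} = B"
    and unit: "e' \<odot> \<phi> u = \<phi> u" "\<phi> u \<odot> e' = \<phi> u" and zero: "e' \<odot> \<phi> v = e'" "\<phi> v \<odot> e' = e'"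
  shows False
proof -
  have B: "u \<in> B" "v \<in> B" using uv gen_base[of _ "{u, v}" f] by auto
  have ne: "\<phi> u \<noteq> e'" using u not_aperiodic_e by auto
  have prods: "\<phi> u \<odot> \<phi> v = \<phi> u" "\<phi> v \<odot> \<phi> u = \<phi> u"
  proof -
    have "\<phi> u \<odot> \<phi> v \<in> \<phi> ` B" "\<phi> v \<odot> \<phi> u \<in> \<phi> ` B"
      using closedD[OF closed_image_B] B by auto
    then obtain z w where zw: "z \<in> B" "w \<in> B" "\<phi> u \<odot> \<phi> v = \<phi> z" "\<phi> v \<odot> \<phi> u = \<phi> w" by auto
    have "\<phi> z \<odot> e' = \<phi> u" "e' \<odot> \<phi> w = \<phi> u"
      using zero unit by (simp_all flip: zw) (simp_all add: T.assoc, simp flip: T.assoc)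
    then have "\<phi> z = \<phi> u" "\<phi> w = \<phi> u" using mult_e_image[OF zw(1)] mult_e_image[OF zw(2)] ne by auto
    then show "\<phi> u \<odot> \<phi> v = \<phi> u" "\<phi> v \<odot> \<phi> u = \<phi> u" using zw by auto
  qed
  have pv: "p \<odot> \<phi> v = p \<and> \<phi> v \<odot> p = p" if "p \<in> gen g {\<phi> u}" for p
    using that
  proof (induction rule: gen_induct)
    case (mult p q)
    then show ?case by (metis T.assoc)
  qed (use prods in auto)
  have pq: "p \<odot> q = p \<and> q \<odot> p = p" if p: "p \<in> gen g {\<phi> u}" and "q \<in> gen g {\<phi> v}" for p q
    using that(2)
  proof (induction rule: gen_induct)
    case (mult q r)
    then show ?case by (metis T.assoc)
  qed (use pv[OF p] in auto)
  have "closed g (gen g {\<phi> u} \<union> gen g {\<phi> v})"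
    by (rule closedI) (use pq in \<open>auto intro: gen_mult\<close>)
  then have "gen g {\<phi> u, \<phi> v} \<subseteq> gen g {\<phi> u} \<union> gen g {\<phi> v}"
    by (rule gen_minimal) (auto intro: gen_base)
  moreover have "e' \<in> gen g {\<phi> u, \<phi> v}"
    using in_gen_iff[of e "{u, v}"] uv e_in by simp
  ultimately have "e' \<in> gen g {\<phi> u} \<union> gen g {\<phi> v}" by blast
  then show False
    using T.aperiodic_not_idem[of "\<phi> u"] T.aperiodic_not_idem[of "\<phi> v"] u v e'_idem
    by (auto simp: T.gen_single phi_aperiodic_iff)
qed

text \<open>Since B - {e} is not a subsemigroup, e' is a nontrivial product in T.\<close>

lemma e'_factors:
  obtains i j where "i \<ge> 1" "j \<ge> 1" "\<phi> (P i) \<odot> \<phi> (Q j) = e' \<or> \<phi> (Q j) \<odot> \<phi> (P i) = e'"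
proof -
  have "\<not> closed f (B - {e})"
  proof
    assume c: "closed f (B - {e})"
    have "al \<in> B - {e}" "be \<in> B - {e}" using aperiodic_p aperiodic_q not_aperiodic_e p_in q_in by auto
    then have "al \<cdot> be \<in> B - {e}" by (rule closedD[OF c])
    then show False by (simp add: al_be)
  qed
  then have "\<not> closed g (\<phi> ` (B - {e}))" by (simp flip: closed_iff)
  then obtain x y where xy: "x \<in> B" "x \<noteq> e" "y \<in> B" "y \<noteq> e" "\<phi> x \<odot> \<phi> y \<notin> \<phi> ` (B - {e})"
    by (auto simp: closed_def)
  moreover have "\<phi> x \<odot> \<phi> y \<in> \<phi> ` B" using closedD[OF closed_image_B] xy by auto
  ultimately have e': "\<phi> x \<odot> \<phi> y = e'" by auto
  have "\<phi> x \<odot> \<phi> y \<in> gen g {\<phi> x, \<phi> y}" by (intro gen_mult gen_base) auto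
  then have "e \<in> gen f {x, y}" using in_gen_iff[of e "{x, y}"] e' by simp
  then obtain i j where "i \<ge> 1" "j \<ge> 1" "x = P i \<and> y = Q j \<or> x = Q j \<and> y = P i"
    using gen_e_imp_powers xy by metis
  then show thesis using that[of i j] e' by blast
qed

lemma no_zero:
  assumes "e' \<odot> al' = e'" "al' \<odot> e' = e'" "e' \<odot> be' = e'" "be' \<odot> e' = e'"
  shows False
proof -
  have zero: "e' \<odot> y = e' \<and> y \<odot> e' = e'" if "y \<in> \<phi> ` B" for y
    using that unfolding image_B
  proof (induction rule: gen_induct)
    case (mult x y)
    then show ?case by (metis T.assoc)
  qed (use assms in auto)
  \<comment> \<open>With \<open>e'\<close> as zero, the square of the reversed product is \<phi> y
    \<odot> \<open>e'\<close> \<odot> \<phi> x = \<open>e'\<close>; an element with an idempotent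
    power is idempotent, so the reversed product is \<open>e'\<close> itself.\<close>
  have rev: "\<phi> y \<odot> \<phi> x = e'" if xy: "x \<in> B" "y \<in> B" "\<phi> x \<odot> \<phi> y = e'" for x y
  proof -
    have "\<phi> y \<odot> \<phi> x \<in> \<phi> ` B" using closedD[OF closed_image_B] xy by auto
    then obtain z where z: "z \<in> B" "\<phi> y \<odot> \<phi> x = \<phi> z" by auto
    have "\<phi> z \<odot> \<phi> z = \<phi> y \<odot> (\<phi> x \<odot> \<phi> y) \<odot> \<phi> x" by (simp only: z(2)[symmetric] T.assoc)
    also have "\<dots> = e'" using zero xy by (metis image_eqI)
    finally have zz: "\<phi> z \<odot> \<phi> z = e'" .
    have "\<phi> z = e'"
    proof (cases "aperiodic g (\<phi> z)")
      case True
      have "pw g (\<phi> z) 2 = e'" using zz pw_Suc[of 1 g "\<phi> z"] by (simp add: numeral_2_eq_2)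
      then show ?thesis using T.aperiodic_not_idem[OF True, of 2] e'_idem by simp
    next
      case False
      then show ?thesis using T_idem_or_aperiodic[of "\<phi> z"] zz by simp
    qed
    then show ?thesis using z by simp
  qed
  obtain i j where ij: "i \<ge> 1" "j \<ge> 1" "\<phi> (P i) \<odot> \<phi> (Q j) = e' \<or> \<phi> (Q j) \<odot> \<phi> (P i) = e'"
    by (rule e'_factors)
  then have PQ: "\<phi> (P i) \<odot> \<phi> (Q j) = e'" "\<phi> (Q j) \<odot> \<phi> (P i) = e'"
    using rev P_in Q_in by metis+
  \<comment> \<open>Chosen so that the j-th power of \<open>P i\<close> times \<open>Q n\<close> is
    \<open>be\<close>. As n \<ge> 2, \<open>be\<close> is no power of \<open>Q n\<close> or
    \<open>P i\<close> by degree, whereas closedness in \<open>T\<close> would confine it to e and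
    these powers.\<close>
  define n where "n = i * j + 1"
  define r where "r = n - j"
  have "i * j \<ge> 1 * j" using ij(1) by (rule mult_le_mono1)
  then have n: "n = j + r" "r \<ge> 1" "n \<ge> 2" using ij(2) unfolding n_def r_def by linarith+
  then have "\<phi> (Q n) = \<phi> (Q j) \<odot> \<phi> (Q r)" "\<phi> (Q n) = \<phi> (Q r) \<odot> \<phi> (Q j)"
    using T.pw_add[of j r be'] T.pw_add[of r j be'] ij by (simp_all add: phi_Q add.commute)
  then have "\<phi> (P i) \<odot> \<phi> (Q n) = e'" "\<phi> (Q n) \<odot> \<phi> (P i) = e'"
    using PQ zero Q_in by (metis T.assoc image_eqI)+
  then have "closed g (insert e' (gen g {\<phi> (P i)} \<union> gen g {\<phi> (Q n)}))"
    using zero P_in Q_in e'_idem by (intro T.closed_zero_union) (simp_all)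
  then have "closed f (insert e (gen f {P i} \<union> gen f {Q n}))"
    unfolding closed_iff by (simp add: image_gen image_Un)
  then have sub: "gen f {P i, Q n} \<subseteq> insert e (gen f {P i} \<union> gen f {Q n})"
    by (rule gen_minimal) (auto intro: gen_base)
  have "pw f (P i) j = P (i * j)" using ij pw_mult[of j i al] by (simp add: P_pw Suc_le_eq)
  moreover have "P (i * j) \<cdot> Q n = be" by (simp add: PQ_le n_def Q_1)
  moreover have "pw f (P i) j \<cdot> Q n \<in> gen f {P i, Q n}"
    using ij by (intro gen_mult pw_gen gen_base) auto
  ultimately have "be \<in> insert e (gen f {P i} \<union> gen f {Q n})" using sub by auto
  then consider "be = e" | k where "k \<ge> 1" "be = pw f (P i) k" | k where "k \<ge> 1" "be = pw f (Q n) k"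
    by (auto simp: gen_single)
  then show False
  proof cases
    case 1
    then show False using aperiodic_q not_aperiodic_e by simp
  next
    case 2
    from 2(2) have "dg be = dg (pw f (P i) k)" by (rule arg_cong)
    then have "- 1 = int (k * i)" using deg_pw[OF 2(1) P_in[of i]] by simp
    then show False by linarith
  next
    case 3
    from 3(2) have "dg be = dg (pw f (Q n) k)" by (rule arg_cong)
    then have "int (k * n) = 1" using deg_pw[OF 3(1) Q_in[of n]] by simp
    then have "k * n = 1" by linarith
    then show False using n by simp
  qed
qed

lemma image_B_unit: "x \<in> B \<Longrightarrow> e' \<odot> \<phi> x = \<phi> x \<and> \<phi> x \<odot> e' = \<phi> x"
proof -
  have qp: "gen f {be, al} = B" using gen_pq by (simp add: insert_commute)
  have "(e' \<odot> al' = al' \<and> al' \<odot> e' = al') \<and> (e' \<odot> be' = be' \<and> be' \<odot> e' = be')"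
    using unit_or_zero_image[OF p_in aperiodic_p] unit_or_zero_image[OF q_in aperiodic_q]
  proof (elim disjE conjE)
    assume "e' \<odot> al' = al'" "al' \<odot> e' = al'" "e' \<odot> be' = e'" "be' \<odot> e' = e'"
    then show ?thesis by (rule no_mixed[OF aperiodic_p aperiodic_q gen_pq, THEN FalseE])
  next
    assume "e' \<odot> al' = e'" "al' \<odot> e' = e'" "e' \<odot> be' = be'" "be' \<odot> e' = be'"
    then show ?thesis using no_mixed[OF aperiodic_q aperiodic_p qp] by blast
  next
    assume "e' \<odot> al' = e'" "al' \<odot> e' = e'" "e' \<odot> be' = e'" "be' \<odot> e' = e'"
    then show ?thesis by (rule no_zero[THEN FalseE])
  qed blast
  note gens = this
  assume "x \<in> B"
  then have "\<phi> x \<in> gen g {al', be'}" by (simp flip: image_B)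
  then show ?thesis
  proof (induction "\<phi> x" arbitrary: x rule: gen_induct)
    case base
    then show ?case using gens by auto
  next
    case (mult y z)
    then show ?case by (metis T.assoc phi_surj)
  qed
qed

text \<open>Splitting off one factor at a time gives a right inverse of \<open>al'\<close> and a
  left inverse of \<open>be'\<close> in the image of \<open>B\<close>; by
  \<open>gen_e_imp_powers\<close> they are \<open>be'\<close>^k and \<open>al'\<close>^l. If kl > 1,
  then \<open>al'\<close>^l is inverted by both \<open>be'\<close> and \<open>be'\<close>^(kl),
  which makes \<open>be'\<close>^(kl-1) equal to \<open>e'\<close>.\<close>

lemma al'_be'_if:
  assumes ij: "i \<ge> 1" "j \<ge> 1" "\<phi> (P i) \<odot> \<phi> (Q j) = e'"
  shows "al' \<odot> be' = e'"
proof -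
  have ne: "\<phi> x \<noteq> e'" if "aperiodic f x" for x using that not_aperiodic_e by auto
  have fac: "\<exists>m\<ge>1. \<exists>n\<ge>1. x = P m \<and> y = Q n \<or> x = Q n \<and> y = P m"
    if xy: "x \<in> B" "y \<in> B" "x \<noteq> e" "y \<noteq> e" "\<phi> x \<odot> \<phi> y = e'" for x y
  proof -
    have "\<phi> x \<odot> \<phi> y \<in> gen g {\<phi> x, \<phi> y}" by (intro gen_mult gen_base) auto
    then have "e \<in> gen f {x, y}" using in_gen_iff[of e "{x, y}"] xy by simp
    then show ?thesis using gen_e_imp_powers[of x y] xy by metis
  qed
  have e1: "al \<noteq> e" "be \<noteq> e" using aperiodic_p aperiodic_q not_aperiodic_e by auto
  have alQ: "al \<noteq> Q n" "be \<noteq> P n" for n using deg_0(2,3) deg_0(4,5)[of n] by fastforce+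
  have "\<exists>w\<in>B. al' \<odot> \<phi> w = e'"
  proof (cases "i = 1")
    case True
    then show ?thesis using ij Q_in by (auto simp: P_1)
  next
    case False
    then have i: "i - 1 \<ge> 1" using ij by simp
    have "\<phi> (P (i - 1)) \<odot> \<phi> (Q j) \<in> \<phi> ` B" using closedD[OF closed_image_B] P_in Q_in by auto
    then obtain w where w: "w \<in> B" "\<phi> (P (i - 1)) \<odot> \<phi> (Q j) = \<phi> w" by auto
    have "\<phi> (P i) = al' \<odot> \<phi> (P (i - 1))" using i ij pw_Suc[OF i, of g al'] by (simp add: phi_P)
    then have "al' \<odot> \<phi> w = e'" using ij(3) w(2) by (metis T.assoc)
    then show ?thesis using w(1) by blast
  qed
  then obtain w where w: "w \<in> B" "al' \<odot> \<phi> w = e'" by blast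
  have "w \<noteq> e" using w(2) image_B_unit[OF p_in] ne[OF aperiodic_p] by auto
  then obtain k where k: "k \<ge> 1" "w = Q k" using fac[OF p_in w(1) e1(1) _ w(2)] alQ by metis
  have "\<exists>w\<in>B. \<phi> w \<odot> be' = e'"
  proof (cases "j = 1")
    case True
    then show ?thesis using ij P_in by (auto simp: Q_1)
  next
    case False
    then have j: "j - 1 \<ge> 1" using ij by simp
    have "\<phi> (P i) \<odot> \<phi> (Q (j - 1)) \<in> \<phi> ` B" using closedD[OF closed_image_B] P_in Q_in by auto
    then obtain w where w: "w \<in> B" "\<phi> (P i) \<odot> \<phi> (Q (j - 1)) = \<phi> w" by auto
    have "\<phi> (Q j) = \<phi> (Q (j - 1)) \<odot> be'" using j ij T.pw_Suc2[OF j, of be'] by (simp add: phi_Q)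
    then have "\<phi> w \<odot> be' = e'" using ij(3) w(2) by (metis T.assoc)
    then show ?thesis using w(1) by blast
  qed
  then obtain v where v: "v \<in> B" "\<phi> v \<odot> be' = e'" by blast
  have "v \<noteq> e" using v(2) image_B_unit[OF q_in] ne[OF aperiodic_q] by auto
  then obtain l where l: "l \<ge> 1" "v = P l" using fac[OF v(1) q_in _ e1(2) v(2)] alQ by metis
  have kn: "pw g al' n \<odot> pw g be' (k * n) = e'" if "n \<ge> 1" for n
    using that
  proof (induction n rule: nat_induct_at_least)
    case base
    then show ?case using w k by (simp add: phi_Q)
  next
    case (Suc n)
    have "pw g al' (Suc n) \<odot> pw g be' (k * Suc n) =
        pw g al' n \<odot> (al' \<odot> pw g be' k) \<odot> pw g be' (k * n)"
      using Suc k T.pw_Suc2[of n al'] T.pw_add[of k "k * n" be'] by (simp add: T.assoc)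
    also have "al' \<odot> pw g be' k = e'" using w k by (simp add: phi_Q)
    also have "pw g al' n \<odot> e' = pw g al' n" using image_B_unit[OF P_in[of n]] Suc by (simp add: phi_P)
    finally show ?case using Suc by simp
  qed
  show ?thesis
  proof (cases "k * l = 1")
    case True
    then show ?thesis using w k by (simp add: Q_1)
  next
    case False
    moreover have "1 * 1 \<le> k * l" using k(1) l(1) by (rule mult_le_mono)
    ultimately have kl: "k * l - 1 \<ge> 1" by linarith
    have "e' = pw g al' l \<odot> be' \<odot> pw g be' (k * l - 1)"
    proof -
      have "Suc (k * l - 1) = k * l" using kl by linarith
      then show ?thesis using kn[OF l(1)] pw_Suc[OF kl, of g be'] by (metis T.assoc)
    qed
    also have "\<dots> = pw g be' (k * l - 1)"
      using v l image_B_unit[OF Q_in[of "k * l - 1"]] kl by (simp add: phi_P phi_Q)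
    finally show ?thesis using T.aperiodic_not_idem[OF aperiodic_be' kl] e'_idem by simp
  qed
qed

lemma al'_be': "al' \<odot> be' = e' \<or> be' \<odot> al' = e'"
proof -
  obtain i j where ij: "i \<ge> 1" "j \<ge> 1" "\<phi> (P i) \<odot> \<phi> (Q j) = e' \<or> \<phi> (Q j) \<odot> \<phi> (P i) = e'"
    by (rule e'_factors)
  then show ?thesis
    using al'_be'_if[of i j] pair_bij.al'_be'_if[OF pair_bij_opp_right, of i j] by auto
qed

end

section \<open>Orientation\<close>

context bicyclic_pair
begin

lemma gen_P_Q_sub: "gen f {P m, Q m} \<subseteq> {E (m * i) (m * j) | i j. True}"
proof (rule gen_minimal)
  show "closed f {E (m * i) (m * j) | i j. True}"
  proof (rule closedI)
    fix x y assume "x \<in> {E (m * i) (m * j) | i j. True}" "y \<in> {E (m * i) (m * j) | i j. True}"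
    then obtain i j k l where "x = E (m * i) (m * j)" "y = E (m * k) (m * l)" by blast
    then have "x \<cdot> y = E (m * i) (m * (j - k + l)) \<or> x \<cdot> y = E (m * (i + (k - j))) (m * l)"
      by (auto simp: el_mult diff_mult_distrib2 add_mult_distrib2)
    then show "x \<cdot> y \<in> {E (m * i) (m * j) | i j. True}" by blast
  qed
  have "P m = E (m * 0) (m * 1)" "Q m = E (m * 1) (m * 0)" by (simp_all add: el_0)
  then show "{P m, Q m} \<subseteq> {E (m * i) (m * j) | i j. True}" by blast
qed

lemma gen_E_p_sub: "gen f {E m m, p} \<subseteq> {E i j | i j. i \<le> m \<and> i \<le> j}"
proof (rule gen_minimal)
  show "closed f {E i j | i j. i \<le> m \<and> i \<le> j}"
  proof (rule closedI)
    fix x y assume "x \<in> {E i j | i j. i \<le> m \<and> i \<le> j}" "y \<in> {E i j | i j. i \<le> m \<and> i \<le> j}"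
    then obtain i j k l where *: "x = E i j" "i \<le> m" "i \<le> j" "y = E k l" "k \<le> m" "k \<le> l" by blast
    show "x \<cdot> y \<in> {E i j | i j. i \<le> m \<and> i \<le> j}"
    proof (cases "k \<le> j")
      case True
      then have "x \<cdot> y = E i (j - k + l) \<and> i \<le> m \<and> i \<le> j - k + l" using * by (simp add: el_mult)
      then show ?thesis by blast
    next
      case False
      then have "x \<cdot> y = E (i + (k - j)) l" using * by (simp add: el_mult)
      moreover have "i + (k - j) \<le> m" "i + (k - j) \<le> l" using * False by linarith+
      ultimately show ?thesis by blast
    qed
  qed
  have "p = E 0 1" by (simp add: el_0 P_1)
  then show "{E m m, p} \<subseteq> {E i j | i j. i \<le> m \<and> i \<le> j}" by blast
qed

text \<open>This makes degrees visible to the lattice: the generators are the idempotents of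
  \<open>B\<close> and one power of p, all with known images once \<open>phi_E_diag\<close> is
  available.\<close>

lemma gen_deg:
  assumes N: "N \<ge> 1"
  shows "gen f (insert (P N) (range (\<lambda>m. E m m))) = {x \<in> B. dg x \<ge> 0 \<and> int N dvd dg x}"
    (is "gen f ?X = ?D")
proof
  show "gen f ?X \<subseteq> ?D"
  proof (rule gen_minimal)
    show "closed f ?D" by (rule closedI) (auto simp: deg_mult els_mult)
    show "?X \<subseteq> ?D" by (auto simp: P_in el_in)
  qed
  show "?D \<subseteq> gen f ?X"
  proof
    fix x assume x: "x \<in> ?D"
    then obtain m n where mn: "x = E m n" by (auto elim: elsE)
    then have "m \<le> n" using x by simp
    then have "int N dvd int (n - m)" using x mn by (simp add: of_nat_diff)
    then have "N dvd n - m" by (simp only: int_dvd_int_iff)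
    then obtain k where "n - m = N * k" by (rule dvdE)
    then have k: "n = m + N * k" using \<open>m \<le> n\<close> by simp
    have Em: "E i i \<in> gen f ?X" for i by (intro gen_base) auto
    have "E m m \<cdot> P (N * k) = x"
      using el_mult[of m m 0 "N * k"] by (simp add: mn k el_0)
    moreover have "P (N * k) \<in> gen f ?X"
    proof (cases "k = 0")
      case True
      then show ?thesis using Em[of 0] by (simp add: el_0)
    next
      case False
      then have "P (N * k) = pw f (P N) k" using N by (simp add: P_pw pw_mult)
      moreover have "pw f (P N) k \<in> gen f ?X" using False by (intro pw_gen gen_base) auto
      ultimately show ?thesis by simp
    qed
    ultimately show "x \<in> gen f ?X" using gen_mult[OF Em] by metis
  qed
qed

end

lemma nat_eqI_dvd:
  assumes "\<And>N. N \<ge> 1 \<Longrightarrow> N dvd m \<longleftrightarrow> N dvd (n::nat)"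
  shows "m = n"
proof (cases "m = 0 \<or> n = 0")
  case True
  then show ?thesis using assms[of "Suc n"] assms[of "Suc m"] by (auto dest: dvd_imp_le)
next
  case False
  then show ?thesis using assms[of m] assms[of n] by (auto intro: dvd_antisym)
qed

section \<open>The action of \<open>e'\<close> on \<open>a'\<close> and \<open>b'\<close>\<close>

context pair_bij
begin

text \<open>The right-hand side is closed because \<open>sandwich\<close> removes inner factors e.
  It leaves only \<open>e'\<close> and the powers of \<open>a'\<close> and \<open>al'\<close> as
  candidates for \<open>e'\<close> \<odot> \<open>a'\<close> and \<open>a'\<close> \<odot>
  \<open>e'\<close>.\<close>

lemma gen_e_a_sub: "gen f {e, a} \<subseteq> insert e (gen f {a} \<union> gen f {al})"
proof (rule gen_minimal)
  have ae: "x \<cdot> e \<in> gen f {al} \<and> e \<cdot> x = x" if "x \<in> gen f {a}" for x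
    using that
  proof (induction rule: gen_induct)
    case (mult x y)
    have "x \<cdot> y \<cdot> e = (x \<cdot> e) \<cdot> (y \<cdot> e)" by (simp add: sandwich flip: assoc)
    then show ?case using mult gen_mult by (metis assoc)
  qed (simp add: al ea gen_base)
  have ale: "x \<cdot> e = x \<and> e \<cdot> x = x \<and> (\<exists>y\<in>gen f {a}. x = y \<cdot> e)" if "x \<in> gen f {al}" for x
    using that
  proof (induction rule: gen_induct)
    case (mult x y)
    then obtain x' y' where *: "x' \<in> gen f {a}" "y' \<in> gen f {a}" "x = x' \<cdot> e" "y = y' \<cdot> e" by blast
    then have "x \<cdot> y = (x' \<cdot> y') \<cdot> e" by (simp add: sandwich flip: assoc)
    moreover have "x' \<cdot> y' \<in> gen f {a}" using * by (intro gen_mult)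
    moreover have "x \<cdot> y \<cdot> e = x \<cdot> y" "e \<cdot> (x \<cdot> y) = x \<cdot> y" using mult by (metis assoc)+
    ultimately show ?case by blast
  next
    case (base x)
    then show ?case using al pe ep gen_base[of a "{a}" f] by auto
  qed
  show "closed f (insert e (gen f {a} \<union> gen f {al}))"
  proof (rule closedI)
    fix x y assume xy: "x \<in> insert e (gen f {a} \<union> gen f {al})" "y \<in> insert e (gen f {a} \<union> gen f {al})"
    consider "x = e" | "y = e" | "x \<in> gen f {a}" "y \<in> gen f {a}" | "x \<in> gen f {al}" "y \<in> gen f {a}"
      | "x \<in> gen f {a} \<union> gen f {al}" "y \<in> gen f {al}" using xy by blast
    then show "x \<cdot> y \<in> insert e (gen f {a} \<union> gen f {al})"
    proof cases
      case 1
      then show ?thesis using xy ae ale by (auto simp: idem_e)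
    next
      case 2
      then show ?thesis using xy ae ale by (auto simp: idem_e)
    next
      case 3
      then show ?thesis using gen_mult[of x f "{a}" y] by simp
    next
      case 4
      then obtain x' where "x' \<in> gen f {a}" "x = x' \<cdot> e" using ale by blast
      then show ?thesis using gen_mult[of x' f "{a}" y] 4 by (simp add: sandwich)
    next
      case 5
      have "x \<cdot> e \<in> gen f {al}" using 5 ae ale by auto
      then have "x \<cdot> e \<cdot> y \<in> gen f {al}" by (rule gen_mult) (use 5 in simp)
      then show ?thesis by (simp add: sandwich)
    qed
  qed
  show "{e, a} \<subseteq> insert e (gen f {a} \<union> gen f {al})" by (auto intro: gen_base)
qed

lemma core_pw_a: "n \<ge> 1 \<Longrightarrow> e \<cdot> pw f a n \<cdot> e = pw f al n"
  by (simp add: core_pw ea al)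

lemma al_notin_gen_a:
  assumes "a \<notin> B"
  shows "al \<notin> gen f {a}"
proof
  assume "al \<in> gen f {a}"
  then obtain n where n: "al = pw f a n" "n \<ge> 1" by (auto simp: gen_single)
  then have "e \<cdot> al \<cdot> e = pw f al n" using core_pw_a by metis
  then have "pw f al 1 = pw f al n" by (simp add: ep pe)
  then have "n = 1" using aperiodicD[OF aperiodic_p, of 1 n] n by simp
  then show False using n assms p_in by simp
qed

text \<open>The product of \<open>be\<close> and a escapes: its core has degree 0, unlike that of a
  power of a, and if it were in \<open>B\<close>, then so would be \<open>al\<close> times it, which
  is a.\<close>

lemma not_closed_gen_a_B:
  assumes "a \<notin> B"
  shows "\<not> closed g (gen g {a'} \<union> \<phi> ` B)"
proof
  assume "closed g (gen g {a'} \<union> \<phi> ` B)"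
  then have c: "closed f (gen f {a} \<union> B)" unfolding closed_iff by (simp add: image_Un image_gen)
  have "be \<cdot> a \<in> gen f {a} \<union> B" by (rule closedD[OF c]) (auto simp: q_in intro: gen_base)
  then show False
  proof
    assume "be \<cdot> a \<in> gen f {a}"
    then obtain n where n: "be \<cdot> a = pw f a n" "n \<ge> 1" by (auto simp: gen_single)
    have "e \<cdot> (be \<cdot> a) \<cdot> e = be \<cdot> al" using eq by (simp add: al assoc flip: assoc[of e be])
    then have "dg (be \<cdot> al) = dg (pw f al n)" using n core_pw_a by simp
    then show False using n deg_pw[OF n(2) p_in] by (simp add: deg_mult p_in q_in)
  next
    assume "be \<cdot> a \<in> B"
    then have "al \<cdot> (be \<cdot> a) \<in> B" using p_in els_mult by blast
    then show False using assms by (simp add: al_be ea flip: assoc)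
  qed
qed

lemma al'_in_closed: "closed g C \<Longrightarrow> e' \<in> C \<Longrightarrow> a' \<in> C \<Longrightarrow> al' \<in> C"
proof -
  assume C: "closed g C" "e' \<in> C" "a' \<in> C"
  have "a' \<odot> e' \<in> gen g {e', a'}" "a \<cdot> e \<in> gen f {e, a}" by (intro gen_mult gen_base; simp)+
  then have "al' \<in> gen g {e', a'}" using in_gen_iff[of al "{e, a}"] by (simp add: al)
  then show "al' \<in> C" using gen_minimal[OF C(1), of "{e', a'}"] C by auto
qed

lemma gen_al'_sub: "gen g {al'} \<subseteq> \<phi> ` B"
  using closed_image_B p_in by (simp add: gen_single_subset_iff)

lemma image_unit: "y \<in> \<phi> ` B \<Longrightarrow> e' \<odot> y = y" "y \<in> \<phi> ` B \<Longrightarrow> y \<odot> e' = y"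
  using image_B_unit by auto

text \<open>Let c be the power of \<open>al'\<close> in question. Adding \<open>e'\<close> to the
  powers of \<open>a'\<close> and of c gives a closed set, which therefore contains
  \<open>al'\<close>; so \<open>al'\<close> is in turn a power of c, and both exponents are
  1.\<close>

lemma e'_a'_eq_al':
  assumes a: "a \<notin> B" and a'e': "a' \<odot> e' = a'" and e'a': "e' \<odot> a' \<in> gen g {al'}"
  shows "e' \<odot> a' = al'"
proof -
  define c where "c = e' \<odot> a'"
  have ec: "e' \<odot> y = y \<and> y \<odot> e' = y" if "y \<in> gen g {c}" for y
  proof -
    have "gen g {c} \<subseteq> \<phi> ` B" unfolding gen_single_subset_iff[OF closed_image_B]
      using e'a' gen_al'_sub by (auto simp: c_def)
    then show ?thesis using that image_unit by blast
  qed
  have ea: "e' \<odot> x \<in> gen g {c} \<and> x \<odot> e' = x" if x: "x \<in> gen g {a'}" for x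
  proof -
    obtain n where n: "x = pw g a' n" "n \<ge> 1" using x by (auto simp: T.gen_single)
    then have "e' \<odot> x = pw g c n" using T.unit_mult_pw[OF _ a'e', of n] by (simp add: c_def)
    then have "e' \<odot> x \<in> gen g {c}" using n by (auto simp: T.gen_single)
    moreover have "x \<odot> e' = x" using x
      by (induction rule: gen_induct) (simp_all add: a'e' T.assoc)
    ultimately show ?thesis by simp
  qed
  have ce: "\<exists>x\<in>gen g {a'}. y = e' \<odot> x" if y: "y \<in> gen g {c}" for y
  proof -
    obtain n where n: "y = pw g c n" "n \<ge> 1" using y by (auto simp: T.gen_single)
    then have "y = e' \<odot> pw g a' n" using T.unit_mult_pw[OF _ a'e', of n] by (simp add: c_def)
    then show ?thesis using n by (auto simp: T.gen_single)
  qed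
  have "closed g (insert e' (gen g {a'} \<union> gen g {c}))"
  proof (rule closedI)
    fix x y assume xy: "x \<in> insert e' (gen g {a'} \<union> gen g {c})" "y \<in> insert e' (gen g {a'} \<union> gen g {c})"
    consider "x = e'" | "y = e'" | "x \<in> gen g {a'}" "y \<in> gen g {a'}" | "x \<in> gen g {a'}" "y \<in> gen g {c}"
      | "x \<in> gen g {c}" "y \<in> gen g {a'} \<union> gen g {c}" using xy by blast
    then show "x \<odot> y \<in> insert e' (gen g {a'} \<union> gen g {c})"
    proof cases
      case 1
      then show ?thesis using xy ea ec e'_idem by auto
    next
      case 2
      then show ?thesis using xy ea ec e'_idem by auto
    next
      case 3
      then show ?thesis using gen_mult[of x g "{a'}" y] by simp
    next
      case 4
      then obtain z where "z \<in> gen g {a'}" "y = e' \<odot> z" using ce by blast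
      moreover from this have "x \<odot> y = x \<odot> z" using ea[OF 4(1)] by (simp flip: T.assoc)
      ultimately show ?thesis using gen_mult[of x g "{a'}" z] 4 by simp
    next
      case 5
      then have "e' \<odot> y \<in> gen g {c}" using ea ec by auto
      moreover have "x \<odot> y = x \<odot> (e' \<odot> y)" using ec[OF 5(1)] by (simp flip: T.assoc)
      ultimately show ?thesis using gen_mult[of x g "{c}" "e' \<odot> y"] 5 by simp
    qed
  qed
  then have "al' \<in> insert e' (gen g {a'} \<union> gen g {c})"
    by (rule al'_in_closed) (auto intro: gen_base)
  moreover have "al' \<noteq> e'" using aperiodic_p not_aperiodic_e by auto
  moreover have "al' \<notin> gen g {a'}" using al_notin_gen_a[OF a] in_gen_iff[of al "{a}"] by simp
  ultimately obtain k where k: "al' = pw g c k" "k \<ge> 1" by (auto simp: T.gen_single)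
  obtain n where n: "c = pw g al' n" "n \<ge> 1" using e'a' by (auto simp: c_def T.gen_single)
  have nk: "n * k \<ge> 1" using n(2) k(2) by (simp add: Suc_le_eq)
  have "pw g al' 1 = pw g al' (n * k)"
    using k(1) T.pw_mult[OF k(2) n(2), of al'] unfolding n(1) by simp
  then have "n * k = 1" using aperiodicD[OF aperiodic_al' _ _ nk] by (metis order_refl)
  then have "n = 1" by simp
  then have "c = al'" using n(1) by (simp only: pw_1)
  then show ?thesis by (simp only: c_def)
qed

text \<open>If both products were in {\<open>e'\<close>, \<open>a'\<close>}, then \<open>e'\<close>
  with the powers of \<open>a'\<close> would be closed without containing \<open>al'\<close>. If
  both were powers of \<open>al'\<close>, the set of \<open>not_closed_gen_a_B\<close> would be
  closed. Bracketing \<open>e'\<close> \<odot> \<open>a'\<close> \<odot> \<open>e'\<close> in two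
  ways excludes \<open>e'\<close> beside a power of \<open>al'\<close>.\<close>

lemma a'_cases:
  "e' \<odot> a' = a' \<and> a' \<odot> e' = al' \<or> e' \<odot> a' = al' \<and> a' \<odot> e' = a'"
proof (cases "a \<in> B")
  case True
  then show ?thesis using image_B_unit[OF True] idem_a_B by metis
next
  case False
  have ap: "aperiodic g a'" by (simp add: phi_aperiodic_iff aperiodic_a)
  have "gen g {e', a'} = \<phi> ` gen f {e, a}" by (simp add: image_gen)
  also have "\<dots> \<subseteq> insert e' (gen g {a'} \<union> gen g {al'})"
    using image_mono[OF gen_e_a_sub, of \<phi>] by (simp add: image_Un image_gen)
  finally have sub: "gen g {e', a'} \<subseteq> insert e' (gen g {a'} \<union> gen g {al'})" .
  have "e' \<odot> a' \<in> gen g {e', a'}" "a' \<odot> e' \<in> gen g {e', a'}" by (intro gen_mult gen_base; simp)+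
  then have mem: "e' \<odot> a' \<in> insert e' (gen g {a'}) \<or> e' \<odot> a' \<in> gen g {al'}"
    "a' \<odot> e' \<in> insert e' (gen g {a'}) \<or> a' \<odot> e' \<in> gen g {al'}" using sub by auto
  have left: "e' \<odot> a' = e' \<or> e' \<odot> a' = a' \<or> e' \<odot> a' \<in> gen g {al'}"
    using mem(1) T.idem_aperiodic_mult[OF e'_idem ap] by blast
  have right: "a' \<odot> e' = e' \<or> a' \<odot> e' = a' \<or> a' \<odot> e' \<in> gen g {al'}"
    using mem(2) semigroup.idem_aperiodic_mult[OF T.opp_semigroup, of e' a'] ap e'_idem by auto
  have not_both: False if "e' \<odot> a' = e' \<or> e' \<odot> a' = a'" "a' \<odot> e' = e' \<or> a' \<odot> e' = a'"
  proof -
    have l: "e' \<odot> x = e' \<or> e' \<odot> x = x" if "x \<in> gen g {a'}" for x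
    proof (cases "e' \<odot> a' = a'")
      case True
      have "e' \<odot> x = x" using that by (induction rule: gen_induct) (simp_all add: True flip: T.assoc)
      then show ?thesis by simp
    next
      case False
      then have *: "e' \<odot> a' = e'" using \<open>e' \<odot> a' = e' \<or> e' \<odot> a' = a'\<close> by simp
      have "e' \<odot> x = e'" using that by (induction rule: gen_induct) (simp_all add: * flip: T.assoc)
      then show ?thesis by simp
    qed
    have r: "x \<odot> e' = e' \<or> x \<odot> e' = x" if "x \<in> gen g {a'}" for x
    proof (cases "a' \<odot> e' = a'")
      case True
      have "x \<odot> e' = x" using that by (induction rule: gen_induct) (simp_all add: True T.assoc)
      then show ?thesis by simp
    next
      case False
      then have *: "a' \<odot> e' = e'" using \<open>a' \<odot> e' = e' \<or> a' \<odot> e' = a'\<close> by simp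
      have "x \<odot> e' = e'" using that by (induction rule: gen_induct) (simp_all add: * T.assoc)
      then show ?thesis by simp
    qed
    have "closed g (insert e' (gen g {a'}))"
    proof (rule closedI)
      fix x y assume "x \<in> insert e' (gen g {a'})" "y \<in> insert e' (gen g {a'})"
      then consider "x = e'" "y = e'" | "x = e'" "y \<in> gen g {a'}" | "x \<in> gen g {a'}" "y = e'"
        | "x \<in> gen g {a'}" "y \<in> gen g {a'}" by blast
      then show "x \<odot> y \<in> insert e' (gen g {a'})"
        by cases (use l[of y] r[of x] e'_idem gen_mult[of x g "{a'}" y] in auto)
    qed
    then have "al' \<in> insert e' (gen g {a'})" by (rule al'_in_closed) (auto intro: gen_base)
    moreover have "al' \<noteq> e'" using aperiodic_p not_aperiodic_e by auto
    ultimately show False using al_notin_gen_a[OF False] in_gen_iff[of al "{a}"] by simp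
  qed
  have e'_notin: "e' \<notin> gen g {al'}"
    using T.aperiodic_not_idem[OF aperiodic_al'] e'_idem by (auto simp: T.gen_single)
  have not_e'_left: False if "e' \<odot> a' = e'" "a' \<odot> e' \<in> gen g {al'}"
  proof -
    have "e' = e' \<odot> (a' \<odot> e')" using that(1) e'_idem by (simp flip: T.assoc)
    also have "\<dots> = a' \<odot> e'" using that(2) gen_al'_sub image_unit by blast
    finally show False using that(2) e'_notin by simp
  qed
  have not_e'_right: False if "a' \<odot> e' = e'" "e' \<odot> a' \<in> gen g {al'}"
  proof -
    have "e' = e' \<odot> a' \<odot> e'" using that(1) e'_idem by (simp add: T.assoc)
    also have "\<dots> = e' \<odot> a'" using that(2) gen_al'_sub image_unit by blast
    finally show False using that(2) e'_notin by simp
  qed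
  have not_core: False if "e' \<odot> a' \<in> gen g {al'}" "a' \<odot> e' \<in> gen g {al'}"
  proof -
    have l: "y \<odot> a' \<in> \<phi> ` B" "a' \<odot> y \<in> \<phi> ` B" if y: "y \<in> \<phi> ` B" for y
    proof -
      have "y \<odot> a' = y \<odot> (e' \<odot> a')" "a' \<odot> y = a' \<odot> e' \<odot> y"
        using image_unit[OF y] by (simp_all flip: T.assoc) (simp add: T.assoc)
      then show "y \<odot> a' \<in> \<phi> ` B" "a' \<odot> y \<in> \<phi> ` B"
        using closedD[OF closed_image_B] y gen_al'_sub
          \<open>e' \<odot> a' \<in> gen g {al'}\<close> \<open>a' \<odot> e' \<in> gen g {al'}\<close> by auto
    qed
    have m: "y \<odot> x \<in> \<phi> ` B \<and> x \<odot> y \<in> \<phi> ` B" if "x \<in> gen g {a'}" "y \<in> \<phi> ` B" for x y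
      using that
    proof (induction arbitrary: y rule: gen_induct)
      case (mult x z)
      then show ?case by (metis T.assoc)
    qed (use l in auto)
    have "closed g (gen g {a'} \<union> \<phi> ` B)"
    proof (rule closedI)
      fix x y assume "x \<in> gen g {a'} \<union> \<phi> ` B" "y \<in> gen g {a'} \<union> \<phi> ` B"
      then show "x \<odot> y \<in> gen g {a'} \<union> \<phi> ` B"
        using m[of x y] m[of y x] gen_mult[of x g "{a'}" y] closedD[OF closed_image_B, of x y] by blast
    qed
    then show False using not_closed_gen_a_B[OF False] by simp
  qed
  consider "e' \<odot> a' = a'" "a' \<odot> e' \<in> gen g {al'}" | "e' \<odot> a' \<in> gen g {al'}" "a' \<odot> e' = a'"
    using left right not_both not_e'_left not_e'_right not_core by blast
  then show ?thesis
  proof cases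
    case 1
    then show ?thesis
      using pair_bij.e'_a'_eq_al'[OF pair_bij_opp_right False] by simp
  next
    case 2
    then show ?thesis using e'_a'_eq_al'[OF False] by simp
  qed
qed

lemma b'_cases:
  "b' \<odot> e' = b' \<and> e' \<odot> b' = be' \<or> b' \<odot> e' = be' \<and> e' \<odot> b' = b'"
  using pair_bij.a'_cases[OF pair_bij_opp] by simp

text \<open>Here \<open>e'\<close> would be a left identity of \<open>T\<close>. For the idempotent
  h = ba, the product \<phi> h \<odot> \<open>e'\<close> is idempotent in the image of the group
  \<open>B\<close>, hence \<open>e'\<close>; so {e, h} is closed in \<open>S\<close>. But eh = e
  puts a into \<open>B\<close>, and eh = h puts b into \<open>B\<close>.\<close>

lemma not_left_unit:
  assumes grp: "be \<cdot> al = e" and nB: "a \<notin> B" "b \<notin> B"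
    and "e' \<odot> a' = a'" "a' \<odot> e' = al'" "e' \<odot> b' = b'" "b' \<odot> e' = be'"
  shows False
proof -
  have T: "y \<in> gen g {a', b'}" for y
  proof -
    obtain x where "y = \<phi> x" by (rule phi_surj)
    then show ?thesis using in_gen_iff[of x "{a, b}"] gen_ab by simp
  qed
  have l: "e' \<odot> y = y \<and> y \<odot> e' \<in> \<phi> ` B" for y
    using T[of y]
  proof (induction rule: gen_induct)
    case (mult x y)
    have "x \<odot> y \<odot> e' = (x \<odot> e') \<odot> (y \<odot> e')" using mult by (metis T.assoc)
    then show ?case using mult closedD[OF closed_image_B] by (metis T.assoc)
  qed (use assms p_in q_in in auto)
  define h where "h = b \<cdot> a"
  have "e \<cdot> h \<cdot> e = be \<cdot> al" by (simp add: h_def be al assoc flip: assoc[of e b])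
  then have hh: "h \<cdot> h = h" by (simp add: idem_iff grp)
  then have h': "\<phi> h \<odot> \<phi> h = \<phi> h" by (simp add: phi_idem_iff)
  obtain z where z: "z \<in> B" "\<phi> h \<odot> e' = \<phi> z" using l[of "\<phi> h"] by auto
  have "\<phi> z \<odot> \<phi> z = \<phi> h \<odot> (e' \<odot> \<phi> h) \<odot> e'" by (simp only: z(2)[symmetric] T.assoc)
  also have "\<dots> = \<phi> z" using l[of "\<phi> h"] h' z(2) by simp
  finally have "z \<cdot> z = z" by (simp add: phi_idem_iff)
  then have "z = e" using idem_el[OF z(1)] el_group[OF grp] by auto
  then have "closed g {e', \<phi> h}" using z(2) l[of "\<phi> h"] h' e'_idem by (auto simp: closed_def)
  then have "closed f {e, h}" using closed_iff[of "{e, h}"] by simp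
  then have "e \<cdot> h = e \<or> e \<cdot> h = h" by (auto simp: closed_def)
  then show False
  proof
    assume eh: "e \<cdot> h = e"
    have "h = h \<cdot> e \<cdot> h" by (simp add: sandwich hh)
    then have "h = h \<cdot> e" using eh by (simp add: assoc)
    then have "a \<cdot> h = a \<cdot> h \<cdot> e" by (metis assoc)
    moreover have "a \<cdot> h = a" unfolding h_def by (metis ab assoc ea)
    ultimately have "a = al" by (simp add: al)
    then show False using nB p_in by simp
  next
    assume "e \<cdot> h = h"
    then have "e \<cdot> h \<cdot> b = h \<cdot> b" by simp
    moreover have "h \<cdot> b = b" by (simp add: h_def assoc ab be_e)
    ultimately have "be = b" by (simp add: assoc be)
    then show False using nB q_in by simp
  qed
qed

end

section \<open>Multiplicativity on \<open>B\<close>\<close>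

locale oriented_pair = pair_bij +
  assumes al'_be'_e': "g (\<phi> al) (\<phi> be) = \<phi> e"
begin

sublocale R: bicyclic_pair g "\<phi> e" "\<phi> al" "\<phi> be"
  by standard
    (use image_B_unit[OF p_in] image_B_unit[OF q_in] al'_be'_e' aperiodic_al' in auto)

lemma oriented_pair_opp: "oriented_pair (opp f) b a e be al (opp g) \<phi>"
  by (intro oriented_pair.intro pair_bij_opp oriented_pair_axioms.intro) (simp add: al'_be'_e')

lemma image_B_R: "\<phi> ` B = R.B"
  by (simp add: image_B R.gen_pq)

lemma phi_P_R: "\<phi> (P n) = R.P n"
  by (cases "n = 0") (simp_all add: phi_P R.P_pw)

lemma phi_Q_R: "\<phi> (Q n) = R.Q n"
  by (cases "n = 0") (simp_all add: phi_Q R.Q_pw)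

text \<open>In \<open>B\<close> and in its image, q^k p^k lies in the subsemigroup generated by p^k
  and q^k, whose exponents are multiples of k. Going back and forth multiplies m by some i * j:
  either i * j = 1, or two diagonal elements coincide and there is only one idempotent.\<close>

lemma phi_E_diag: "\<phi> (E m m) = R.E m m"
proof (cases "m = 0")
  case True
  then show ?thesis by (simp add: el_0 R.el_0)
next
  case False
  then have m: "m \<ge> 1" by simp
  have bwd: "\<exists>i. R.E k k = \<phi> (E (k * i) (k * i))" for k
  proof -
    obtain x where x: "R.E k k = \<phi> x" by (rule phi_surj)
    have "R.E k k \<in> gen g {R.P k, R.Q k}" by (simp add: R.el_eq gen_mult gen_base)
    then have "x \<in> gen f {P k, Q k}"
      using in_gen_iff[of x "{P k, Q k}"] x by (simp add: phi_P_R phi_Q_R)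
    then obtain i j where ij: "x = E (k * i) (k * j)" using gen_P_Q_sub by blast
    have "x \<cdot> x = x" using R.el_idem[of k] x phi_idem_iff by simp
    moreover have "x \<in> B" using ij el_in by simp
    ultimately obtain l where "x = E l l" using idem_el by blast
    then have "dg x = 0" by simp
    then have "int (k * j) - int (k * i) = 0" unfolding ij deg_el .
    then have "k * i = k * j" by linarith
    then have "x = E (k * i) (k * i)" using ij by (simp only:)
    then show ?thesis using x by blast
  qed
  have fwd: "\<exists>i. \<phi> (E k k) = R.E (k * i) (k * i)" for k
  proof -
    have "E k k \<in> gen f {P k, Q k}" by (simp add: el_eq gen_mult gen_base)
    then have "\<phi> (E k k) \<in> gen g {R.P k, R.Q k}"
      using in_gen_iff[of "E k k" "{P k, Q k}"] by (simp add: phi_P_R phi_Q_R)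
    then obtain i j where ij: "\<phi> (E k k) = R.E (k * i) (k * j)" using R.gen_P_Q_sub by blast
    have "\<phi> (E k k) \<odot> \<phi> (E k k) = \<phi> (E k k)" using el_idem phi_idem_iff by simp
    moreover have "\<phi> (E k k) \<in> R.B" using ij R.el_in by simp
    ultimately obtain l where "\<phi> (E k k) = R.E l l" using R.idem_el by blast
    then have "R.dg (\<phi> (E k k)) = 0" by simp
    then have "int (k * j) - int (k * i) = 0" unfolding ij R.deg_el .
    then have "k * i = k * j" by linarith
    then have "\<phi> (E k k) = R.E (k * i) (k * i)" using ij by (simp only:)
    then show ?thesis by blast
  qed
  obtain i where i: "R.E m m = \<phi> (E (m * i) (m * i))" using bwd by blast
  obtain j where "\<phi> (E (m * i) (m * i)) = R.E (m * i * j) (m * i * j)" using fwd by blast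
  then have ij: "R.E m m = R.E (m * i * j) (m * i * j)" using i by simp
  show ?thesis
  proof (cases "i * j = 1")
    case True
    then show ?thesis using i by simp
  next
    case False
    then have "m * i * j \<noteq> m" using m by (simp add: mult.assoc)
    then have "be' \<odot> al' = e'" using ij R.el_collapse by (metis linorder_neqE_nat)
    then have "R.E k k = e'" for k by (rule R.el_group)
    then show ?thesis using fwd[of m] by auto
  qed
qed

text \<open>By \<open>gen_deg\<close>, \<phi> preserves the elements of nonnegative degree divisible
  by N, for each N \<ge> 1, and a natural number is determined by its divisors.\<close>

lemma deg_image_nonneg:
  assumes x: "x \<in> B"
  shows "dg x \<ge> 0 \<longleftrightarrow> R.dg (\<phi> x) \<ge> 0" "dg x \<ge> 0 \<Longrightarrow> R.dg (\<phi> x) = dg x"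
proof -
  have x': "\<phi> x \<in> R.B" using x image_B_R by auto
  have iff: "dg x \<ge> 0 \<and> int N dvd dg x \<longleftrightarrow> R.dg (\<phi> x) \<ge> 0 \<and> int N dvd R.dg (\<phi> x)"
    if "N \<ge> 1" for N
  proof -
    have "\<phi> ` insert (P N) (range (\<lambda>m. E m m)) = insert (R.P N) (range (\<lambda>m. R.E m m))"
      by (auto simp: phi_P_R phi_E_diag image_iff)
    then have "x \<in> gen f (insert (P N) (range (\<lambda>m. E m m))) \<longleftrightarrow>
        \<phi> x \<in> gen g (insert (R.P N) (range (\<lambda>m. R.E m m)))"
      using in_gen_iff by metis
    then show ?thesis unfolding gen_deg[OF that] R.gen_deg[OF that] using x x' by blast
  qed
  show nn: "dg x \<ge> 0 \<longleftrightarrow> R.dg (\<phi> x) \<ge> 0" using iff[of 1] by simp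
  assume ge: "dg x \<ge> 0"
  have "nat (dg x) = nat (R.dg (\<phi> x))"
  proof (rule nat_eqI_dvd)
    fix N :: nat assume "N \<ge> 1"
    then have "int N dvd int (nat (dg x)) \<longleftrightarrow> int N dvd int (nat (R.dg (\<phi> x)))"
      using iff[of N] ge nn by simp
    then show "N dvd nat (dg x) \<longleftrightarrow> N dvd nat (R.dg (\<phi> x))" by (simp only: int_dvd_int_iff)
  qed
  then show "R.dg (\<phi> x) = dg x" using ge nn by simp
qed

text \<open>The preimage x of the right-hand side has degree 1 and lies in the subsemigroup of
  \<open>E m m\<close> and \<open>al\<close>, so x = \<open>E i (Suc i)\<close> with i \<le> m. If i
  < m, the induction hypothesis and multiplication by \<open>be'\<close> identify the diagonal
  elements at i and m, so x is still the expected element.\<close>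

lemma phi_E_Suc: "\<phi> (E m (Suc m)) = R.E m (Suc m)"
proof (induction m rule: less_induct)
  case (less m)
  have Suc: "E i (Suc i) = E i i \<cdot> al" "R.E i (Suc i) = R.E i i \<odot> al'" for i
    by (simp_all add: el_eq R.el_eq P_Suc2 R.P_Suc2 assoc T.assoc)
  obtain x where x: "R.E m (Suc m) = \<phi> x" by (rule phi_surj)
  have "R.E m (Suc m) \<in> gen g {R.E m m, al'}" unfolding Suc by (intro gen_mult gen_base) auto
  then have "x \<in> gen f {E m m, al}"
    using in_gen_iff[of x "{E m m, al}"] x by (simp add: phi_E_diag)
  then obtain i j where ij: "x = E i j" "i \<le> m" "i \<le> j" using gen_E_p_sub by blast
  then have "R.dg (\<phi> x) = dg x" using deg_image_nonneg(2)[OF el_in, of i j] by simp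
  then have j: "j = Suc i" using x[symmetric] ij by simp
  show ?case
  proof (cases "i = m")
    case True
    then show ?thesis using x ij j by simp
  next
    case False
    then have "R.E i (Suc i) = R.E m (Suc m)" using less ij x j by simp
    then have "R.E i (Suc i) \<odot> be' = R.E m (Suc m) \<odot> be'" by simp
    moreover have "R.E k (Suc k) \<odot> be' = R.E k k" for k
      using R.el_mult[of k "Suc k" 1 0] by (simp add: R.el_0 R.Q_1)
    ultimately have "\<phi> (E i i) = \<phi> (E m m)" by (simp add: phi_E_diag)
    then have "E i i = E m m" unfolding phi_eq_iff .
    then have "E i (Suc i) = E m (Suc m)" by (simp add: Suc(1))
    then show ?thesis using x ij j by simp
  qed
qed

text \<open>Off the diagonal, \<open>E m (m + k)\<close> is the k-th power of
  \<open>E m (Suc m)\<close>, and \<phi> preserves powers.\<close>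

lemma phi_E_le: "m \<le> n \<Longrightarrow> \<phi> (E m n) = R.E m n"
proof (cases "m = n")
  case False
  assume "m \<le> n"
  with False obtain k where k: "n = m + k" "k \<ge> 1" by (metis le_Suc_ex add_0_right less_one not_le)
  then show ?thesis
    using phi_pw[of k "E m (Suc m)"] by (simp add: pw_el R.pw_el phi_E_Suc)
qed (simp add: phi_E_diag)

lemma phi_E: "\<phi> (E m n) = R.E m n"
proof (cases "m \<le> n")
  case False
  then show ?thesis
    using oriented_pair.phi_E_le[OF oriented_pair_opp, of n m] by (simp add: el_opp R.el_opp)
qed (rule phi_E_le)

lemma phi_mult_B: "x \<in> B \<Longrightarrow> y \<in> B \<Longrightarrow> \<phi> (x \<cdot> y) = \<phi> x \<odot> \<phi> y"
  by (elim elsE) (simp add: el_mult R.el_mult phi_E)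

text \<open>In the opposite case \<open>a'\<close> \<odot> \<open>be'\<close> is shown to be
  \<open>e'\<close>: its preimage h is in \<open>B\<close> or of the form pa, and the second option
  leads to p \<open>al\<close> = e with p of degree -1, hence to the group case. Then
  \<open>a'\<close> strips factors \<open>be'\<close>, so the set of
  \<open>not_closed_gen_a_B\<close> becomes closed.\<close>

lemma e'_a'_bicyclic:
  assumes nongrp: "be \<cdot> al \<noteq> e"
  shows "e' \<odot> a' = a' \<and> a' \<odot> e' = al'"
proof (rule ccontr)
  assume neg: "\<not> ?thesis"
  then have e'a': "e' \<odot> a' = al'" and a'e': "a' \<odot> e' = a'" using a'_cases by auto
  have a: "a \<notin> B"
  proof
    assume "a \<in> B"
    then show False using neg image_B_unit[of a] idem_a_B by metis
  qed
  obtain h where h: "a' \<odot> be' = \<phi> h" by (rule phi_surj)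
  have "\<phi> h \<in> gen g (\<phi> ` insert a B)" unfolding h[symmetric] by (intro gen_mult gen_base) (auto simp: q_in)
  then have "h \<in> gen f (insert a B)" by (simp only: in_gen_iff)
  then have h_cases: "h \<in> B \<or> (\<exists>p\<in>B. h = p \<cdot> a)" using gen_insert_a_B by blast
  have eh: "e' \<odot> \<phi> h = e'" using e'a' al'_be'_e' by (simp flip: h T.assoc)
  have he: "\<phi> h \<odot> e' = \<phi> h" using image_B_unit[OF q_in] by (simp flip: h add: T.assoc)
  have "\<phi> h \<odot> \<phi> h = \<phi> h" using eh he by (metis T.assoc)
  then have "closed g {e', \<phi> h}" using eh he e'_idem by (auto simp: closed_def)
  then have "closed f {e, h}" using closed_iff[of "{e, h}"] by simp
  then have hec: "h \<cdot> e = e \<or> h \<cdot> e = h" by (auto simp: closed_def)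
  have "h = e"
  proof (cases "h \<in> B")
    case True
    then show ?thesis using eh image_B_unit[of h] by simp
  next
    case False
    then obtain p where p: "p \<in> B" "h = p \<cdot> a" using h_cases by blast
    have pal: "h \<cdot> e = p \<cdot> al" by (simp add: p assoc al)
    then have "h \<cdot> e \<in> B" using els_mult p p_in by simp
    then have pe: "p \<cdot> al = e" using hec pal False by auto
    obtain m n where mn: "p = E m n" using p(1) by (rule elsE)
    have "dg (p \<cdot> al) = 0" by (simp add: pe)
    then have "m = Suc n" using p_in by (simp add: mn deg_mult el_in)
    then have "E (Suc n) (Suc n) = E 0 0"
      using pe mn el_mult[of m n 0 1] by (simp add: el_0 P_1)
    then have "be \<cdot> al = e" using el_collapse[of 0 "Suc n"] by simp
    then show ?thesis using nongrp by simp
  qed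
  then have a'be': "a' \<odot> be' = e'" using h by simp
  define C where "C = gen g {a'} \<union> \<phi> ` B"
  have a'C: "a' \<odot> y \<in> C" if "y \<in> C" for y
  proof (cases "y \<in> gen g {a'}")
    case True
    then have "a' \<odot> y \<in> gen g {a'}" by (intro gen_mult[OF gen_base]) simp_all
    then show ?thesis by (simp add: C_def)
  next
    case False
    then obtain q where q: "q \<in> B" "y = \<phi> q" using \<open>y \<in> C\<close> by (auto simp: C_def)
    obtain m n where mn: "q = E m n" using q(1) by (rule elsE)
    show ?thesis
    proof (cases m)
      case 0
      show ?thesis
      proof (cases "n = 0")
        case True
        then show ?thesis using q mn 0 a'e' by (simp add: C_def el_0 gen_base)
      next
        case False
        then have "y = pw g al' n" using q mn 0 by (simp add: el_0 phi_P)
        then have "a' \<odot> y = a' \<odot> (e' \<odot> pw g a' n)"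
          using T.unit_mult_pw[OF _ a'e', of n] e'a' False by simp
        also have "\<dots> = a' \<odot> pw g a' n" using a'e' by (simp flip: T.assoc)
        finally have "a' \<odot> y = a' \<odot> pw g a' n" .
        moreover have "a' \<odot> pw g a' n \<in> gen g {a'}"
          by (intro gen_mult T.pw_gen gen_base) (use False in auto)
        ultimately show ?thesis by (simp add: C_def)
      qed
    next
      case (Suc k)
      have "q = be \<cdot> E k n" using mn Suc by (simp add: el_eq mpow_Suc assoc)
      then have "y = be' \<odot> \<phi> (E k n)" using q phi_mult_B q_in el_in by simp
      then have "a' \<odot> y = \<phi> (E k n)" using a'be' image_B_unit[OF el_in] by (simp flip: T.assoc)
      then show ?thesis using el_in by (auto simp: C_def)
    qed
  qed
  have xC: "x \<odot> y \<in> C" if "x \<in> gen g {a'}" "y \<in> C" for x y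
    using that
  proof (induction arbitrary: y rule: gen_induct)
    case (mult x z)
    then show ?case by (simp add: T.assoc)
  qed (use a'C in auto)
  have Bx: "y \<odot> x \<in> \<phi> ` B" if "x \<in> gen g {a'}" "y \<in> \<phi> ` B" for x y
    using that
  proof (induction arbitrary: y rule: gen_induct)
    case (base x)
    then have "y \<odot> x = y \<odot> al'" using image_unit(2)[of y] e'a' by (metis T.assoc singletonD)
    then show ?case using base closedD[OF closed_image_B] p_in by auto
  next
    case (mult x z)
    then show ?case by (simp flip: T.assoc)
  qed
  have "closed g C"
  proof (rule closedI)
    fix x y assume "x \<in> C" "y \<in> C"
    then show "x \<odot> y \<in> C"
      using xC[of x y] Bx[of y x] closedD[OF closed_image_B, of x y] unfolding C_def by blast
  qed
  then show False using not_closed_gen_a_B[OF a] by (simp add: C_def)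
qed

end

section \<open>Extension to the whole semigroup\<close>

context orthodox_pair
begin

text \<open>The retraction x \<mapsto> exe keeps \<open>B\<close> fixed and maps the left-hand
  subsemigroup into the right-hand set. This describes exe by subsemigroups alone, up to the choice
  of a generator.\<close>

lemma gen_e_Int_B: "gen f {e, x} \<inter> B = insert e (gen f {e \<cdot> x \<cdot> e})"
proof (intro equalityI subsetI)
  have sub: "gen f {e \<cdot> x \<cdot> e} \<subseteq> B" using core_in els_closed by (simp add: gen_single_subset_iff)
  fix y assume y: "y \<in> gen f {e, x} \<inter> B"
  then have "y \<in> gen f {e, x}" by simp
  then have "e \<cdot> y \<cdot> e \<in> insert e (gen f {e \<cdot> x \<cdot> e})"
  proof (induction rule: gen_induct)
    case (base y)
    then show ?case by (auto simp: idem_e gen_base)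
  next
    case (mult y z)
    then show ?case unfolding core_mult
      using sub unit[of "e \<cdot> y \<cdot> e"] unit[of "e \<cdot> z \<cdot> e"] e_in
        gen_mult[of "e \<cdot> y \<cdot> e" f "{e \<cdot> x \<cdot> e}" "e \<cdot> z \<cdot> e"] core_in by auto
  qed
  then show "y \<in> insert e (gen f {e \<cdot> x \<cdot> e})" using y unit[of y] by simp
next
  have e: "e \<in> gen f {e, x}" by (simp add: gen_base)
  have "e \<cdot> x \<cdot> e \<in> gen f {e, x}" by (intro gen_mult gen_base) auto
  then have "gen f {e \<cdot> x \<cdot> e} \<subseteq> gen f {e, x}" by (simp only: gen_single_subset_iff[OF closed_gen])
  moreover have "gen f {e \<cdot> x \<cdot> e} \<subseteq> B" using core_in by (simp only: gen_single_subset_iff[OF els_closed])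
  moreover fix y assume "y \<in> insert e (gen f {e \<cdot> x \<cdot> e})"
  ultimately show "y \<in> gen f {e, x} \<inter> B" using e e_in by auto
qed

end

locale good_pair = oriented_pair +
  assumes e'a': "g (\<phi> e) (\<phi> a) = \<phi> a" and a'e': "g (\<phi> a) (\<phi> e) = \<phi> al"
    and b'e': "g (\<phi> b) (\<phi> e) = \<phi> b" and e'b': "g (\<phi> e) (\<phi> b) = \<phi> be"
begin

lemma good_pair_opp: "good_pair (opp f) b a e be al (opp g) \<phi>"
  by (intro good_pair.intro oriented_pair_opp good_pair_axioms.intro)
    (simp_all add: e'a' a'e' b'e' e'b')

text \<open>If z = a'b' is idempotent, then b'a' satisfies (b'a')^2 = (b'a')^3, so it is idempotent, and
  compressing by e' gives z = e'.  Otherwise z has nonzero degree, but a'^N b'^N has the same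
  degree for all N, and this degree must be divisible by N.\<close>

lemma a'b': "a' \<odot> b' = e'"
proof -
  obtain z where z: "a' \<odot> b' = \<phi> z" by (rule phi_surj)
  have ez: "e' \<odot> \<phi> z = \<phi> z" "\<phi> z \<odot> e' = \<phi> z"
    using e'a' b'e' z by (metis T.assoc)+
  show ?thesis
  proof (cases "z \<cdot> z = z")
    case True
    then have zz: "\<phi> z \<odot> \<phi> z = \<phi> z" by (simp add: phi_idem_iff)
    define w where "w = b' \<odot> a'"
    have ww: "w \<odot> w = b' \<odot> \<phi> z \<odot> a'" by (simp add: w_def T.assoc flip: z)
    have "w \<odot> (w \<odot> w) = b' \<odot> (\<phi> z \<odot> \<phi> z) \<odot> a'"
      unfolding ww by (simp add: w_def T.assoc flip: z)
    then have www: "w \<odot> (w \<odot> w) = w \<odot> w" by (simp add: zz ww)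
    have "w \<odot> w = w"
    proof (rule ccontr)
      assume "w \<odot> w \<noteq> w"
      then have "aperiodic g w" using T_idem_or_aperiodic by blast
      moreover have "pw g w 2 = w \<odot> w" "pw g w 3 = w \<odot> (w \<odot> w)"
        using pw_Suc[of 1 g w] pw_Suc[of 2 g w] by (simp_all add: numeral_2_eq_2 numeral_3_eq_3)
      ultimately show False using www aperiodicD[of g w 2 3] by simp
    qed
    \<comment> \<open>Compression by \<open>e'\<close> turns \<open>b'\<close> into
      \<open>be'\<close> and \<open>a'\<close> into \<open>al'\<close>, and the outer factors cancel
      these: the left side becomes \<open>e'\<close>, the right side \<phi> z.\<close>
    then have "al' \<odot> (e' \<odot> w \<odot> e') \<odot> be' = al' \<odot> (e' \<odot> (b' \<odot> \<phi> z \<odot> a') \<odot> e') \<odot> be'" using ww by simp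
    moreover have "al' \<odot> (e' \<odot> w \<odot> e') \<odot> be' = (al' \<odot> (e' \<odot> b')) \<odot> ((a' \<odot> e') \<odot> be')"
      by (simp only: w_def T.assoc)
    moreover have "al' \<odot> (e' \<odot> (b' \<odot> \<phi> z \<odot> a') \<odot> e') \<odot> be' =
        (al' \<odot> (e' \<odot> b')) \<odot> \<phi> z \<odot> ((a' \<odot> e') \<odot> be')"
      by (simp only: T.assoc)
    ultimately have "e' \<odot> e' = e' \<odot> \<phi> z \<odot> e'" by (simp only: e'b' a'e' al'_be'_e')
    then show ?thesis using ez z by (simp add: e'_idem)
  next
    case False
    then have ap: "aperiodic f z" using idem_or_aperiodic_all by blast
    have u: "e' \<odot> x = x \<and> x \<odot> e' = x" if "x \<in> gen g {\<phi> z}" for x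
      using that
    proof (induction rule: gen_induct)
      case (mult x y)
      then show ?case by (metis T.assoc)
    qed (use ez in auto)
    have "closed g (insert e' (gen g {\<phi> z}))"
      by (rule closedI) (use u e'_idem in \<open>auto intro: gen_mult\<close>)
    then have "closed f (insert e (gen f {z}))" unfolding closed_iff by (simp add: image_gen)
    then have "e \<cdot> z = z \<and> z \<cdot> e = z \<or> e \<cdot> z = e \<and> z \<cdot> e = e"
      by (rule unit_or_zero[OF idem_e ap])
    moreover have "\<not> (e \<cdot> z = e \<and> z \<cdot> e = e)"
    proof
      assume "e \<cdot> z = e \<and> z \<cdot> e = e"
      then have "dg (e \<cdot> z \<cdot> e) = 0" by (simp add: idem_e)
      then show False using False by (simp add: idem_iff)
    qed
    ultimately have zB: "z \<in> B" by (simp add: in_B_iff)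
    then have dz: "dg z \<noteq> 0" using deg_0_el el_idem False by metis
    \<comment> \<open>The exponent N = k + 1 exceeds the absolute value of \<open>dg z\<close>, so
      it cannot divide this nonzero number.\<close>
    define k where "k = nat \<bar>dg z\<bar>"
    have k: "k \<ge> 1" using dz by (simp add: k_def)
    define x where "x = P k \<cdot> z \<cdot> Q k"
    have xB: "x \<in> B" and dx: "dg x = dg z"
      using zB P_in Q_in els_mult by (simp_all add: x_def deg_mult)
    have ae: "pw g a' k \<odot> e' = pw g al' k"
      using semigroup.unit_mult_pw[OF T.opp_semigroup k, of a' e'] k e'a' a'e' by (simp add: T.pw_opp)
    have eb: "e' \<odot> pw g b' k = pw g be' k"
      using T.unit_mult_pw[OF k, of b' e'] b'e' e'b' by simp
    have "pw g a' (Suc k) \<odot> pw g b' (Suc k) = pw g a' k \<odot> (a' \<odot> b') \<odot> pw g b' k"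
      using k by (simp add: T.pw_Suc2[of k a'] pw_Suc[of k g b'] T.assoc)
    also have "\<dots> = pw g a' k \<odot> (e' \<odot> \<phi> z \<odot> e') \<odot> pw g b' k" by (simp add: z ez)
    also have "\<dots> = (pw g a' k \<odot> e') \<odot> \<phi> z \<odot> (e' \<odot> pw g b' k)" by (simp only: T.assoc)
    also have "\<dots> = \<phi> x"
      using zB P_in Q_in els_mult k by (simp add: ae eb x_def phi_mult_B phi_P phi_Q)
    finally have "\<phi> x = \<phi> (pw f a (Suc k)) \<odot> \<phi> (pw f b (Suc k))" by (simp add: phi_pw)
    then have "\<phi> x \<in> gen g (\<phi> ` {pw f a (Suc k), pw f b (Suc k)})"
      by (simp only:) (intro gen_mult gen_base; simp)
    then have "x \<in> gen f {pw f a (Suc k), pw f b (Suc k)}" by (simp only: in_gen_iff)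
    then have "int (Suc k) dvd dg (e \<cdot> x \<cdot> e)"
    proof (induction rule: gen_induct)
      case (base x)
      then show ?case
      proof
        assume "x = pw f a (Suc k)"
        then have "e \<cdot> x \<cdot> e = pw f al (Suc k)" using core_pw[of "Suc k" a] by (simp add: ea al)
        then have "dg (e \<cdot> x \<cdot> e) = int (Suc k) * dg al" using deg_pw[OF _ p_in, of "Suc k"] by simp
        then show ?thesis by (metis dvd_triv_left)
      next
        assume "x \<in> {pw f b (Suc k)}"
        then have "e \<cdot> x \<cdot> e = pw f be (Suc k)" using core_pw[of "Suc k" b] by (simp add: be_e be qe)
        then have "dg (e \<cdot> x \<cdot> e) = int (Suc k) * dg be" using deg_pw[OF _ q_in, of "Suc k"] by simp
        then show ?thesis by (metis dvd_triv_left)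
      qed
    next
      case (mult x y)
      then show ?case by (simp add: core_mult deg_mult core_in)
    qed
    then have "int (Suc k) dvd dg z" using xB dx unit[of x] by simp
    then have "int (Suc k) \<le> \<bar>dg z\<bar>" using dvd_imp_le_int[OF dz, of "int (Suc k)"] by simp
    then show ?thesis by (simp add: k_def)
  qed
qed

lemma orthodox_pair_image: "orthodox_pair g a' b' e' al' be'"
proof
  have "\<phi> ` gen f {a, b} = gen g {a', b'}" by (simp add: image_gen)
  then show "gen g {a', b'} = UNIV" using bij by (simp add: gen_ab bij_def)
qed (simp_all add: a'b' e'a' a'e' b'e' e'b' al'_be'_e' phi_aperiodic_iff aperiodic_a)

sublocale O: orthodox_pair g "\<phi> a" "\<phi> b" "\<phi> e" "\<phi> al" "\<phi> be"
  by (rule orthodox_pair_image)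

text \<open>\<open>gen_e_Int_B\<close> holds in \<open>T\<close> as well, because \<open>T\<close>
  is now an \<open>orthodox_pair\<close>. So both sides generate the same subsemigroup up to
  \<open>e'\<close>, and generators are unique.\<close>

lemma phi_core: "\<phi> (e \<cdot> t \<cdot> e) = e' \<odot> \<phi> t \<odot> e'"
proof -
  define x where "x = \<phi> (e \<cdot> t \<cdot> e)"
  define y where "y = e' \<odot> \<phi> t \<odot> e'"
  have "insert e' (gen g {x}) = \<phi> ` (gen f {e, t} \<inter> B)"
    unfolding gen_e_Int_B x_def by (simp add: image_gen)
  also have "\<dots> = gen g {e', \<phi> t} \<inter> R.B"
    using bij by (simp add: image_Int bij_is_inj image_gen image_B_R)
  also have "\<dots> = insert e' (gen g {y})" unfolding y_def by (rule O.gen_e_Int_B)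
  finally have xy: "insert e' (gen g {x}) = insert e' (gen g {y})" .
  have e: "gen g {e'} = {e'}" by (rule T.gen_idem) (rule e'_idem)
  have "x \<in> insert e' (gen g {y})" "y \<in> insert e' (gen g {x})"
    using xy gen_base[of x "{x}" g] gen_base[of y "{y}" g] by auto
  then consider "x = e'" | "y = e'" | "x \<in> gen g {y}" "y \<in> gen g {x}" by blast
  then have "x = y"
  proof cases
    case 1
    then show ?thesis using \<open>y \<in> insert e' (gen g {x})\<close> e by auto
  next
    case 2
    then show ?thesis using \<open>x \<in> insert e' (gen g {y})\<close> e by auto
  next
    case 3
    then have "gen g {x} \<subseteq> gen g {y}" "gen g {y} \<subseteq> gen g {x}"
      by (simp_all only: gen_single_subset_iff[OF closed_gen])
    then have "gen g {x} = gen g {y}" by simp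
    then show ?thesis using T.gen_single_inj T_idem_or_aperiodic by blast
  qed
  then show ?thesis by (simp add: x_def y_def)
qed

text \<open>The preimage t of the product lies in \<open>B\<close> or has the form qa. In the second
  case comparing cores and cancelling \<open>al\<close> by \<open>be\<close> gives q = p. In the
  first case a' and al' agree after \<phi> p; this is an equality of powers of a' and al', which
  \<phi> carries back to \<open>S\<close>, so that pa = p \<open>al\<close> there too.\<close>

lemma phi_mult_a:
  assumes p: "p \<in> B"
  shows "\<phi> (p \<cdot> a) = \<phi> p \<odot> a'"
proof -
  obtain t where t: "\<phi> p \<odot> a' = \<phi> t" by (rule phi_surj)
  have "\<phi> t \<in> gen g (\<phi> ` insert a B)" unfolding t[symmetric] by (intro gen_mult gen_base) (use p in auto)
  then have "t \<in> gen f (insert a B)" by (simp only: in_gen_iff)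
  then obtain q where q: "q \<in> B" "t = q \<or> t = q \<cdot> a" using gen_insert_a_B by blast
  have te: "\<phi> t \<odot> e' = \<phi> (p \<cdot> al)" using p p_in by (simp add: phi_mult_B a'e' T.assoc flip: t)
  show ?thesis
  proof (cases "t = q \<cdot> a")
    case True
    have "e \<cdot> t \<cdot> e = q \<cdot> al" using unit(1)[OF q(1)] by (simp add: True al assoc flip: assoc[of e q])
    moreover have "\<phi> (e \<cdot> t \<cdot> e) = \<phi> (p \<cdot> al)"
      using te image_B_unit[of "p \<cdot> al"] els_mult[OF p p_in] by (simp add: phi_core T.assoc)
    ultimately have "q \<cdot> al \<cdot> be = p \<cdot> al \<cdot> be" by simp
    then have "q = p" using unit(2) p q(1) by (simp add: assoc al_be)
    then show ?thesis using t True by simp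
  next
    case False
    then have "t = p \<cdot> al" using te image_B_unit[of t] q by simp
    then have *: "\<phi> p \<odot> a' = \<phi> p \<odot> al'" using t phi_mult_B[OF p p_in] by simp
    obtain m n where mn: "p = E m n" using p by (rule elsE)
    have "P m \<cdot> p = P n" using el_mult[of 0 m m n] by (simp add: mn el_0)
    then have "R.P m \<odot> \<phi> p = R.P n" using phi_mult_B[OF P_in p, of m] by (metis phi_P_R)
    then have "R.P n \<odot> a' = R.P n \<odot> al'" using * by (metis T.assoc)
    then have "pw g a' (Suc n) = R.P (Suc n)" by (simp add: O.P_a R.P_Suc2)
    then have "\<phi> (pw f a (Suc n)) = \<phi> (P (Suc n))" by (simp add: phi_pw phi_P_R)
    then have "pw f a (Suc n) = P (Suc n)" unfolding phi_eq_iff .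
    then have "p \<cdot> a = p \<cdot> al" by (simp add: mn el_eq assoc P_a P_Suc2)
    then show ?thesis using * phi_mult_B[OF p p_in] by simp
  qed
qed

lemma phi_b_mult:
  assumes "p \<in> B"
  shows "\<phi> (b \<cdot> p) = b' \<odot> \<phi> p"
  using good_pair.phi_mult_a[OF good_pair_opp, of p] assms by (simp add: els_opp)

text \<open>Only a degenerate situation has t fixed by e: then \<open>b'\<close> may be replaced by
  \<open>be'\<close>, and cancelling \<open>a'\<close> by \<open>b'\<close> on the right yields
  \<open>be\<close> p = bp in \<open>S\<close>.\<close>

lemma phi_b_mult_a_left:
  assumes p: "p \<in> B" and t: "\<phi> t = b' \<odot> \<phi> p \<odot> a'" and et: "e \<cdot> t = t"
  shows "t = b \<cdot> p \<cdot> a"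
proof -
  obtain q where q: "q \<in> B" "t = q \<or> t = q \<cdot> a" using left_fixed[OF et] by blast
  then have "e' \<odot> \<phi> t = \<phi> t"
    using image_B_unit[OF q(1)] phi_mult_a[OF q(1)] by (auto simp flip: T.assoc)
  then have *: "be' \<odot> \<phi> p \<odot> a' = b' \<odot> \<phi> p \<odot> a'" using t e'b' by (simp flip: T.assoc)
  have "be' \<odot> \<phi> p \<odot> (a' \<odot> b') = b' \<odot> \<phi> p \<odot> (a' \<odot> b')" using * by (metis T.assoc)
  then have "be' \<odot> \<phi> p = b' \<odot> \<phi> p" using image_B_unit[OF p] by (simp add: a'b' T.assoc)
  then have "\<phi> (be \<cdot> p) = \<phi> (b \<cdot> p)" using phi_mult_B[OF q_in p] phi_b_mult[OF p] by simp
  then have bp: "be \<cdot> p = b \<cdot> p" unfolding phi_eq_iff .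
  have "\<phi> t = \<phi> (be \<cdot> p \<cdot> a)"
    using t * phi_mult_a[of "be \<cdot> p"] phi_mult_B[OF q_in p] els_mult[OF q_in p] by simp
  then show ?thesis using bp by simp
qed

lemma phi_b_mult_a:
  assumes p: "p \<in> B"
  shows "\<phi> (b \<cdot> p \<cdot> a) = b' \<odot> \<phi> p \<odot> a'"
proof -
  obtain t where t: "b' \<odot> \<phi> p \<odot> a' = \<phi> t" by (rule phi_surj)
  obtain u v q where *: "u \<in> {e, b}" "v \<in> {e, a}" "q \<in> B" "t = u \<cdot> q \<cdot> v" by (rule decomp)
  consider "u = e" | "v = e" | "u = b" "v = a" using * by blast
  then have "t = b \<cdot> p \<cdot> a"
  proof cases
    case 1
    then have "e \<cdot> t = t" by (simp add: * idem_e flip: assoc)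
    then show ?thesis by (rule phi_b_mult_a_left[OF p t[symmetric]])
  next
    case 2
    then have "t \<cdot> e = t" by (simp add: * idem_e assoc)
    then show ?thesis
      using good_pair.phi_b_mult_a_left[OF good_pair_opp, of p t] p t
      by (simp add: els_opp assoc T.assoc)
  next
    case 3
    have "e \<cdot> t \<cdot> e = (e \<cdot> b) \<cdot> q \<cdot> (a \<cdot> e)" by (simp add: * 3 assoc)
    then have "\<phi> (be \<cdot> q \<cdot> al) = e' \<odot> \<phi> t \<odot> e'" using phi_core[of t] by (simp add: be al)
    also have "\<dots> = (e' \<odot> b') \<odot> \<phi> p \<odot> (a' \<odot> e')" by (simp add: T.assoc flip: t)
    also have "\<dots> = \<phi> (be \<cdot> p \<cdot> al)"
      using p p_in q_in els_mult by (simp add: e'b' a'e' phi_mult_B)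
    finally have "be \<cdot> q \<cdot> al = be \<cdot> p \<cdot> al" unfolding phi_eq_iff .
    then have "al \<cdot> be \<cdot> q \<cdot> (al \<cdot> be) = al \<cdot> be \<cdot> p \<cdot> (al \<cdot> be)" by (metis assoc)
    then have "q = p" using unit p *(3) by (simp add: al_be)
    then show ?thesis using * 3 by simp
  qed
  then show ?thesis using t by simp
qed

lemma phi_decomp:
  assumes "u \<in> {e, b}" "v \<in> {e, a}" "p \<in> B"
  shows "\<phi> (u \<cdot> p \<cdot> v) = \<phi> u \<odot> \<phi> p \<odot> \<phi> v"
proof -
  note p = assms(3)
  have "e \<cdot> p \<cdot> e = p" "e \<cdot> p \<cdot> a = p \<cdot> a" "b \<cdot> p \<cdot> e = b \<cdot> p"
    using unit[OF p] by (simp_all add: assoc)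
  moreover have "e' \<odot> \<phi> p \<odot> e' = \<phi> p" "e' \<odot> \<phi> p = \<phi> p" "b' \<odot> \<phi> p \<odot> e' = b' \<odot> \<phi> p"
    using image_B_unit[OF p] by (simp_all add: T.assoc)
  ultimately show ?thesis
    using assms(1,2) phi_b_mult[OF p] phi_mult_a[OF p] phi_b_mult_a[OF p] by auto
qed

theorem phi_mult: "\<phi> (x \<cdot> y) = \<phi> x \<odot> \<phi> y"
proof -
  obtain u v p where x: "u \<in> {e, b}" "v \<in> {e, a}" "p \<in> B" "x = u \<cdot> p \<cdot> v" by (rule decomp)
  obtain u' v' q where y: "u' \<in> {e, b}" "v' \<in> {e, a}" "q \<in> B" "y = u' \<cdot> q \<cdot> v'" by (rule decomp)
  have vu: "v \<cdot> u' \<in> B" "\<phi> (v \<cdot> u') = \<phi> v \<odot> \<phi> u'"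
    using x(2) y(1) by (auto simp: ab al be idem_e e_in p_in q_in a'b' a'e' e'b' e'_idem)
  have "x \<cdot> y = u \<cdot> (p \<cdot> (v \<cdot> u') \<cdot> q) \<cdot> v'" by (simp add: x y assoc)
  then have "\<phi> (x \<cdot> y) = \<phi> u \<odot> \<phi> (p \<cdot> (v \<cdot> u') \<cdot> q) \<odot> \<phi> v'"
    using phi_decomp x y vu els_mult by metis
  also have "\<dots> = \<phi> u \<odot> (\<phi> p \<odot> (\<phi> v \<odot> \<phi> u') \<odot> \<phi> q) \<odot> \<phi> v'"
    using x y vu els_mult by (simp add: phi_mult_B)
  also have "\<dots> = (\<phi> u \<odot> \<phi> p \<odot> \<phi> v) \<odot> (\<phi> u' \<odot> \<phi> q \<odot> \<phi> v')" by (simp only: T.assoc)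
  finally show ?thesis using phi_decomp x y by simp
qed

end

section \<open>Choice of the orientation of \<open>T\<close>\<close>

context pair_bij
begin

lemma good_pairI:
  assumes "al' \<odot> be' = e'" "e' \<odot> a' = a'" "a' \<odot> e' = al'" "b' \<odot> e' = b'" "e' \<odot> b' = be'"
  shows "good_pair f a b e al be g \<phi>"
  using assms by (intro good_pair.intro oriented_pair.intro pair_bij_axioms
      oriented_pair_axioms.intro good_pair_axioms.intro)

lemma good_pair_bicyclic:
  assumes "al' \<odot> be' = e'" and nongrp: "be \<cdot> al \<noteq> e"
  shows "good_pair f a b e al be g \<phi>"
proof -
  interpret O: oriented_pair f a b e al be g \<phi>
    by (intro oriented_pair.intro pair_bij_axioms oriented_pair_axioms.intro assms)
  have "e' \<odot> a' = a' \<and> a' \<odot> e' = al'" by (rule O.e'_a'_bicyclic[OF nongrp])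
  moreover have "b' \<odot> e' = b' \<and> e' \<odot> b' = be'"
    using oriented_pair.e'_a'_bicyclic[OF O.oriented_pair_opp] nongrp by simp
  ultimately show ?thesis using assms by (intro good_pairI) auto
qed

text \<open>One of the two products is \<open>e'\<close> by \<open>al'_be'\<close>. The other is
  then idempotent, and the image of a group \<open>B\<close> has a single idempotent.\<close>

lemma al'_be'_group:
  assumes grp: "be \<cdot> al = e"
  shows "al' \<odot> be' = e'" "be' \<odot> al' = e'"
proof -
  have idem: "y = e'" if y: "y \<in> \<phi> ` B" "y \<odot> y = y" for y
  proof -
    obtain z where z: "z \<in> B" "y = \<phi> z" using y(1) by auto
    then have "z \<cdot> z = z" using y by (simp add: phi_idem_iff)
    then show ?thesis using z idem_el[OF z(1)] el_group[OF grp] by auto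
  qed
  have in': "al' \<odot> be' \<in> \<phi> ` B" "be' \<odot> al' \<in> \<phi> ` B"
    using closedD[OF closed_image_B] p_in q_in by auto
  have 1: "be' \<odot> al' = e'" if "al' \<odot> be' = e'"
  proof (rule idem[OF in'(2)])
    have "be' \<odot> al' \<odot> (be' \<odot> al') = be' \<odot> (al' \<odot> be') \<odot> al'" by (simp only: T.assoc)
    then show "be' \<odot> al' \<odot> (be' \<odot> al') = be' \<odot> al'" using that image_B_unit[OF q_in] by simp
  qed
  have 2: "al' \<odot> be' = e'" if "be' \<odot> al' = e'"
  proof (rule idem[OF in'(1)])
    have "al' \<odot> be' \<odot> (al' \<odot> be') = al' \<odot> (be' \<odot> al') \<odot> be'" by (simp only: T.assoc)
    then show "al' \<odot> be' \<odot> (al' \<odot> be') = al' \<odot> be'" using that image_B_unit[OF p_in] by simp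
  qed
  show "al' \<odot> be' = e'" "be' \<odot> al' = e'" using 1 2 al'_be' by blast+
qed

text \<open>In the group case each of \<open>a'\<close> and \<open>b'\<close> selects a side of
  \<open>T\<close>. Different choices are excluded by \<open>not_left_unit\<close>, unless a or b
  lies in \<open>B\<close>; such a generator is compatible with both sides, so the other one
  decides.\<close>

lemma good_orientation:
  "good_pair f a b e al be g \<phi> \<or> good_pair f a b e al be (opp g) \<phi>"
proof (cases "be \<cdot> al = e")
  case False
  then show ?thesis
    using al'_be' good_pair_bicyclic pair_bij.good_pair_bicyclic[OF pair_bij_opp_right] by auto
next
  case grp: True
  note inv = al'_be'_group[OF grp]
  have left: "good_pair f a b e al be g \<phi>"
    if "e' \<odot> a' = a'" "a' \<odot> e' = al'" "b' \<odot> e' = b'" "e' \<odot> b' = be'"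
    using that inv by (intro good_pairI)
  have right: "good_pair f a b e al be (opp g) \<phi>"
    if "e' \<odot> a' = al'" "a' \<odot> e' = a'" "b' \<odot> e' = be'" "e' \<odot> b' = b'"
    using that inv by (intro pair_bij.good_pairI[OF pair_bij_opp_right]) simp_all
  have aB: "e' \<odot> a' = a' \<and> a' \<odot> e' = a' \<and> al' = a'" if "a \<in> B"
    using image_B_unit[OF that] idem_a_B that by simp
  have bB: "e' \<odot> b' = b' \<and> b' \<odot> e' = b' \<and> be' = b'" if "b \<in> B"
    using image_B_unit[OF that] unit(1)[OF that] be by simp
  show ?thesis
    using a'_cases
  proof
    assume A: "e' \<odot> a' = a' \<and> a' \<odot> e' = al'"
    show ?thesis
      using b'_cases
    proof
      assume "b' \<odot> e' = b' \<and> e' \<odot> b' = be'"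
      then show ?thesis using A left by simp
    next
      assume "b' \<odot> e' = be' \<and> e' \<odot> b' = b'"
      then show ?thesis using not_left_unit[OF grp] A aB bB left right by metis
    qed
  next
    assume A: "e' \<odot> a' = al' \<and> a' \<odot> e' = a'"
    show ?thesis
      using b'_cases
    proof
      assume B: "b' \<odot> e' = b' \<and> e' \<odot> b' = be'"
      have "a \<notin> B \<Longrightarrow> b \<notin> B \<Longrightarrow> False"
        using pair_bij.not_left_unit[OF pair_bij_opp_right grp] A B by simp
      then show ?thesis using A B aB bB left right by metis
    next
      assume "b' \<odot> e' = be' \<and> e' \<odot> b' = b'"
      then show ?thesis using A right by simp
    qed
  qed
qed

theorem hom_or_antihom:
  "(\<forall>x y. \<phi> (x \<cdot> y) = \<phi> x \<odot> \<phi> y) \<or> (\<forall>x y. \<phi> (x \<cdot> y) = \<phi> y \<odot> \<phi> x)"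
  using good_orientation
proof
  assume "good_pair f a b e al be g \<phi>"
  from good_pair.phi_mult[OF this] show ?thesis by simp
next
  assume "good_pair f a b e al be (opp g) \<phi>"
  from good_pair.phi_mult[OF this] show ?thesis by simp
qed

end

section \<open>Passage from the type class formulation\<close>

lemma (in semigroup) infinite_gen_aperiodic:
  assumes "infinite (gen f {x})"
  shows "aperiodic f x"
proof (rule ccontr)
  assume "\<not> aperiodic f x"
  then obtain i j where ij: "1 \<le> i" "i < j" "pw f x i = pw f x j"
    unfolding aperiodic_def inj_on_def by (metis atLeast_iff linorder_neqE_nat)
  have "pw f x n \<in> pw f x ` {1..<j}" if "n \<ge> 1" for n
    using that
  proof (induction n rule: nat_induct_at_least)
    case base
    show ?case using ij by (intro image_eqI[of _ _ 1]) auto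
  next
    case (Suc n)
    then obtain m where m: "pw f x n = pw f x m" "1 \<le> m" "m < j" by auto
    then have *: "pw f x (Suc n) = pw f x (Suc m)" using Suc by (simp add: pw_Suc)
    show ?case
    proof (cases "Suc m = j")
      case True
      then have "pw f x (Suc n) = pw f x i" using * ij by simp
      then show ?thesis using ij by (intro image_eqI[of _ _ i]) auto
    next
      case False
      then show ?thesis using * m by (intro image_eqI[of _ _ "Suc m"]) auto
    qed
  qed
  then have "gen f {x} \<subseteq> pw f x ` {1..<j}" by (auto simp: gen_single)
  then have "finite (gen f {x})" by (rule finite_subset) simp
  then show False using assms by simp
qed

lemma subsemigroup_iff_closed: "subsemigroup U \<longleftrightarrow> closed (*) U"
  by (simp add: subsemigroup_def closed_def)

lemma generated_eq_gen: "generated X = gen (*) X"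
proof -
  have "subsemigroup = closed (*)" by (simp add: fun_eq_iff subsemigroup_iff_closed)
  then show ?thesis unfolding generated_def gen_def by (rule arg_cong)
qed

text \<open>An x with e R x and x L ef exists because S is bisimple; the first letters of a word for x decide
  which of the two cases holds.\<close>

lemma bisimple_relation:
  fixes a b :: "'a::semigroup_mult"
  assumes orth: "orthodox_semigroup TYPE('a)" and bis: "bisimple TYPE('a)"
    and inv: "mutually_inverse a b" and gen: "generated {a, b} = UNIV"
  shows "a * a * b * b = a * b \<or> b * b * a * a = b * a"
proof -
  have aba: "a * (b * a) = a" and bab: "b * (a * b) = b"
    using inv by (simp_all add: mutually_inverse_def mult.assoc)
  have aba': "a * (b * (a * z)) = a * z" and bab': "b * (a * (b * z)) = b * z" for z
    using aba bab by (metis mult.assoc)+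
  note red = mult.assoc aba bab aba' bab'
  define e where "e = a * b"
  define h where "h = b * a"
  have ee: "e * e = e" and hh: "h * h = h" by (simp_all add: e_def h_def red)
  have idem: "e * h * (e * h) = e * h" "h * e * (h * e) = h * e"
    using orth ee hh by (auto simp: orthodox_semigroup_def idempotents_def subsemigroup_def)
  \<comment> \<open>By aba = a, every word equals a or ab or begins with b, aa or abb.\<close>
  define W where "W = {a, a * b} \<union> {b, a * a, a * b * b} \<union> {w * s | w s. w \<in> {b, a * a, a * b * b}}"
  have "x * y \<in> W" if "x \<in> W" for x y
  proof -
    have "y \<in> gen (*) {a, b}" using gen by (simp flip: generated_eq_gen)
    then have "\<forall>x\<in>W. x * y \<in> W"
    proof (induction rule: gen_induct)
      case (base y)
      show ?case
      proof
        fix x assume "x \<in> W"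
        then consider "x = a" | "x = a * b" | w where "w \<in> {b, a * a, a * b * b}" "x = w"
          | w s where "w \<in> {b, a * a, a * b * b}" "x = w * s" unfolding W_def by blast
        then show "x * y \<in> W"
        proof cases
          case 1
          then show ?thesis using base by (auto simp: W_def)
        next
          case 2
          then show ?thesis using base by (auto simp: W_def red)
        next
          case 3
          then show ?thesis unfolding W_def by blast
        next
          case 4
          then have "x * y = w * (s * y)" by (simp add: mult.assoc)
          then show ?thesis using 4 unfolding W_def by blast
        qed
      qed
    next
      case (mult y z)
      then show ?case by (simp flip: mult.assoc)
    qed
    then show ?thesis using that by blast
  qed
  then have "closed (*) W" by (simp add: closed_def)
  then have "gen (*) {a, b} \<subseteq> W" by (rule gen_minimal) (simp add: W_def)
  then have W: "x \<in> W" for x using gen by (auto simp: generated_eq_gen)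
  have "(e * h, e) \<in> green_D" using bis by (simp add: bisimple_def)
  then obtain x where L: "principal_left_ideal (e * h) = principal_left_ideal x"
    and R: "principal_right_ideal x = principal_right_ideal e"
    by (auto simp: green_D_def green_L_def green_R_def)
  have "e \<in> principal_right_ideal x" unfolding R by (simp add: principal_right_ideal_def)
  then have "e = x \<or> (\<exists>t. e = x * t)" by (auto simp: principal_right_ideal_def)
  then obtain t where t: "e = x * t" using ee by metis
  have "x \<in> principal_left_ideal (e * h)" unfolding L by (simp add: principal_left_ideal_def)
  then have x: "x * (e * h) = x" using idem(1) by (auto simp: principal_left_ideal_def mult.assoc)
  have "\<exists>t. e = w * t" if "w \<in> {b, a * a, a * b * b}" "x = w \<or> (\<exists>s. x = w * s)" for w
    using that t by (auto simp: mult.assoc)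
  then consider "x = a" | "x = a * b" | s where "e = b * s" | s where "e = a * a * s" | s where "e = a * b * b * s"
    using W[of x] unfolding W_def by blast
  \<comment> \<open>These are the two relations of the conclusion in terms of idempotents:
    multiplying the first by a and b on the outside gives aabb = ab, and multiplying the second by b
    and a gives bbaa = ba.\<close>
  then have "h * e * h = h \<or> e * h * e = e"
  proof cases
    case 1
    then have "b * (a * (e * h)) = b * a" using x by simp
    then show ?thesis by (simp add: h_def mult.assoc)
  next
    case 2
    then have "e * h = e" using x ee by (simp add: e_def[symmetric] flip: mult.assoc)
    then show ?thesis using ee by simp
  next
    case (3 s)
    then have "h * e = e" by (simp add: h_def red)
    then show ?thesis using ee by (simp add: mult.assoc)
  next
    case (4 s)
    have "h = b * e * a" by (simp add: h_def e_def red)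
    also have "\<dots> = b * (a * a * s) * a" by (simp only: 4)
    also have "\<dots> = h * e * (a * s * a)" by (simp add: h_def e_def red)
    finally have h: "h = h * e * (a * s * a)" .
    have "h * e * h = h * e * (h * e) * (a * s * a)" by (subst h) (simp add: mult.assoc)
    also have "\<dots> = h" by (simp only: idem(2) flip: h)
    finally show ?thesis by simp
  next
    case (5 s)
    have "e * h * (b * s) = a * b * b * s" by (simp add: h_def e_def red)
    with 5 have e: "e = e * h * (b * s)" by (rule trans[OF _ sym])
    have "e * h * e = e * h * (e * h * (b * s))" using e by (rule arg_cong)
    also have "\<dots> = e * h * (e * h) * (b * s)" by (simp only: mult.assoc)
    also have "\<dots> = e" by (simp only: idem(1) flip: e)
    finally show ?thesis by simp
  qed
  then show ?thesis
  proof
    assume "h * e * h = h"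
    then have "a * (h * e * h) * b = a * h * b" by simp
    then show ?thesis by (simp add: h_def e_def red)
  next
    assume "e * h * e = e"
    then have "b * (e * h * e) * a = b * e * a" by simp
    then show ?thesis by (simp add: h_def e_def red)
  qed
qed

lemma lattice_determined:
  fixes a b :: "'a::semigroup_mult" and \<Phi> :: "'a set \<Rightarrow> 'b::semigroup_mult set"
  assumes inv: "mutually_inverse a b" and gen: "generated {a, b} = UNIV"
    and inf: "infinite_order a" and rel: "a * a * b * b = a * b"
    and iso: "lattice_isomorphism \<Phi>"
  shows "\<exists>\<phi>::'a \<Rightarrow> 'b. (isomorphism \<phi> \<or> antiisomorphism \<phi>) \<and>
           (\<forall>U. subsemigroup U \<longrightarrow> \<Phi> U = \<phi> ` U)"
proof -
  have sg: "semigroup ((*) :: 'a \<Rightarrow> 'a \<Rightarrow> 'a)" "semigroup ((*) :: 'b \<Rightarrow> 'b \<Rightarrow> 'b)"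
    by (rule mult.semigroup_axioms)+
  have op: "orthodox_pair (*) a b (a * b) (a * (a * b)) (a * b * b)"
  proof (intro orthodox_pair.intro orthodox_pair_axioms.intro sg)
    show "a * (a * b) * (a * b * b) = a * b"
      using rel inv by (simp add: mutually_inverse_def) (metis mult.assoc)
    show "gen (*) {a, b} = UNIV" using gen by (simp add: generated_eq_gen)
    show "aperiodic (*) a"
      using inf semigroup.infinite_gen_aperiodic[OF sg(1)]
      by (simp add: infinite_order_def generated_eq_gen)
  qed (use inv in \<open>simp_all add: mutually_inverse_def mult.assoc\<close>)
  interpret L: lattice_iso "(*)" "(*)" \<Phi>
    using iso unfolding lattice_isomorphism_iff_order subsemigroup_iff_closed
    by (intro lattice_iso.intro lattice_iso_axioms.intro sg) auto
  have S: "x * x = x \<or> aperiodic (*) x" for x :: 'a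
    by (rule orthodox_pair.idem_or_aperiodic_all[OF op])
  obtain \<phi> where \<phi>: "bij \<phi>" "\<And>U. closed (*) U \<Longrightarrow> \<Phi> U = \<phi> ` U"
    using L.induced_by_bijection[OF S] by blast
  have cl: "closed (*) U \<longleftrightarrow> closed (*) (\<phi> ` U)" for U
  proof
    assume "closed (*) U"
    then show "closed (*) (\<phi> ` U)" using L.closed_img \<phi>(2) by metis
  next
    assume c: "closed (*) (\<phi> ` U)"
    then have "\<phi> ` U = \<phi> ` L.\<Psi> (\<phi> ` U)" using L.img_inv L.inv_closed \<phi>(2) by metis
    then have "U = L.\<Psi> (\<phi> ` U)" using \<phi>(1) by (simp add: inj_image_eq_iff bij_is_inj)
    then show "closed (*) U" using L.inv_closed[OF c] by simp
  qed
  have "pair_bij (*) a b (a * b) (a * (a * b)) (a * b * b) (*) \<phi>"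
    by (intro pair_bij.intro op closure_bij.intro closure_bij_axioms.intro sg \<phi>(1) cl S
        L.idem_or_aperiodic_image)
  from pair_bij.hom_or_antihom[OF this] have "isomorphism \<phi> \<or> antiisomorphism \<phi>"
    using \<phi>(1) by (simp add: isomorphism_def antiisomorphism_def)
  then show ?thesis using \<phi>(2) by (auto simp: subsemigroup_iff_closed)
qed

theorem theorem3p1:
  fixes a b :: "'a::semigroup_mult"
    and \<Phi> :: "'a set \<Rightarrow> 'b::semigroup_mult set"
  assumes "orthodox_semigroup TYPE('a)"
    and "bisimple TYPE('a)"
    and "mutually_inverse a b"
    and "generated {a, b} = UNIV"
    and "infinite_order a"
    and "infinite_order b"
    and "lattice_isomorphism \<Phi>"
  shows "\<exists>\<phi>::'a \<Rightarrow> 'b. (isomorphism \<phi> \<or> antiisomorphism \<phi>) \<and>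
           (\<forall>U. subsemigroup U \<longrightarrow> \<Phi> U = \<phi> ` U)"
  using bisimple_relation[OF assms(1-4)]
proof
  assume "a * a * b * b = a * b"
  with assms show ?thesis by (intro lattice_determined)
next
  assume "b * b * a * a = b * a"
  moreover have "mutually_inverse b a" using assms(3) by (simp add: mutually_inverse_def)
  moreover have "generated {b, a} = UNIV" using assms(4) by (simp add: insert_commute)
  ultimately show ?thesis using assms by (intro lattice_determined)
qed

end
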